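(* Let $n\ge 2$ and $\delta\in\{\mathrm I,\mathrm D,\mathrm U,\mathrm X\}^n$ with $\delta_1=\delta_n=\mathrm I$. The set of $\delta$-permutrees on $n$ nodes is in bijection with the set of maximal cliques of pairwise coherent routes of the framed graph $\mathrm{Bic}_\delta$ (with its inherited framing).
   Context: Decorations: $\mathrm I$ (one parent, one child), $\mathrm D$ (one parent, two children), $\mathrm U$ (two parents, one child), $\mathrm X$ (two parents, two children). A $\delta$-permutree is a directed tree on nodes $v_1,\dots,v_n$ (dangling leaf/root edges allowed, so a slot may be empty) where $v_i$ has two parent slots if $\delta_i\in\{\mathrm U,\mathrm X\}$ (one otherwise) and two child slots if $\delta_i\in\{\mathrm D,\mathrm X\}$ (one otherwise); removing $v_i$, each slot gives a (possibly empty) subtree, and with two children (resp. parents) the left descendant (resp. ancestor) subtree has labels $<i$ and the right one labels $>i$. The oruga graph $\mathcal O_n$ has vertices $v_0,\dots,v_n$ and, for $i\in[n]$, a bump $e^i_0$ and a dip $e^i_1$ from $v_{n-i}$ to $v_{n+1-i}$, framed by: incoming edges at $v_{n+1-i}$ ordered $e^i_0\prec e^i_1$, outgoing edges at $v_{n+1-i}$ ordered $e^{i-1}_0\prec e^{i-1}_1$. An M-move on an edge $e=(v_a,v_{a+1})$ removes $e$ and adds $(v_0,v_{a+1})$, which takes the place of $e$ in the incoming order at $v_{a+1}$, and $(v_a,v_n)$, which takes the place of $e$ in the outgoing order at $v_a$ (inherited framing). $\mathrm{Bic}_\delta$ is obtained from $\mathcal O_n$ by M-moves on $e^i_0$ for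 each $i$ with $\delta_i\in\{\mathrm U,\mathrm X\}$ and on $e^i_1$ for each $i$ with $\delta_i\in\{\mathrm D,\mathrm X\}$. Routes are directed paths from $v_0$ to $v_n$. Two routes $P,Q$ are coherent if for every maximal common subpath from $v_a$ to $v_b$ (possibly $a=b$) with $v_a\ne v_0$ and $v_b\ne v_n$, $P$'s edge entering $v_a$ precedes $Q$'s in the incoming order at $v_a$ iff $P$'s edge leaving $v_b$ precedes $Q$'s in the outgoing order at $v_b$. A clique is a set of pairwise coherent routes; maximal means maximal under inclusion. *)

theory Defs
  imports "Graph_Theory.Graph_Theory"
begin

section \<open>Directed trees\<close>

text \<open>
  In \<^term>\<open>bidirected G\<close> every arc of \<open>G\<close> may be traversed both ways; the flag says
  whether it is traversed forwards. A cycle of the underlying undirected multigraph of \<open>G\<close> is a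
  cycle here that uses no arc of \<open>G\<close> twice, so loops, parallel arcs and antiparallel arcs of \<open>G\<close>
  all give cycles. (The constants \<open>forest\<close> and \<open>tree\<close> of the library only forbid directed cycles
  and are therefore not suitable.)
\<close>

definition bidirected :: "('a, 'b) pre_digraph \<Rightarrow> ('a, 'b \<times> bool) pre_digraph" where
  "bidirected G =
     \<lparr> verts = verts G, arcs = arcs G \<times> UNIV,
       tail = (\<lambda>(e, fwd). if fwd then tail G e else head G e),
       head = (\<lambda>(e, fwd). if fwd then head G e else tail G e) \<rparr>"

definition directed_tree :: "('a, 'b) pre_digraph \<Rightarrow> bool" where
  "directed_tree G \<longleftrightarrow>
     wf_digraph G \<and> connected G \<and>
     \<not> (\<exists>p. pre_digraph.cycle (bidirected G) p \<and> distinct (map fst p))"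

section \<open>Permutrees\<close>

datatype decoration = I | D | U | X

datatype slot = Single | LeftSlot | RightSlot

definition parent_slots :: "decoration \<Rightarrow> slot set" where
  "parent_slots d = (if d \<in> {U, X} then {LeftSlot, RightSlot} else {Single})"

definition child_slots :: "decoration \<Rightarrow> slot set" where
  "child_slots d = (if d \<in> {D, X} then {LeftSlot, RightSlot} else {Single})"

text \<open>
  The node \<open>v\<^sub>i\<close> is the number \<open>i\<close>. An edge joins a child to one of its parents and records the
  parent slot of the child and the child slot of the parent that it occupies. A permutree is
  given by its set of edges between nodes; dangling edges are the slots occupied by no edge.
\<close>

datatype tree_edge =
  TreeEdge (child: nat) (parent_slot: slot) (parent: nat) (child_slot: slot)

definition tree_digraph :: "nat \<Rightarrow> tree_edge set \<Rightarrow> (nat, tree_edge) pre_digraph" where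
  "tree_digraph n T = \<lparr> verts = {1..n}, arcs = T, tail = child, head = parent \<rparr>"

text \<open>
  The labels of the subtree containing the neighbour \<open>j\<close> of \<open>i\<close> once \<open>i\<close> is removed.
\<close>

definition subtree_at :: "nat \<Rightarrow> tree_edge set \<Rightarrow> nat \<Rightarrow> nat \<Rightarrow> nat set" where
  "subtree_at n T i j =
     {k. j \<rightarrow>\<^sup>*\<^bsub>with_proj (mk_symmetric (pre_digraph.del_vert (tree_digraph n T) i))\<^esub> k}"

fun slot_condition :: "nat \<Rightarrow> slot \<Rightarrow> nat set \<Rightarrow> bool" where
  "slot_condition i Single S \<longleftrightarrow> True"
| "slot_condition i LeftSlot S \<longleftrightarrow> (\<forall>k\<in>S. k < i)"
| "slot_condition i RightSlot S \<longleftrightarrow> (\<forall>k\<in>S. i < k)"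

definition permutrees :: "nat \<Rightarrow> (nat \<Rightarrow> decoration) \<Rightarrow> tree_edge set set" where
  "permutrees n \<delta> =
     {T. directed_tree (tree_digraph n T) \<and>
         (\<forall>e\<in>T. parent_slot e \<in> parent_slots (\<delta> (child e)) \<and>
                child_slot e \<in> child_slots (\<delta> (parent e))) \<and>
         inj_on (\<lambda>e. (child e, parent_slot e)) T \<and>
         inj_on (\<lambda>e. (parent e, child_slot e)) T \<and>
         (\<forall>e\<in>T. slot_condition (child e) (parent_slot e) (subtree_at n T (child e) (parent e)) \<and>
                slot_condition (parent e) (child_slot e) (subtree_at n T (parent e) (child e)))}"

section \<open>Framed graphs, routes and cliques\<close>

text \<open>
  \<^term>\<open>(e, f) \<in> in_order F v\<close> means that \<open>e\<close> strictly precedes \<open>f\<close> among the edges entering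
  \<open>v\<close>, and likewise for \<open>out_order\<close> and the edges leaving \<open>v\<close>. These orders only matter at
  vertices other than the source and the sink.
\<close>

record ('v, 'e) framed_graph =
  dgraph :: "('v, 'e) pre_digraph"
  source :: 'v
  sink :: 'v
  in_order :: "'v \<Rightarrow> ('e \<times> 'e) set"
  out_order :: "'v \<Rightarrow> ('e \<times> 'e) set"

definition routes :: "('v, 'e) framed_graph \<Rightarrow> 'e list set" where
  "routes F = {P. pre_digraph.apath (dgraph F) (source F) P (sink F)}"

text \<open>
  A subpath is a triple of its first vertex, its list of edges and its last vertex; the vertices
  are needed because the list is empty for a one-vertex subpath.
\<close>

definition subpath_of :: "('v, 'e) framed_graph \<Rightarrow> 'v \<times> 'e list \<times> 'v \<Rightarrow> 'e list \<Rightarrow> bool" where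
  "subpath_of F = (\<lambda>(a, R, b) P. \<exists>P1 P2. P = P1 @ R @ P2 \<and>
     pre_digraph.awalk (dgraph F) (source F) P1 a \<and>
     pre_digraph.awalk (dgraph F) a R b \<and>
     pre_digraph.awalk (dgraph F) b P2 (sink F))"

definition extends_path ::
    "('v, 'e) framed_graph \<Rightarrow> 'v \<times> 'e list \<times> 'v \<Rightarrow> 'v \<times> 'e list \<times> 'v \<Rightarrow> bool" where
  "extends_path F = (\<lambda>(a', R', b') (a, R, b). \<exists>S1 S2. R' = S1 @ R @ S2 \<and>
     pre_digraph.awalk (dgraph F) a' S1 a \<and>
     pre_digraph.awalk (dgraph F) b S2 b')"

definition max_common_subpath ::
    "('v, 'e) framed_graph \<Rightarrow> 'e list \<Rightarrow> 'e list \<Rightarrow> 'v \<times> 'e list \<times> 'v \<Rightarrow> bool" where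
  "max_common_subpath F P Q s \<longleftrightarrow>
     subpath_of F s P \<and> subpath_of F s Q \<and>
     (\<forall>s'. subpath_of F s' P \<and> subpath_of F s' Q \<and> extends_path F s' s \<longrightarrow> s' = s)"

text \<open>
  A route has exactly one edge entering each of its vertices other than the source, and exactly
  one edge leaving each of its vertices other than the sink.
\<close>

definition coherent :: "('v, 'e) framed_graph \<Rightarrow> 'e list \<Rightarrow> 'e list \<Rightarrow> bool" where
  "coherent F P Q \<longleftrightarrow>
     (\<forall>a R b. max_common_subpath F P Q (a, R, b) \<and> a \<noteq> source F \<and> b \<noteq> sink F \<longrightarrow>
       (\<forall>eP\<in>set P. \<forall>eQ\<in>set Q. \<forall>fP\<in>set P. \<forall>fQ\<in>set Q.
          head (dgraph F) eP = a \<and> head (dgraph F) eQ = a \<and>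
          tail (dgraph F) fP = b \<and> tail (dgraph F) fQ = b \<longrightarrow>
          ((eP, eQ) \<in> in_order F a \<longleftrightarrow> (fP, fQ) \<in> out_order F b)))"

definition clique :: "('v, 'e) framed_graph \<Rightarrow> 'e list set \<Rightarrow> bool" where
  "clique F C \<longleftrightarrow> C \<subseteq> routes F \<and> pairwise (coherent F) C"

definition maximal_cliques :: "('v, 'e) framed_graph \<Rightarrow> 'e list set set" where
  "maximal_cliques F = {C. clique F C \<and> (\<forall>C'. clique F C' \<and> C \<subseteq> C' \<longrightarrow> C' = C)}"

section \<open>The oruga graph, M-moves and the bicho graph\<close>

text \<open>
  \<^term>\<open>Bump i\<close> and \<^term>\<open>Dip i\<close> are the edges \<open>e\<^sup>i\<^sub>0\<close> and \<open>e\<^sup>i\<^sub>1\<close> of the oruga graph;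
  \<^term>\<open>FromSource e\<close> and \<^term>\<open>ToSink e\<close> name the two edges by which an M-move replaces \<open>e\<close>.
\<close>

datatype edge = Bump nat | Dip nat | FromSource edge | ToSink edge

definition oruga :: "nat \<Rightarrow> (nat, edge) framed_graph" where
  "oruga n =
     \<lparr> dgraph =
         \<lparr> verts = {0..n}, arcs = Bump ` {1..n} \<union> Dip ` {1..n},
           tail = (\<lambda>e. case e of Bump i \<Rightarrow> n - i | Dip i \<Rightarrow> n - i | _ \<Rightarrow> undefined),
           head = (\<lambda>e. case e of Bump i \<Rightarrow> n + 1 - i | Dip i \<Rightarrow> n + 1 - i | _ \<Rightarrow> undefined) \<rparr>,
       source = 0, sink = n,
       in_order = (\<lambda>v. {(Bump i, Dip i) | i. i \<in> {1..n} \<and> v = n + 1 - i}),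
       out_order = (\<lambda>v. {(Bump (i - 1), Dip (i - 1)) | i. i \<in> {2..n} \<and> v = n + 1 - i}) \<rparr>"

definition m_move :: "edge \<Rightarrow> ('v, edge) framed_graph \<Rightarrow> ('v, edge) framed_graph" where
  "m_move e F = (let G = dgraph F; a = tail G e; b = head G e in
     \<lparr> dgraph =
         \<lparr> verts = verts G, arcs = (arcs G - {e}) \<union> {FromSource e, ToSink e},
           tail = (tail G)(FromSource e := source F, ToSink e := a),
           head = (head G)(FromSource e := b, ToSink e := sink F) \<rparr>,
       source = source F, sink = sink F,
       in_order = (in_order F)
         (b := map_prod (id(e := FromSource e)) (id(e := FromSource e)) ` in_order F b),
       out_order = (out_order F)
         (a := map_prod (id(e := ToSink e)) (id(e := ToSink e)) ` out_order F a) \<rparr>)"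

text \<open>The M-moves below act on distinct edges of the oruga graph, so they commute.\<close>

definition bicho :: "nat \<Rightarrow> (nat \<Rightarrow> decoration) \<Rightarrow> (nat, edge) framed_graph" where
  "bicho n \<delta> =
     fold m_move
       (map Bump (filter (\<lambda>i. \<delta> i \<in> {U, X}) [1..<n + 1]) @
        map Dip (filter (\<lambda>i. \<delta> i \<in> {D, X}) [1..<n + 1]))
       (oruga n)"

end

theory Submission
  imports Defs
begin

text \<open>
  Both sides are built up by adding the largest label. In a permutree the node \<open>n + 1\<close> must be
  inserted into the upward path \<open>w\<close> of the nodes visible from the right, so there are \<open>|w| + 1\<close>
  choices; a split \<open>w = u v\<close> makes the new visible path \<open>u (n + 1) v\<close>, where \<open>u\<close> disappears if
  \<open>n + 1\<close> gets two child slots and \<open>v\<close> disappears if it gets two parent slots.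

  A route is a word in bumps and dips, read from a cut (or an end of the graph) to the next one, and
  two routes are coherent iff their words are pointwise comparable on their common range. The
  words of a maximal clique that use the largest label \<open>n\<close> are totally ordered. Adding the label
  \<open>n + 1\<close> cuts them at \<open>n\<close> according to the decoration of \<open>n\<close>, and what remains is prefixed with the bump
  up to some pivot and with the dip from the pivot on. The choices of the pivot obey the same
  recursion as the splits \<open>w = u v\<close>, so both sides are in bijection with the same codes.
\<close>

section \<open>Codes\<close>

text \<open>Neither side offers a direct map to the other: a fibre on the clique side is a choice of
  rank in a chain, a fibre on the tree side a choice of gap in a path, and what they share is their
  number. Both meanings of a decoration enter through \<open>cut_at\<close>:
  \<open>cut_at \<delta> i True\<close> says that the dip of i is cut and that node i has two child
  slots, \<open>cut_at \<delta> i False\<close> that the bump is cut and that it has two parent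
  slots. The largest label is a good recursion variable because all other labels lie to its left.
  Its right slots are empty, so it has at most one child and one parent: it subdivides an edge or
  fills a dangling slot. It must not land in a left subtree of another node, and the gaps of the
  visible path are the places where this does not happen. On the clique side a cut shrinks all words
  through that letter to a single tail, because a route leaves for the sink there. A decoration
  takes effect only when the next label arrives; this fits \<open>\<delta> n = I\<close>. The
  assumption \<open>\<delta> 1 = I\<close> keeps the one-letter tails produced by a cut apart from
  the words of the previous level.\<close>

definition cut_at :: "(nat \<Rightarrow> decoration) \<Rightarrow> nat \<Rightarrow> bool \<Rightarrow> bool" where
  "cut_at \<delta> i b \<longleftrightarrow> \<delta> i \<in> (if b then {D, decoration.X} else {U, decoration.X})"

text \<open>Without cuts, the entry (a, b) of the label k belongs to a visible path with a + b - 1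
  nodes, hence with a + b gaps, both ends included. A cut replaces |u| + 1 or |v| + 1 by 1; on the
  clique side it replaces all tails with that letter by a one-letter word.\<close>

definition spots :: "(nat \<Rightarrow> decoration) \<Rightarrow> nat \<Rightarrow> nat \<times> nat \<Rightarrow> nat" where
  "spots \<delta> k s = (if cut_at \<delta> k True then 1 else fst s) + (if cut_at \<delta> k False then 1 else snd s)"

text \<open>
  An entry \<open>(a, b)\<close> of a code means \<open>a = |u| + 1\<close>, \<open>b = |v| + 1\<close> for the split of the visible path, and
  that \<open>a\<close> words of the clique start with the dip and \<open>b\<close> words with the bump of the largest label.
\<close>

primrec codes :: "(nat \<Rightarrow> decoration) \<Rightarrow> nat \<Rightarrow> (nat \<times> nat) list set" where
  "codes \<delta> 0 = {[(1, 1)]}"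
| "codes \<delta> (Suc m) =
     {(a, b) # c | a b c. c \<in> codes \<delta> m \<and> 1 \<le> a \<and> 1 \<le> b \<and> a + b = Suc (spots \<delta> (Suc m) (hd c))}"

text \<open>The admissible heads depend on \<open>x\<close> only through \<open>stat x\<close>,
  which is the head of its code. So bijections from the fibres of \<open>par\<close> onto these
  heads extend a bijection by one level, whatever the objects are.\<close>

lemma bij_betw_codes_step:
  assumes f: "bij_betw f A (codes \<delta> m)" and hd_f: "\<And>x. x \<in> A \<Longrightarrow> hd (f x) = stat x"
    and par: "\<And>y. y \<in> B \<Longrightarrow> par y \<in> A"
    and fib: "\<And>x. x \<in> A \<Longrightarrow> bij_betw stat' {y \<in> B. par y = x}
        {(a, b). 1 \<le> a \<and> 1 \<le> b \<and> a + b = Suc (spots \<delta> (Suc m) (stat x))}"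
  shows "bij_betw (\<lambda>y. stat' y # f (par y)) B (codes \<delta> (Suc m))"
proof (rule bij_betw_imageI)
  show "inj_on (\<lambda>y. stat' y # f (par y)) B"
  proof (rule inj_onI)
    fix y z assume y: "y \<in> B" and z: "z \<in> B" and eq: "stat' y # f (par y) = stat' z # f (par z)"
    then have "par y = par z"
      using f par by (auto simp: bij_betw_def inj_on_def)
    then show "y = z"
      using fib[OF par[OF y]] y z eq by (auto simp: bij_betw_def inj_on_def)
  qed
  have "stat' y # f (par y) \<in> codes \<delta> (Suc m)" if y: "y \<in> B" for y
  proof -
    have "stat' y \<in> {(a, b). 1 \<le> a \<and> 1 \<le> b \<and> a + b = Suc (spots \<delta> (Suc m) (stat (par y)))}"
      by (rule bij_betw_apply[OF fib[OF par[OF y]]]) (simp add: y)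
    moreover have "f (par y) \<in> codes \<delta> m"
      using f par[OF y] by (rule bij_betw_apply)
    ultimately show ?thesis
      using hd_f[OF par[OF y]] by auto
  qed
  moreover have "\<exists>y\<in>B. c = stat' y # f (par y)" if c: "c \<in> codes \<delta> (Suc m)" for c
  proof -
    obtain a b c' where c': "c = (a, b) # c'" "c' \<in> codes \<delta> m" "1 \<le> a" "1 \<le> b"
      "a + b = Suc (spots \<delta> (Suc m) (hd c'))"
      using c by auto
    obtain x where x: "x \<in> A" "c' = f x"
      using f c'(2) by (auto simp: bij_betw_def)
    have "(a, b) \<in> stat' ` {y \<in> B. par y = x}"
      using fib[OF x(1)] c' x hd_f[OF x(1)] unfolding bij_betw_def by auto
    then show ?thesis
      using c'(1) x(2) by auto
  qed
  ultimately show "(\<lambda>y. stat' y # f (par y)) ` B = codes \<delta> (Suc m)"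
    by (simp only: set_eq_iff image_iff) blast
qed

section \<open>Maximal cliques of words\<close>

text \<open>
  A route is recorded by its letters \<open>(i, b)\<close>, where \<open>b = False\<close> for the bump and \<open>b = True\<close> for the
  dip with index \<open>i\<close>, in descending order of \<open>i\<close>. At level \<open>m\<close> the labels are \<open>1, \<dots>, Suc m\<close>, and the
  decoration of \<open>Suc m\<close> is treated as \<open>I\<close>.
\<close>

type_synonym word = "(nat \<times> bool) list"

definition lt :: "word \<Rightarrow> word \<Rightarrow> bool" where
  "lt P Q \<longleftrightarrow> (\<exists>i. (i, False) \<in> set P \<and> (i, True) \<in> set Q)"

definition coh :: "word \<Rightarrow> word \<Rightarrow> bool" where
  "coh P Q \<longleftrightarrow> \<not> (lt P Q \<and> lt Q P)"

text \<open>These are the words of the walks from the vertex n - i to the sink. A cut letter stands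
  here for the edge \<open>ToSink\<close>, after which nothing can follow.\<close>

primrec suffixes :: "(nat \<Rightarrow> decoration) \<Rightarrow> nat \<Rightarrow> word set" where
  "suffixes \<delta> 0 = {[]}"
| "suffixes \<delta> (Suc i) =
     {(Suc i, b) # h | b h. h \<in> (if cut_at \<delta> (Suc i) b then {[]} else suffixes \<delta> i)}"

definition top_words :: "(nat \<Rightarrow> decoration) \<Rightarrow> nat \<Rightarrow> word set" where
  "top_words \<delta> m = {(Suc m, b) # h | b h. h \<in> suffixes \<delta> m}"

text \<open>As the first letter of a route a cut letter stands for the edge
  \<open>FromSource\<close>. This edge enters an ordinary vertex, so the word goes on, unlike in
  \<open>suffixes\<close>.\<close>

definition low_words :: "(nat \<Rightarrow> decoration) \<Rightarrow> nat \<Rightarrow> word set" where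
  "low_words \<delta> m = {(Suc s, b) # h | s b h. s < m \<and> cut_at \<delta> (Suc s) b \<and> h \<in> suffixes \<delta> s}"

definition words :: "(nat \<Rightarrow> decoration) \<Rightarrow> nat \<Rightarrow> word set" where
  "words \<delta> m = top_words \<delta> m \<union> low_words \<delta> m"

text \<open>Maximality is stated as closure: a word coherent with all members is a member. Since
  every word is coherent with itself, this agrees with maximality under inclusion, and
  \<open>coh\<close> may be demanded of equal pairs as well.\<close>

definition word_cliques :: "(nat \<Rightarrow> decoration) \<Rightarrow> nat \<Rightarrow> word set set" where
  "word_cliques \<delta> m =
     {C. C \<subseteq> words \<delta> m \<and> (\<forall>P\<in>C. \<forall>Q\<in>C. coh P Q) \<and>
         (\<forall>P\<in>words \<delta> m. (\<forall>Q\<in>C. coh P Q) \<longrightarrow> P \<in> C)}"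

definition word_stat :: "nat \<Rightarrow> word set \<Rightarrow> nat \<times> nat" where
  "word_stat m C = (card {h. (Suc m, True) # h \<in> C}, card {h. (Suc m, False) # h \<in> C})"

definition functional :: "word \<Rightarrow> bool" where
  "functional P \<longleftrightarrow> (\<forall>i. \<not> ((i, True) \<in> set P \<and> (i, False) \<in> set P))"

section \<open>Coherence and the order of suffixes\<close>

lemma coh_sym: "coh P Q \<longleftrightarrow> coh Q P"
  by (auto simp: coh_def)

lemma suffixes_levels: "h \<in> suffixes \<delta> i \<Longrightarrow> (k, b) \<in> set h \<Longrightarrow> 1 \<le> k \<and> k \<le> i"
  by (induction i arbitrary: h) (auto split: if_splits, fastforce+)

lemma suffixes_functional: "h \<in> suffixes \<delta> i \<Longrightarrow> functional h"
proof (induction i arbitrary: h)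
  case (Suc i)
  obtain b h' where h: "h = (Suc i, b) # h'" "h' \<in> suffixes \<delta> i \<or> h' = []"
    using Suc.prems by (auto split: if_splits)
  with Suc.IH show ?case
    by (auto simp: functional_def dest: suffixes_levels)
qed (auto simp: functional_def)

lemma Cons_functional: "h \<in> suffixes \<delta> i \<Longrightarrow> i < k \<Longrightarrow> functional ((k, b) # h)"
  using suffixes_functional[of h \<delta> i] by (auto simp: functional_def dest: suffixes_levels)

lemma words_functional: "P \<in> words \<delta> m \<Longrightarrow> functional P"
  by (auto simp: words_def top_words_def low_words_def intro: Cons_functional)

lemma coh_refl: "functional P \<Longrightarrow> coh P P"
  by (auto simp: coh_def lt_def functional_def)

text \<open>Incomparability needs two different indices, and \<open>[x]\<close> has only one. This
  is why the one-letter words produced by a cut fit into every clique.\<close>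

lemma coh_single: "functional P \<Longrightarrow> coh P [x]"
  by (cases x) (auto simp: coh_def lt_def functional_def)

lemma low_words_levels: "P \<in> low_words \<delta> m \<Longrightarrow> (k, b) \<in> set P \<Longrightarrow> k \<le> m"
  by (auto simp: low_words_def dest: suffixes_levels)

lemma words_levels: "P \<in> words \<delta> m \<Longrightarrow> (k, b) \<in> set P \<Longrightarrow> k \<le> Suc m"
  using low_words_levels[of P \<delta> m k b]
  by (force simp: words_def top_words_def dest: suffixes_levels)

lemma coh_Cons:
  assumes "\<And>b. (k, b) \<notin> set P"
  shows "coh P ((k, b) # h) \<longleftrightarrow> coh P h"
  using assms by (auto simp: coh_def lt_def)

lemma lt_Cons_Cons:
  assumes "\<And>b. (k, b) \<notin> set h" "\<And>b. (k, b) \<notin> set h'"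
  shows "lt ((k, b) # h) ((k, b') # h') \<longleftrightarrow> \<not> b \<and> b' \<or> lt h h'"
  using assms by (auto simp: lt_def)

lemma finite_suffixes: "finite (suffixes \<delta> i)"
proof (induction i)
  case (Suc i)
  have "suffixes \<delta> (Suc i) \<subseteq> (\<lambda>(b, h). (Suc i, b) # h) ` (UNIV \<times> insert [] (suffixes \<delta> i))"
    by (auto split: if_splits)
  then show ?case
    using Suc.IH finite_surj by (metis finite.insertI finite_SigmaI finite_code)
qed simp

text \<open>On coherent suffixes the relation \<open>lt\<close> is the order of these binary numbers.\<close>

definition val :: "word \<Rightarrow> nat" where
  "val h = (\<Sum>(i, b)\<leftarrow>h. if b then 2 ^ i else 0)"

lemma val_simps [simp]: "val [] = 0" "val ((i, b) # h) = (if b then 2 ^ i else 0) + val h"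
  by (simp_all add: val_def)

lemma val_less: "h \<in> suffixes \<delta> i \<Longrightarrow> val h < 2 ^ Suc i"
proof (induction i arbitrary: h)
  case (Suc i)
  obtain b h' where h: "h = (Suc i, b) # h'" "h' \<in> suffixes \<delta> i \<or> h' = []"
    using Suc.prems by (auto split: if_splits)
  then have "val h' < 2 ^ Suc i"
    using Suc.IH by auto
  then show ?case
    using h by auto
qed simp

text \<open>Whether a word stops is decided by its last letter, so neither of two words of the same
  level is a proper prefix of the other. They part at a common index.\<close>

lemma lt_total: "h \<in> suffixes \<delta> i \<Longrightarrow> h' \<in> suffixes \<delta> i \<Longrightarrow> h \<noteq> h' \<Longrightarrow> lt h h' \<or> lt h' h"
proof (induction i arbitrary: h h')
  case (Suc i)
  obtain b t where h: "h = (Suc i, b) # t" "t \<in> (if cut_at \<delta> (Suc i) b then {[]} else suffixes \<delta> i)"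
    using Suc.prems(1) by auto
  obtain b' t' where h': "h' = (Suc i, b') # t'" "t' \<in> (if cut_at \<delta> (Suc i) b' then {[]} else suffixes \<delta> i)"
    using Suc.prems(2) by auto
  show ?case
  proof (cases "b = b'")
    case True
    then have "t \<in> suffixes \<delta> i" "t' \<in> suffixes \<delta> i" "t \<noteq> t'"
      using h h' Suc.prems(3) by (auto split: if_splits)
    then show ?thesis
      using Suc.IH[of t t'] h h' by (auto simp: lt_def)
  next
    case False
    then show ?thesis
      using h h' by (cases b; cases b') (auto simp: lt_def)
  qed
qed simp

text \<open>The highest index at which the words differ decides the comparison of
  \<open>val\<close>, and coherence forces every other difference at a common index to point the
  same way.\<close>

lemma lt_imp_val_less:
  "h \<in> suffixes \<delta> i \<Longrightarrow> h' \<in> suffixes \<delta> i \<Longrightarrow> coh h h' \<Longrightarrow> lt h h' \<Longrightarrow> val h < val h'"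
proof (induction i arbitrary: h h')
  case (Suc i)
  obtain b t where h: "h = (Suc i, b) # t" "t \<in> (if cut_at \<delta> (Suc i) b then {[]} else suffixes \<delta> i)"
    using Suc.prems(1) by auto
  obtain b' t' where h': "h' = (Suc i, b') # t'" "t' \<in> (if cut_at \<delta> (Suc i) b' then {[]} else suffixes \<delta> i)"
    using Suc.prems(2) by auto
  have *: "\<And>b. (Suc i, b) \<notin> set t" "\<And>b. (Suc i, b) \<notin> set t'"
    using h(2) h'(2) by (auto split: if_splits dest: suffixes_levels)
  \<comment> \<open>All letters of \<open>t\<close> together weigh less than the single dip at
    \<open>Suc i\<close>, even if \<open>t'\<close> is shorter than \<open>t\<close>.\<close>
  have less: "val t < 2 ^ Suc i"
    using h(2) val_less[of t \<delta> i] by (auto split: if_splits)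
  have lt: "\<not> b \<and> b' \<or> lt t t'" and ge: "\<not> (\<not> b' \<and> b) \<and> \<not> lt t' t"
    using Suc.prems(3,4) lt_Cons_Cons[OF *] lt_Cons_Cons[OF *(2,1)]
    by (auto simp: h(1) h'(1) coh_def)
  show ?case
  proof (cases "b = b'")
    case True
    then have "lt t t'" using lt by auto
    then have "t \<in> suffixes \<delta> i" "t' \<in> suffixes \<delta> i"
      using h h' True by (auto split: if_splits simp: lt_def)
    then have "val t < val t'"
      using Suc.IH \<open>lt t t'\<close> ge by (auto simp: coh_def)
    then show ?thesis
      using h h' True by auto
  next
    case False
    then have "\<not> b" "b'" using ge by auto
    then show ?thesis
      using less h h' by auto
  qed
qed (simp add: lt_def)

lemma lt_iff_val_less:
  assumes "h \<in> suffixes \<delta> i" "h' \<in> suffixes \<delta> i" "coh h h'"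
  shows "lt h h' \<longleftrightarrow> val h < val h'"
proof
  assume "val h < val h'"
  then have "h \<noteq> h'" "\<not> lt h' h"
    using lt_imp_val_less[OF assms(2,1)] assms(3) coh_sym by auto
  then show "lt h h'"
    using lt_total assms by blast
qed (use lt_imp_val_less assms in blast)

lemma val_inj:
  assumes "h \<in> suffixes \<delta> i" "h' \<in> suffixes \<delta> i" "coh h h'" "val h = val h'"
  shows "h = h'"
  using lt_total[OF assms(1,2)] lt_imp_val_less[OF assms(1-3)]
    lt_imp_val_less[OF assms(2,1)] assms(3,4) coh_sym by fastforce

section \<open>Passing from one level to the next\<close>

lemma low_words_Suc:
  "low_words \<delta> (Suc m) =
     low_words \<delta> m \<union> {(Suc m, b) # h | b h. cut_at \<delta> (Suc m) b \<and> h \<in> suffixes \<delta> m}"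
  unfolding low_words_def by (auto simp: less_Suc_eq)

lemma suffixes_Suc:
  "suffixes \<delta> (Suc m) =
     {(Suc m, b) # h | b h. \<not> cut_at \<delta> (Suc m) b \<and> h \<in> suffixes \<delta> m} \<union> {[(Suc m, b)] | b. cut_at \<delta> (Suc m) b}"
  by (auto split: if_splits)

text \<open>When a larger label arrives, a word starting with \<open>Suc m\<close> stays a route
  word if its first letter is cut, because an M-move then lets it start at the source. Otherwise it
  survives only as a tail to be prefixed.\<close>

lemma words_Suc: "words \<delta> m \<subseteq> low_words \<delta> (Suc m) \<union> suffixes \<delta> (Suc m)"
  unfolding words_def low_words_Suc suffixes_Suc top_words_def by blast

lemma low_words_Suc_subset: "low_words \<delta> (Suc m) \<subseteq> words \<delta> m"
  unfolding words_def low_words_Suc top_words_def by blast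

declare suffixes.simps(2) [simp del]

lemma Nil_in_suffixes: "[] \<in> suffixes \<delta> m \<longleftrightarrow> m = 0"
  by (cases m) (simp_all add: suffixes_Suc)

text \<open>
  \<open>tops \<delta> m C\<close> is what remains at level \<open>Suc m\<close> of the words of a clique once this level is no
  longer treated as uncut; \<open>ext\<close> prepends level \<open>Suc (Suc m)\<close>, the letter \<open>False\<close> up to the pivot
  \<open>p\<close> and the letter \<open>True\<close> from \<open>p\<close> on.
\<close>

definition tops :: "(nat \<Rightarrow> decoration) \<Rightarrow> nat \<Rightarrow> word set \<Rightarrow> word set" where
  "tops \<delta> m C = {h \<in> suffixes \<delta> (Suc m). h \<in> C \<or> (\<exists>b. h = [(Suc m, b)] \<and> cut_at \<delta> (Suc m) b)}"

definition ext :: "(nat \<Rightarrow> decoration) \<Rightarrow> nat \<Rightarrow> word set \<Rightarrow> word \<Rightarrow> word set" where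
  "ext \<delta> m C p = (C \<inter> low_words \<delta> (Suc m)) \<union>
     {(Suc (Suc m), False) # h | h. h \<in> tops \<delta> m C \<and> val h \<le> val p} \<union>
     {(Suc (Suc m), True) # h | h. h \<in> tops \<delta> m C \<and> val p \<le> val h}"

text \<open>Strips the label added by \<open>ext\<close>. Intersecting with \<open>words\<close>
  drops the one-letter words that \<open>tops\<close> has added; if \<open>\<delta> 1 = I\<close>,
  these are not words of level \<open>m\<close>.\<close>

definition down :: "(nat \<Rightarrow> decoration) \<Rightarrow> nat \<Rightarrow> word set \<Rightarrow> word set" where
  "down \<delta> m C' = {P \<in> words \<delta> m. P \<in> C' \<or> (\<exists>b. (Suc (Suc m), b) # P \<in> C')}"

lemma coh_Cons_Cons:
  assumes "\<And>b. (k, b) \<notin> set h" "\<And>b. (k, b) \<notin> set h'"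
  shows "coh ((k, b) # h) ((k, b') # h') \<longleftrightarrow>
    coh h h' \<and> \<not> (\<not> b \<and> b' \<and> lt h' h) \<and> \<not> (b \<and> \<not> b' \<and> lt h h')"
  using lt_Cons_Cons[OF assms] lt_Cons_Cons[OF assms(2,1)] by (auto simp: coh_def)

text \<open>The origin of the pivot: in a clique every tail after the new bump lies weakly below
  every tail after the new dip. Besides the coherence of the tails this is the only
  constraint.\<close>

lemma coh_suffixes_Cons:
  assumes "h \<in> suffixes \<delta> i" "h' \<in> suffixes \<delta> i"
  shows "coh ((Suc i, b) # h) ((Suc i, b') # h') \<longleftrightarrow>
    coh h h' \<and> (\<not> b \<and> b' \<longrightarrow> val h \<le> val h') \<and> (b \<and> \<not> b' \<longrightarrow> val h' \<le> val h)"
proof -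
  have "coh ((Suc i, b) # h) ((Suc i, b') # h') \<longleftrightarrow>
    coh h h' \<and> \<not> (\<not> b \<and> b' \<and> lt h' h) \<and> \<not> (b \<and> \<not> b' \<and> lt h h')"
    using suffixes_levels[OF assms(1)] suffixes_levels[OF assms(2)] by (intro coh_Cons_Cons) force+
  then show ?thesis
    using lt_iff_val_less[OF assms] lt_iff_val_less[OF assms(2,1)] coh_sym[of h h'] by auto
qed

lemma coh_low_Cons:
  assumes "P \<in> low_words \<delta> (Suc m)"
  shows "coh P ((Suc (Suc m), b) # h) \<longleftrightarrow> coh P h" "coh ((Suc (Suc m), b) # h) P \<longleftrightarrow> coh h P"
  using coh_Cons[of "Suc (Suc m)" P b h] low_words_levels[OF assms] coh_sym by fastforce+

lemma words_Suc_cases: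
  assumes "P \<in> words \<delta> (Suc m)"
  obtains "P \<in> low_words \<delta> (Suc m)"
    | b h where "P = (Suc (Suc m), b) # h" "h \<in> suffixes \<delta> (Suc m)"
  using assms unfolding words_def top_words_def by blast

lemma Cons_in_words_Suc: "h \<in> suffixes \<delta> (Suc m) \<Longrightarrow> (Suc (Suc m), b) # h \<in> words \<delta> (Suc m)"
  by (simp only: words_def top_words_def) blast

lemma Cons_notin_low: "(Suc (Suc m), b) # h \<notin> low_words \<delta> (Suc m)"
  using low_words_levels[of "(Suc (Suc m), b) # h" \<delta> "Suc m" "Suc (Suc m)" b] by auto

lemma word_cliquesD:
  assumes "C \<in> word_cliques \<delta> m"
  shows "C \<subseteq> words \<delta> m" "P \<in> C \<Longrightarrow> Q \<in> C \<Longrightarrow> coh P Q"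
    "P \<in> words \<delta> m \<Longrightarrow> (\<And>Q. Q \<in> C \<Longrightarrow> coh P Q) \<Longrightarrow> P \<in> C"
  using assms unfolding word_cliques_def by blast+

lemma tops_subset: "tops \<delta> m C \<subseteq> suffixes \<delta> (Suc m)"
  unfolding tops_def by blast

lemma finite_tops: "finite (tops \<delta> m C)"
  using tops_subset finite_suffixes by (rule finite_subset)

lemma coh_tops:
  assumes C: "C \<in> word_cliques \<delta> m" and P: "P \<in> C \<or> P \<in> tops \<delta> m C" and h: "h \<in> tops \<delta> m C"
  shows "coh P h"
proof -
  have fun_P: "functional P"
    using P word_cliquesD(1)[OF C] words_functional suffixes_functional tops_subset by blast
  have fun_h: "functional h"
    using h suffixes_functional tops_subset by blast
  show ?thesis
  proof (cases "h \<in> C \<and> P \<in> C")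
    case True
    then show ?thesis using word_cliquesD(2)[OF C] by blast
  next
    case False
    then consider b where "h = [(Suc m, b)]" | b where "P = [(Suc m, b)]"
      using P h unfolding tops_def by blast
    then show ?thesis
      using coh_single[OF fun_P] coh_single[OF fun_h] coh_sym by cases metis+
  qed
qed

lemma tops_val_inj:
  assumes "C \<in> word_cliques \<delta> m" "h \<in> tops \<delta> m C" "h' \<in> tops \<delta> m C" "val h = val h'"
  shows "h = h'"
  using val_inj[of h \<delta> "Suc m" h'] coh_tops[OF assms(1) disjI2] assms tops_subset by blast

text \<open>A suffix that is not a one-letter cut word begins with an uncut letter and so is already
  a word of level \<open>m\<close>; there the maximality of \<open>C\<close> applies.\<close>

lemma topsI:
  assumes C: "C \<in> word_cliques \<delta> m" and h: "h \<in> suffixes \<delta> (Suc m)"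
    and coh_C: "\<And>Q. Q \<in> C \<Longrightarrow> Q \<in> low_words \<delta> (Suc m) \<Longrightarrow> coh h Q"
    and coh_tops: "\<And>Q. Q \<in> tops \<delta> m C \<Longrightarrow> coh h Q"
  shows "h \<in> tops \<delta> m C"
proof (cases "\<exists>b. h = [(Suc m, b)] \<and> cut_at \<delta> (Suc m) b")
  case False
  then have "h \<in> words \<delta> m"
    using h unfolding suffixes_Suc words_def top_words_def by blast
  moreover have "coh h Q" if "Q \<in> C" for Q
    using words_Suc[of \<delta> m] word_cliquesD(1)[OF C] that coh_C coh_tops[of Q]
    unfolding tops_def by blast
  ultimately have "h \<in> C" using word_cliquesD(3)[OF C] by blast
  then show ?thesis using h unfolding tops_def by blast
qed (use h in \<open>auto simp: tops_def\<close>)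

lemma Cons_in_ext:
  "(Suc (Suc m), b) # h \<in> ext \<delta> m C p \<longleftrightarrow>
    h \<in> tops \<delta> m C \<and> (if b then val p \<le> val h else val h \<le> val p)"
  using Cons_notin_low unfolding ext_def by auto

lemma low_in_ext: "P \<in> low_words \<delta> (Suc m) \<Longrightarrow> P \<in> ext \<delta> m C p \<longleftrightarrow> P \<in> C"
  using Cons_notin_low unfolding ext_def by auto

lemma ext_cases:
  assumes "P \<in> ext \<delta> m C p"
  obtains "P \<in> low_words \<delta> (Suc m)" "P \<in> C"
    | b h where "P = (Suc (Suc m), b) # h" "h \<in> tops \<delta> m C"
        "if b then val p \<le> val h else val h \<le> val p"
  using assms unfolding ext_def by force

lemma ext_word_clique:
  assumes C: "C \<in> word_cliques \<delta> m" and p: "p \<in> tops \<delta> m C"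
  shows "ext \<delta> m C p \<in> word_cliques \<delta> (Suc m)"
  unfolding word_cliques_def
proof (intro CollectI conjI ballI impI)
  show "ext \<delta> m C p \<subseteq> words \<delta> (Suc m)"
  proof
    fix P assume "P \<in> ext \<delta> m C p"
    then show "P \<in> words \<delta> (Suc m)"
    proof (cases rule: ext_cases)
      case 1
      then show ?thesis by (simp add: words_def)
    next
      case (2 b h)
      then show ?thesis using Cons_in_words_Suc tops_subset by blast
    qed
  qed
next
  fix P Q assume P: "P \<in> ext \<delta> m C p" and Q: "Q \<in> ext \<delta> m C p"
  show "coh P Q"
    using P
  proof (cases rule: ext_cases)
    case P: 1
    show ?thesis
      using Q
    proof (cases rule: ext_cases)
      case 1
      then show ?thesis using P word_cliquesD(2)[OF C] by blast
    next
      case (2 b h)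
      then show ?thesis using P coh_tops[OF C disjI1, of P h] coh_low_Cons[of P] by simp
    qed
  next
    case P: (2 b h)
    show ?thesis
      using Q
    proof (cases rule: ext_cases)
      case 1
      then show ?thesis
        using P coh_tops[OF C disjI1, of Q h] coh_low_Cons[of Q] coh_sym[of Q h] by simp
    next
      case (2 b' h')
      moreover have "coh h h'"
        using P(2) 2(2) coh_tops[OF C disjI2] by blast
      moreover have "h \<in> suffixes \<delta> (Suc m)" "h' \<in> suffixes \<delta> (Suc m)"
        using P(2) 2(2) tops_subset by blast+
      ultimately show ?thesis
        using P by (auto simp: coh_suffixes_Cons split: if_splits)
    qed
  qed
next
  fix P assume P: "P \<in> words \<delta> (Suc m)" and coh: "\<forall>Q\<in>ext \<delta> m C p. coh P Q"
  \<comment> \<open>The letter is the one on whose side of the pivot \<open>h\<close> lies, so every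
    tail occurs in the new clique.\<close>
  have tops_ext: "\<exists>b. (Suc (Suc m), b) # h \<in> ext \<delta> m C p" if "h \<in> tops \<delta> m C" for h
    using that by (intro exI[of _ "val p \<le> val h"]) (simp add: Cons_in_ext)
  show "P \<in> ext \<delta> m C p"
    using P
  proof (cases rule: words_Suc_cases)
    case 1
    have "coh P Q" if Q: "Q \<in> C" for Q
    proof (cases "Q \<in> low_words \<delta> (Suc m)")
      case True
      then show ?thesis using coh Q low_in_ext by blast
    next
      case False
      then have "Q \<in> tops \<delta> m C"
        using Q words_Suc[of \<delta> m] word_cliquesD(1)[OF C] unfolding tops_def by blast
      then obtain b where "(Suc (Suc m), b) # Q \<in> ext \<delta> m C p"
        using tops_ext by blast
      then show ?thesis using coh coh_low_Cons(1)[OF 1, of b Q] by simp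
    qed
    then have "P \<in> C"
      using word_cliquesD(3)[OF C] 1 low_words_Suc_subset by blast
    then show ?thesis using 1 low_in_ext by blast
  next
    case (2 b h)
    have "h \<in> tops \<delta> m C"
    proof (rule topsI[OF C 2(2)])
      show "coh h Q" if "Q \<in> C" "Q \<in> low_words \<delta> (Suc m)" for Q
        using that coh 2(1) low_in_ext[OF that(2), of C p] coh_low_Cons(2)[OF that(2), of b h] by simp
      show "coh h Q" if Q: "Q \<in> tops \<delta> m C" for Q
      proof -
        obtain b' where "coh P ((Suc (Suc m), b') # Q)"
          using tops_ext[OF Q] coh by blast
        then show ?thesis
          using coh_suffixes_Cons[OF 2(2), of Q b b'] Q tops_subset[of \<delta> m C] 2(1) by auto
      qed
    qed
    \<comment> \<open>The pivot carries both letters. Its copy with the opposite letter forces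
      \<open>h\<close> onto the correct side.\<close>
    moreover have "(Suc (Suc m), \<not> b) # p \<in> ext \<delta> m C p"
      using p by (simp add: Cons_in_ext)
    then have "coh ((Suc (Suc m), b) # h) ((Suc (Suc m), \<not> b) # p)"
      using coh 2(1) by blast
    then have "if b then val p \<le> val h else val h \<le> val p"
      using coh_suffixes_Cons[OF 2(2), of p b "\<not> b"] p tops_subset[of \<delta> m C] by auto
    ultimately show ?thesis
      using 2(1) by (simp add: Cons_in_ext)
  qed
qed

lemma down_ext:
  assumes one: "\<delta> 1 = I" and C: "C \<in> word_cliques \<delta> m" and p: "p \<in> tops \<delta> m C"
  shows "down \<delta> m (ext \<delta> m C p) = C"
proof (intro set_eqI iffI)
  fix P assume "P \<in> down \<delta> m (ext \<delta> m C p)"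
  then have P: "P \<in> words \<delta> m" "P \<in> ext \<delta> m C p \<or> (\<exists>b. (Suc (Suc m), b) # P \<in> ext \<delta> m C p)"
    unfolding down_def by blast+
  consider "P \<in> ext \<delta> m C p" "P \<in> low_words \<delta> (Suc m)" | "P \<in> tops \<delta> m C"
    using P(2)
  proof (elim disjE exE)
    assume ext: "P \<in> ext \<delta> m C p"
    then show ?thesis
    proof (cases rule: ext_cases)
      case 1
      then show ?thesis using ext that(1) by blast
    next
      case (2 b h)
      then show ?thesis using words_levels[OF P(1), of "Suc (Suc m)" b] by simp
    qed
  qed (use that(2) in \<open>simp add: Cons_in_ext\<close>)
  then show "P \<in> C"
  proof cases
    case 1
    then show ?thesis using low_in_ext by blast
  next
    case 2
    \<comment> \<open>The empty word is a suffix only at level 0, so such a word would force the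
      label 1 to be cut.\<close>
    moreover have "P \<noteq> [(Suc m, b)]" if "cut_at \<delta> (Suc m) b" for b
    proof
      assume "P = [(Suc m, b)]"
      then have "m = 0"
        using P(1) unfolding words_def top_words_def low_words_def by (auto simp: Nil_in_suffixes)
      then show False using one that by (simp add: cut_at_def split: if_splits)
    qed
    ultimately show ?thesis unfolding tops_def by blast
  qed
next
  fix P assume P: "P \<in> C"
  then have words: "P \<in> words \<delta> m" using word_cliquesD(1)[OF C] by blast
  show "P \<in> down \<delta> m (ext \<delta> m C p)"
  proof (cases "P \<in> low_words \<delta> (Suc m)")
    case True
    then show ?thesis using P words low_in_ext unfolding down_def by blast
  next
    case False
    then have "P \<in> tops \<delta> m C"
      using P words words_Suc[of \<delta> m] unfolding tops_def by blast
    then have "(Suc (Suc m), val p \<le> val P) # P \<in> ext \<delta> m C p"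
      by (simp add: Cons_in_ext)
    then show ?thesis
      using words unfolding down_def by blast
  qed
qed

text \<open>A suffix that is coherent with all tails of the new label and with all low words can be
  prefixed with one of the two letters. So the tails are complete, and the maximality of
  \<open>C'\<close> passes to \<open>down\<close>.\<close>

lemma up_clique:
  assumes one: "\<delta> 1 = I" and C': "C' \<in> word_cliques \<delta> (Suc m)"
  shows heads_eq: "{h. \<exists>b. (Suc (Suc m), b) # h \<in> C'} = tops \<delta> m (down \<delta> m C')"
    and down_word_clique: "down \<delta> m C' \<in> word_cliques \<delta> m"
proof -
  let ?K = "Suc (Suc m)" and ?S = "suffixes \<delta> (Suc m)"
  define heads where "heads = {h. \<exists>b. (?K, b) # h \<in> C'}"
  have heads_S: "heads \<subseteq> ?S"
  proof
    fix h assume "h \<in> heads"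
    then obtain b where "(?K, b) # h \<in> words \<delta> (Suc m)"
      using word_cliquesD(1)[OF C'] unfolding heads_def by blast
    then show "h \<in> ?S"
      using Cons_notin_low by (cases rule: words_Suc_cases) auto
  qed
  have headsI: "h \<in> heads"
    if h: "h \<in> ?S" and coh_heads: "\<And>h'. h' \<in> heads \<Longrightarrow> coh h h'"
      and coh_low: "\<And>P. P \<in> C' \<Longrightarrow> P \<in> low_words \<delta> (Suc m) \<Longrightarrow> coh h P" for h
  proof -
    \<comment> \<open>The dip is chosen if all bump tails lie weakly below \<open>h\<close>.
      Otherwise some bump tail lies strictly above \<open>h\<close>; all dip tails lie above that
      one, hence above \<open>h\<close>, and the bump is safe.\<close>
    define b where "b \<longleftrightarrow> (\<forall>h'. (?K, False) # h' \<in> C' \<longrightarrow> val h' \<le> val h)"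
    have "coh ((?K, b) # h) P" if P: "P \<in> C'" for P
    proof -
      have "P \<in> words \<delta> (Suc m)" using P word_cliquesD(1)[OF C'] by blast
      then show ?thesis
      proof (cases rule: words_Suc_cases)
        case 1
        then show ?thesis using coh_low P coh_low_Cons(2) by blast
      next
        case (2 c h')
        then have "coh h h'" using P coh_heads unfolding heads_def by blast
        moreover have "val h' \<le> val h" if "b" "\<not> c"
          using that 2(1) P unfolding b_def by simp
        moreover have "val h \<le> val h'" if nb: "\<not> b" and c: "c"
        proof -
          obtain h'' where h'': "(?K, False) # h'' \<in> C'" "val h < val h''"
            using nb unfolding b_def by (auto simp: not_le)
          have "coh ((?K, False) # h'') ((?K, True) # h')"
            using word_cliquesD(2)[OF C' h''(1)] P 2(1) c by simp
          moreover have "h'' \<in> ?S" using h''(1) heads_S unfolding heads_def by blast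
          ultimately show ?thesis
            using coh_suffixes_Cons[of h'' \<delta> "Suc m" h' False True] 2(2) h''(2) by simp
        qed
        ultimately show ?thesis
          unfolding 2(1) using coh_suffixes_Cons[OF h 2(2), of b c] by blast
      qed
    qed
    then have "(?K, b) # h \<in> C'"
      using word_cliquesD(3)[OF C'] Cons_in_words_Suc[OF h] by blast
    then show ?thesis unfolding heads_def by blast
  qed
  have heads_coh: "coh h h'" if hs: "h \<in> heads" "h' \<in> heads" for h h'
  proof -
    obtain b b' where "coh ((?K, b) # h) ((?K, b') # h')"
      using hs word_cliquesD(2)[OF C'] unfolding heads_def by blast
    then show ?thesis
      using coh_suffixes_Cons[of h \<delta> "Suc m" h' b b'] hs heads_S by blast
  qed
  have heads_low: "coh h P" if hs: "h \<in> heads" "P \<in> C'" "P \<in> low_words \<delta> (Suc m)" for h P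
    using hs word_cliquesD(2)[OF C'] coh_low_Cons(2)[OF hs(3)] unfolding heads_def by blast
  have single: "[(Suc m, b)] \<in> heads" if "cut_at \<delta> (Suc m) b" for b
  proof (rule headsI)
    show "[(Suc m, b)] \<in> ?S" using that unfolding suffixes_Suc by blast
    show "coh [(Suc m, b)] h'" if "h' \<in> heads" for h'
      using that heads_S suffixes_functional coh_single coh_sym by blast
    show "coh [(Suc m, b)] P" if "P \<in> C'" for P
      using that word_cliquesD(1)[OF C'] words_functional coh_single coh_sym by blast
  qed
  have down: "P \<in> down \<delta> m C' \<longleftrightarrow>
      P \<in> words \<delta> m \<and> (P \<in> C' \<and> P \<in> low_words \<delta> (Suc m) \<or> P \<in> heads)" for P
  proof -
    have "P \<in> low_words \<delta> (Suc m)" if "P \<in> words \<delta> m" "P \<in> C'"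
    proof -
      have "P \<in> words \<delta> (Suc m)" using that word_cliquesD(1)[OF C'] by blast
      then show ?thesis
        using words_levels[OF that(1), of ?K] by (cases rule: words_Suc_cases) auto
    qed
    then show ?thesis unfolding down_def heads_def by blast
  qed
  show tops: "{h. \<exists>b. (?K, b) # h \<in> C'} = tops \<delta> m (down \<delta> m C')"
  proof -
    have "h \<in> heads \<longleftrightarrow> h \<in> tops \<delta> m (down \<delta> m C')" for h
    proof
      assume h: "h \<in> heads"
      then show "h \<in> tops \<delta> m (down \<delta> m C')"
        using heads_S unfolding tops_def down by (auto simp: suffixes_Suc words_def top_words_def)
    next
      assume h: "h \<in> tops \<delta> m (down \<delta> m C')"
      show "h \<in> heads"
      proof (rule ccontr)
        assume n: "h \<notin> heads"
        \<comment> \<open>A low word starts with a cut letter, while a suffix starting with a cut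
          letter has no second letter.\<close>
        then have "h \<in> ?S" "h \<in> low_words \<delta> (Suc m)" "\<nexists>b. h = [(Suc m, b)] \<and> cut_at \<delta> (Suc m) b"
          using h single unfolding tops_def down by blast+
        then show False
          unfolding low_words_def suffixes_Suc by (auto dest: suffixes_levels)
      qed
    qed
    then show ?thesis unfolding heads_def by blast
  qed
  show "down \<delta> m C' \<in> word_cliques \<delta> m"
    unfolding word_cliques_def
  proof (intro CollectI conjI ballI impI)
    show "down \<delta> m C' \<subseteq> words \<delta> m" unfolding down_def by blast
  next
    fix P Q assume "P \<in> down \<delta> m C'" "Q \<in> down \<delta> m C'"
    then have "P \<in> C' \<and> P \<in> low_words \<delta> (Suc m) \<or> P \<in> heads"
      "Q \<in> C' \<and> Q \<in> low_words \<delta> (Suc m) \<or> Q \<in> heads"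
      unfolding down by blast+
    then show "coh P Q"
      using heads_coh[of P Q] heads_low[of P Q] heads_low[of Q P] word_cliquesD(2)[OF C', of P Q]
        coh_sym[of P Q] by blast
  next
    fix P assume P: "P \<in> words \<delta> m" and coh: "\<forall>Q\<in>down \<delta> m C'. coh P Q"
    have coh_heads: "coh P h" if h: "h \<in> heads" for h
    proof (cases "\<exists>b. h = [(Suc m, b)]")
      case True
      then show ?thesis using coh_single words_functional[OF P] by blast
    next
      case False
      then have "h \<in> words \<delta> m"
        using h heads_S unfolding suffixes_Suc words_def top_words_def by blast
      then show ?thesis using coh h down by blast
    qed
    have coh_low: "coh P Q" if "Q \<in> C'" "Q \<in> low_words \<delta> (Suc m)" for Q
      using that coh down low_words_Suc_subset by blast
    consider "P \<in> low_words \<delta> (Suc m)" | "P \<in> ?S" using P words_Suc by blast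
    then show "P \<in> down \<delta> m C'"
    proof cases
      case 1
      have "P \<in> C'"
      proof (rule word_cliquesD(3)[OF C'])
        show "P \<in> words \<delta> (Suc m)" using 1 unfolding words_def by blast
        fix Q assume Q: "Q \<in> C'"
        then have "Q \<in> words \<delta> (Suc m)" using word_cliquesD(1)[OF C'] by blast
        then show "coh P Q"
        proof (cases rule: words_Suc_cases)
          case (2 b h)
          then show ?thesis
            using coh_heads[of h] coh_low_Cons(1)[OF 1] Q unfolding heads_def by blast
        qed (use coh_low Q in blast)
      qed
      then show ?thesis using 1 P down by blast
    next
      case 2
      then have "P \<in> heads" using headsI coh_heads coh_low by blast
      then show ?thesis using P down by blast
    qed
  qed
qed

lemma constant_suffix: "\<exists>h\<in>suffixes \<delta> i. \<forall>(k, b)\<in>set h. b = c"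
proof (induction i)
  case (Suc i)
  then obtain h where h: "h \<in> suffixes \<delta> i" "\<forall>(k, b)\<in>set h. b = c" by blast
  have "(Suc i, c) # (if cut_at \<delta> (Suc i) c then [] else h) \<in> suffixes \<delta> (Suc i)"
    using h(1) unfolding suffixes_Suc by simp
  moreover have "\<forall>(k, b)\<in>set ((Suc i, c) # (if cut_at \<delta> (Suc i) c then [] else h)). b = c"
    using h(2) by simp
  ultimately show ?case by (rule bexI[rotated])
qed simp

text \<open>The suffix made of bumps only has no dip that could lie above the bump of another word,
  so it is coherent with every word.\<close>

lemma tops_nonempty:
  assumes C: "C \<in> word_cliques \<delta> m"
  shows "tops \<delta> m C \<noteq> {}"
proof -
  obtain h where h: "h \<in> suffixes \<delta> (Suc m)" "\<forall>(k, b)\<in>set h. b = False"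
    using constant_suffix by blast
  then have "coh h Q" for Q by (auto simp: coh_def lt_def)
  then show ?thesis using topsI[OF C h(1)] by blast
qed

lemma ex_max_min:
  fixes f :: "'a \<Rightarrow> nat"
  assumes "finite S" "S \<noteq> {}"
  shows ex_max: "\<exists>p\<in>S. \<forall>h\<in>S. f h \<le> f p" and ex_min: "\<exists>p\<in>S. \<forall>h\<in>S. f p \<le> f h"
proof -
  have fin: "finite (f ` S)" "f ` S \<noteq> {}" using assms by auto
  obtain p where p: "p \<in> S" "Max (f ` S) = f p" using Max_in[OF fin] by blast
  obtain q where q: "q \<in> S" "Min (f ` S) = f q" using Min_in[OF fin] by blast
  show "\<exists>p\<in>S. \<forall>h\<in>S. f h \<le> f p"
    using p Max_ge[OF fin(1)] by (intro bexI[of _ p]) auto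
  show "\<exists>p\<in>S. \<forall>h\<in>S. f p \<le> f h"
    using q Min_le[OF fin(1)] by (intro bexI[of _ q]) auto
qed

text \<open>Maximality forces some tail to carry both letters: the highest tail after the bump can
  also take the dip, and if no tail followed the bump, the lowest tail could take it. With this tail
  as pivot \<open>C'\<close> lies in the clique \<open>ext\<close>, and maximality gives
  equality.\<close>

lemma ext_down:
  assumes one: "\<delta> 1 = I" and C': "C' \<in> word_cliques \<delta> (Suc m)"
  obtains p where "p \<in> tops \<delta> m (down \<delta> m C')" "C' = ext \<delta> m (down \<delta> m C') p"
proof -
  let ?K = "Suc (Suc m)" and ?T = "tops \<delta> m (down \<delta> m C')"
  note C = down_word_clique[of \<delta>, OF one C']
  have heads: "h \<in> ?T \<longleftrightarrow> (?K, False) # h \<in> C' \<or> (?K, True) # h \<in> C'" for h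
  proof -
    have "h \<in> ?T \<longleftrightarrow> (\<exists>b. (?K, b) # h \<in> C')"
      unfolding heads_eq[of \<delta>, OF one C', symmetric] by simp
    then show ?thesis by (metis (full_types))
  qed
  have prependI: "(?K, b) # p \<in> C'" if p: "p \<in> ?T"
    and ord: "\<And>h. (?K, \<not> b) # h \<in> C' \<Longrightarrow> if b then val h \<le> val p else val p \<le> val h" for p b
  proof (rule word_cliquesD(3)[OF C'])
    have p': "p \<in> suffixes \<delta> (Suc m)" using p tops_subset by blast
    then show "(?K, b) # p \<in> words \<delta> (Suc m)" by (rule Cons_in_words_Suc)
    fix Q assume Q: "Q \<in> C'"
    then have "Q \<in> words \<delta> (Suc m)" using word_cliquesD(1)[OF C'] by blast
    then show "coh ((?K, b) # p) Q"
    proof (cases rule: words_Suc_cases)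
      case 1
      obtain b' where "coh ((?K, b') # p) Q"
        using p word_cliquesD(2)[OF C' _ Q] unfolding heads by blast
      then show ?thesis using coh_low_Cons(2)[OF 1] by blast
    next
      case (2 c h)
      then have "h \<in> ?T" using Q heads by (cases c) auto
      then have "coh p h" using coh_tops[OF C] p by blast
      then show ?thesis
        using ord[of h] Q unfolding 2(1) coh_suffixes_Cons[OF p' 2(2)]
        by (cases b; cases c) auto
    qed
  qed
  obtain p where p: "p \<in> ?T" "(?K, False) # p \<in> C'" "(?K, True) # p \<in> C'"
  proof (cases "\<exists>h. (?K, False) # h \<in> C'")
    case True
    let ?Z = "{h \<in> ?T. (?K, False) # h \<in> C'}"
    have "finite ?Z" using finite_tops by simp
    moreover have "?Z \<noteq> {}" using True heads by blast
    ultimately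
    obtain p where p: "p \<in> ?Z" "\<forall>h\<in>?Z. val h \<le> val p"
      using ex_max[of ?Z val] by blast
    then have "(?K, True) # p \<in> C'"
      using heads by (intro prependI) auto
    then show ?thesis using that p by blast
  next
    case False
    obtain p where p: "p \<in> ?T" "\<forall>h\<in>?T. val p \<le> val h"
      using ex_min[OF finite_tops tops_nonempty[OF C], of val] by blast
    then have "(?K, False) # p \<in> C'"
      using heads by (intro prependI) auto
    then show ?thesis using False by blast
  qed
  have sub: "C' \<subseteq> ext \<delta> m (down \<delta> m C') p"
  proof
    fix P assume P: "P \<in> C'"
    then have "P \<in> words \<delta> (Suc m)" using word_cliquesD(1)[OF C'] by blast
    then show "P \<in> ext \<delta> m (down \<delta> m C') p"
    proof (cases rule: words_Suc_cases)
      case 1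
      then show ?thesis
        using P low_words_Suc_subset low_in_ext[OF 1] unfolding down_def by blast
    next
      case (2 b h)
      have p': "p \<in> suffixes \<delta> (Suc m)" using p(1) tops_subset by blast
      have "coh P ((?K, \<not> b) # p)" using word_cliquesD(2)[OF C' P] p by (cases b) auto
      moreover have "h \<in> ?T" using P 2(1) heads by (cases b) auto
      ultimately show ?thesis
        unfolding 2(1) Cons_in_ext coh_suffixes_Cons[OF 2(2) p'] by auto
    qed
  qed
  moreover have "P \<in> C'" if P: "P \<in> ext \<delta> m (down \<delta> m C') p" for P
  proof (rule word_cliquesD(3)[OF C'])
    note E = ext_word_clique[OF C p(1)]
    show "P \<in> words \<delta> (Suc m)" using word_cliquesD(1)[OF E] P by blast
    show "coh P Q" if "Q \<in> C'" for Q using word_cliquesD(2)[OF E P] sub that by blast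
  qed
  ultimately show thesis using that p(1) by blast
qed

section \<open>Counting the pivots\<close>

lemma word_stat_ext:
  "word_stat (Suc m) (ext \<delta> m C p) =
    (card {h \<in> tops \<delta> m C. val p \<le> val h}, card {h \<in> tops \<delta> m C. val h \<le> val p})"
  by (simp add: word_stat_def Cons_in_ext)

lemma card_tops:
  assumes C: "C \<in> word_cliques \<delta> m"
  shows "card (tops \<delta> m C) = spots \<delta> (Suc m) (word_stat m C)"
proof -
  define S where "S b = (if cut_at \<delta> (Suc m) b then {[(Suc m, b)]}
    else Cons (Suc m, b) ` {h. (Suc m, b) # h \<in> C})" for b
  have tail: "h \<in> suffixes \<delta> m" if "(Suc m, b) # h \<in> C" for b h
  proof -
    have "(Suc m, b) # h \<in> words \<delta> m" using that word_cliquesD(1)[OF C] by blast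
    then show ?thesis unfolding words_def low_words_def top_words_def by auto
  qed
  have "tops \<delta> m C = S True \<union> S False"
  proof (intro set_eqI iffI)
    fix h assume h: "h \<in> tops \<delta> m C"
    then obtain b h' where h': "h = (Suc m, b) # h'" "cut_at \<delta> (Suc m) b \<longrightarrow> h' = []"
      unfolding tops_def suffixes_Suc by blast
    then have "h \<in> S b"
      using h unfolding tops_def S_def by auto
    then show "h \<in> S True \<union> S False"
      by (cases b) auto
  next
    fix h assume "h \<in> S True \<union> S False"
    then obtain b where "h \<in> S b" by blast
    then show "h \<in> tops \<delta> m C"
      using tail unfolding tops_def suffixes_Suc S_def by (auto split: if_splits)
  qed
  moreover have "S True \<inter> S False = {}" unfolding S_def by auto
  moreover have "finite (S b)" for b
  proof -
    have "S b \<subseteq> insert [(Suc m, b)] (Cons (Suc m, b) ` suffixes \<delta> m)"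
      using tail unfolding S_def by auto
    then show ?thesis using finite_suffixes finite_subset by blast
  qed
  moreover have "card (S b) = (if cut_at \<delta> (Suc m) b then 1 else card {h. (Suc m, b) # h \<in> C})" for b
    unfolding S_def by (simp add: card_image)
  ultimately show ?thesis
    by (simp add: card_Un_disjoint spots_def word_stat_def)
qed

text \<open>Both ranks count \<open>p\<close> itself, so their sum exceeds the size of
  \<open>T\<close> by one; in a chain the rank from below runs through 1, ...,
  \<open>card T\<close>.\<close>

lemma bij_betw_ranks:
  fixes v :: "'a \<Rightarrow> nat"
  assumes fin: "finite T" and inj: "inj_on v T"
  shows "bij_betw (\<lambda>p. (card {h \<in> T. v p \<le> v h}, card {h \<in> T. v h \<le> v p})) T
    {(a, b). 1 \<le> a \<and> 1 \<le> b \<and> a + b = Suc (card T)}"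
proof -
  define r where "r p = card {h \<in> T. v h \<le> v p}" for p
  have sum: "card {h \<in> T. v p \<le> v h} + r p = Suc (card T)" if p: "p \<in> T" for p
  proof -
    have "{h \<in> T. v p \<le> v h} \<union> {h \<in> T. v h \<le> v p} = T" by auto
    moreover have "{h \<in> T. v p \<le> v h} \<inter> {h \<in> T. v h \<le> v p} = {p}"
      using inj p by (auto simp: inj_on_def)
    ultimately show ?thesis
      using card_Un_Int[of "{h \<in> T. v p \<le> v h}" "{h \<in> T. v h \<le> v p}"] fin by (simp add: r_def)
  qed
  have pos: "1 \<le> card {h \<in> T. v p \<le> v h}" "1 \<le> r p" if p: "p \<in> T" for p
    using p fin by (auto simp: r_def Suc_le_eq card_gt_0_iff)
  have "inj_on r T"
  proof (rule inj_onI)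
    have less: "r p < r q" if "p \<in> T" "q \<in> T" "v p < v q" for p q
    proof -
      have "q \<in> {h \<in> T. v h \<le> v q}" "q \<notin> {h \<in> T. v h \<le> v p}"
        "{h \<in> T. v h \<le> v p} \<subseteq> {h \<in> T. v h \<le> v q}"
        using that by auto
      then show ?thesis unfolding r_def using fin by (intro psubset_card_mono) auto
    qed
    fix p q assume "p \<in> T" "q \<in> T" "r p = r q"
    then have "v p = v q"
      using less[of p q] less[of q p] by (cases "v p" "v q" rule: linorder_cases) auto
    then show "p = q"
      using \<open>p \<in> T\<close> \<open>q \<in> T\<close> by (rule inj_onD[OF inj])
  qed
  moreover have "r ` T \<subseteq> {1..card T}"
    using sum pos by fastforce
  ultimately have r: "r ` T = {1..card T}"
    by (intro card_subset_eq) (auto simp: card_image)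
  show ?thesis
  proof (rule bij_betw_imageI)
    show "inj_on (\<lambda>p. (card {h \<in> T. v p \<le> v h}, card {h \<in> T. v h \<le> v p})) T"
      using \<open>inj_on r T\<close> by (auto simp: inj_on_def r_def)
    have "(a, b) \<in> (\<lambda>p. (card {h \<in> T. v p \<le> v h}, r p)) ` T"
      if "1 \<le> a" "1 \<le> b" "a + b = Suc (card T)" for a b
    proof -
      have "b \<in> r ` T" using that r by auto
      then obtain p where "p \<in> T" "b = r p" by blast
      then show ?thesis using sum[of p] that by (auto intro!: image_eqI[of _ _ p])
    qed
    then show "(\<lambda>p. (card {h \<in> T. v p \<le> v h}, card {h \<in> T. v h \<le> v p})) ` T =
        {(a, b). 1 \<le> a \<and> 1 \<le> b \<and> a + b = Suc (card T)}"
      using sum pos unfolding r_def[symmetric] by fastforce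
  qed
qed

lemma word_clique_fibre:
  assumes one: "\<delta> 1 = I" and C: "C \<in> word_cliques \<delta> m"
  shows "bij_betw (word_stat (Suc m)) {C' \<in> word_cliques \<delta> (Suc m). down \<delta> m C' = C}
    {(a, b). 1 \<le> a \<and> 1 \<le> b \<and> a + b = Suc (spots \<delta> (Suc m) (word_stat m C))}"
proof -
  have "{C' \<in> word_cliques \<delta> (Suc m). down \<delta> m C' = C} = ext \<delta> m C ` tops \<delta> m C"
  proof (intro equalityI subsetI)
    fix C' assume "C' \<in> {C' \<in> word_cliques \<delta> (Suc m). down \<delta> m C' = C}"
    then have C': "C' \<in> word_cliques \<delta> (Suc m)" "down \<delta> m C' = C" by auto
    obtain p where "p \<in> tops \<delta> m C" "C' = ext \<delta> m C p"
      using ext_down[of \<delta>, OF one C'(1)] unfolding C'(2) .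
    then show "C' \<in> ext \<delta> m C ` tops \<delta> m C" by blast
  qed (use ext_word_clique[OF C] down_ext[of \<delta>, OF one C] in auto)
  moreover have "inj_on val (tops \<delta> m C)"
    using tops_val_inj[OF C] by (auto intro: inj_onI)
  then have bij: "bij_betw (word_stat (Suc m) \<circ> ext \<delta> m C) (tops \<delta> m C)
    {(a, b). 1 \<le> a \<and> 1 \<le> b \<and> a + b = Suc (card (tops \<delta> m C))}"
    using bij_betw_ranks[OF finite_tops] by (simp add: comp_def word_stat_ext)
  \<comment> \<open>The two counts recover the pivot, so different pivots give different
    cliques.\<close>
  then have "inj_on (ext \<delta> m C) (tops \<delta> m C)"
    by (intro inj_on_imageI2[of "word_stat (Suc m)"]) (rule bij_betw_imp_inj_on)
  then have "bij_betw (ext \<delta> m C) (tops \<delta> m C) (ext \<delta> m C ` tops \<delta> m C)"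
    by (simp add: bij_betw_def)
  then have "bij_betw (word_stat (Suc m)) (ext \<delta> m C ` tops \<delta> m C)
      {(a, b). 1 \<le> a \<and> 1 \<le> b \<and> a + b = Suc (card (tops \<delta> m C))}"
    using bij by (simp only: bij_betw_comp_iff)
  ultimately show ?thesis
    by (simp only: card_tops[OF C])
qed

lemma bij_betw_word_cliques_codes:
  assumes one: "\<delta> 1 = I"
  shows "\<exists>f. bij_betw f (word_cliques \<delta> m) (codes \<delta> m) \<and>
    (\<forall>C\<in>word_cliques \<delta> m. hd (f C) = word_stat m C)"
proof (induction m)
  case 0
  have words: "words \<delta> 0 = {[(1, True)], [(1, False)]}"
    by (auto simp: words_def top_words_def low_words_def)
  have coh: "coh P Q" if "P \<in> words \<delta> 0" "Q \<in> words \<delta> 0" for P Q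
    using that by (auto simp: words coh_def lt_def)
  have "words \<delta> 0 \<in> word_cliques \<delta> 0"
    unfolding word_cliques_def using coh by blast
  moreover have "C = words \<delta> 0" if C: "C \<in> word_cliques \<delta> 0" for C
  proof
    show "words \<delta> 0 \<subseteq> C"
      using word_cliquesD(1)[OF C] by (intro subsetI word_cliquesD(3)[OF C] coh) auto
  qed (rule word_cliquesD(1)[OF C])
  ultimately have "word_cliques \<delta> 0 = {words \<delta> 0}"
    by blast
  moreover have "word_stat 0 (words \<delta> 0) = (1, 1)"
    by (simp add: words word_stat_def)
  ultimately show ?case
    by (intro exI[of _ "\<lambda>_. [(1, 1)]"]) (simp add: bij_betw_def)
next
  case (Suc m)
  then obtain f where "bij_betw f (word_cliques \<delta> m) (codes \<delta> m) \<and>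
    (\<forall>C\<in>word_cliques \<delta> m. hd (f C) = word_stat m C)" ..
  then have f: "bij_betw f (word_cliques \<delta> m) (codes \<delta> m)"
    "\<And>C. C \<in> word_cliques \<delta> m \<Longrightarrow> hd (f C) = word_stat m C" by simp_all
  let ?g = "\<lambda>C'. word_stat (Suc m) C' # f (down \<delta> m C')"
  have "bij_betw ?g (word_cliques \<delta> (Suc m)) (codes \<delta> (Suc m))"
  proof (rule bij_betw_codes_step[where stat = "word_stat m"])
    show "down \<delta> m C' \<in> word_cliques \<delta> m" if "C' \<in> word_cliques \<delta> (Suc m)" for C'
      using that by (rule down_word_clique[of \<delta>, OF one])
    show "bij_betw (word_stat (Suc m)) {C' \<in> word_cliques \<delta> (Suc m). down \<delta> m C' = C}
        {(a, b). 1 \<le> a \<and> 1 \<le> b \<and> a + b = Suc (spots \<delta> (Suc m) (word_stat m C))}"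
      if "C \<in> word_cliques \<delta> m" for C
      using that by (rule word_clique_fibre[of \<delta>, OF one])
  qed (fact f)+
  then show ?case by (intro exI[of _ ?g]) simp
qed

section \<open>Routes of the bicho graph\<close>

definition raw :: "nat \<times> bool \<Rightarrow> edge" where
  "raw x = (if snd x then Dip (fst x) else Bump (fst x))"

lemma raw_eq_iff [simp]: "raw x = raw y \<longleftrightarrow> x = y"
  by (cases x; cases y) (auto simp: raw_def)

lemma raw_neq [simp]: "raw x \<noteq> FromSource e" "raw x \<noteq> ToSink e"
    "FromSource e \<noteq> raw x" "ToSink e \<noteq> raw x"
  by (auto simp: raw_def)

lemma raw_image_oruga: "Bump ` {1..n} \<union> Dip ` {1..n} = raw ` ({1..n} \<times> UNIV)"
proof -
  have "raw ` ({1..n} \<times> UNIV) = (\<lambda>i. raw (i, False)) ` {1..n} \<union> (\<lambda>i. raw (i, True)) ` {1..n}"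
    by (auto simp: image_iff all_bool_eq ex_bool_eq)
  then show ?thesis by (simp add: raw_def)
qed

definition moved_in :: "edge set \<Rightarrow> edge \<Rightarrow> edge" where
  "moved_in S e = (if e \<in> S then FromSource e else e)"

definition moved_out :: "edge set \<Rightarrow> edge \<Rightarrow> edge" where
  "moved_out S e = (if e \<in> S then ToSink e else e)"

text \<open>Invariant for the fold in \<open>bicho\<close>: the effect of the moves depends only on
  the set \<open>S\<close> of moved edges. The ends of a moved edge stay prescribed although it is
  no longer an arc, since the two new edges take theirs from it. The index in
  \<open>out_order\<close> is shifted by one against \<open>oruga\<close>, so that it is the label
  of the edges, as in \<open>in_order\<close>.\<close>

definition moved_oruga :: "nat \<Rightarrow> edge set \<Rightarrow> (nat, edge) framed_graph \<Rightarrow> bool" where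
  "moved_oruga n S F \<longleftrightarrow>
     verts (dgraph F) = {0..n} \<and>
     arcs (dgraph F) = (raw ` ({1..n} \<times> UNIV) - S) \<union> FromSource ` S \<union> ToSink ` S \<and>
     source F = 0 \<and> sink F = n \<and>
     (\<forall>i b. i \<in> {1..n} \<longrightarrow> tail (dgraph F) (raw (i, b)) = n - i \<and> head (dgraph F) (raw (i, b)) = n + 1 - i) \<and>
     (\<forall>e\<in>S. tail (dgraph F) (FromSource e) = 0 \<and> head (dgraph F) (FromSource e) = head (dgraph F) e \<and>
        tail (dgraph F) (ToSink e) = tail (dgraph F) e \<and> head (dgraph F) (ToSink e) = n) \<and>
     (\<forall>v. in_order F v = {(moved_in S (raw (i, False)), moved_in S (raw (i, True))) | i. i \<in> {1..n} \<and> v = n + 1 - i}) \<and>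
     (\<forall>v. out_order F v = {(moved_out S (raw (i, False)), moved_out S (raw (i, True))) | i. i \<in> {1..<n} \<and> v = n - i})"

lemma moved_oruga_oruga: "moved_oruga n {} (oruga n)"
proof -
  have "out_order (oruga n) v = {(Bump i, Dip i) | i. i \<in> {1..<n} \<and> v = n - i}" for v
  proof -
    have "(\<exists>i. x = (Bump (i - 1), Dip (i - 1)) \<and> i \<in> {2..n} \<and> v = n + 1 - i) \<longleftrightarrow>
        (\<exists>i. x = (Bump i, Dip i) \<and> i \<in> {1..<n} \<and> v = n - i)" for x
    proof
      assume "\<exists>i. x = (Bump (i - 1), Dip (i - 1)) \<and> i \<in> {2..n} \<and> v = n + 1 - i"
      then obtain i where "x = (Bump (i - 1), Dip (i - 1))" "i \<in> {2..n}" "v = n + 1 - i" by blast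
      then show "\<exists>i. x = (Bump i, Dip i) \<and> i \<in> {1..<n} \<and> v = n - i"
        by (intro exI[of _ "i - 1"]) auto
    next
      assume "\<exists>i. x = (Bump i, Dip i) \<and> i \<in> {1..<n} \<and> v = n - i"
      then obtain i where "x = (Bump i, Dip i)" "i \<in> {1..<n}" "v = n - i" by blast
      then show "\<exists>i. x = (Bump (i - 1), Dip (i - 1)) \<and> i \<in> {2..n} \<and> v = n + 1 - i"
        by (intro exI[of _ "Suc i"]) auto
    qed
    then show ?thesis by (simp add: oruga_def)
  qed
  then show ?thesis
    unfolding moved_oruga_def raw_image_oruga[symmetric]
    by (simp add: oruga_def moved_in_def moved_out_def raw_def)
qed

lemma moved_image:
  assumes eq: "\<And>x. x \<noteq> e \<Longrightarrow> r' x = r x" "r e = e" "r' e = g e"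
    and g: "\<And>x. x \<noteq> e \<Longrightarrow> g (r x) = r x"
  shows "map_prod g g ` {(r (raw (i, False)), r (raw (i, True))) | i. Q i} =
    {(r' (raw (i, False)), r' (raw (i, True))) | i. Q i}"
proof -
  have "g (r x) = r' x" for x using eq g by (cases "x = e") auto
  moreover have "map_prod g g ` {(r (raw (i, False)), r (raw (i, True))) | i. Q i} =
      {(g (r (raw (i, False))), g (r (raw (i, True)))) | i. Q i}"
    by (auto simp: image_iff)
  ultimately show ?thesis by simp
qed

lemma moved_oruga_m_move:
  assumes F: "moved_oruga n S F" and e: "e = raw (j, c)" and j: "j \<in> {1..n}" and new: "e \<notin> S"
    and S: "S \<subseteq> raw ` ({1..n} \<times> UNIV)"
  shows "moved_oruga n (insert e S) (m_move e F)"
proof -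
  have tail: "tail (dgraph F) e = n - j" and head: "head (dgraph F) e = n + 1 - j"
    and src: "source F = 0" "sink F = n"
    using F e j unfolding moved_oruga_def by simp_all
  have raw_S: "FromSource x \<notin> S" "ToSink x \<notin> S" "x \<in> S \<Longrightarrow> x \<noteq> FromSource y" "x \<in> S \<Longrightarrow> x \<noteq> ToSink y" for x y
    using S by auto
  have e_neq: "FromSource x \<noteq> e" "ToSink x \<noteq> e" "e \<noteq> FromSource x" "e \<noteq> ToSink x" for x
    by (simp_all add: e)
  have inb: "in_order (m_move e F) v =
      {(moved_in (insert e S) (raw (i, False)), moved_in (insert e S) (raw (i, True))) | i. i \<in> {1..n} \<and> v = n + 1 - i}" for v
  proof (cases "v = n + 1 - j")
    case True
    have "in_order (m_move e F) v =
        map_prod (id(e := FromSource e)) (id(e := FromSource e)) ` in_order F v"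
      by (simp add: m_move_def Let_def head True)
    also have "in_order F v = {(moved_in S (raw (i, False)), moved_in S (raw (i, True))) | i. i \<in> {1..n} \<and> v = n + 1 - i}"
      using F unfolding moved_oruga_def by blast
    also have "map_prod (id(e := FromSource e)) (id(e := FromSource e)) ` \<dots> =
      {(moved_in (insert e S) (raw (i, False)), moved_in (insert e S) (raw (i, True))) | i. i \<in> {1..n} \<and> v = n + 1 - i}"
      by (rule moved_image[of e]) (use new e_neq in \<open>auto simp: moved_in_def\<close>)
    finally show ?thesis .
  next
    case False
    have "in_order (m_move e F) v = in_order F v"
      using False by (simp add: m_move_def Let_def head)
    also have "\<dots> = {(moved_in S (raw (i, False)), moved_in S (raw (i, True))) | i. i \<in> {1..n} \<and> v = n + 1 - i}"
      using F unfolding moved_oruga_def by blast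
    also have "\<dots> = {(moved_in (insert e S) (raw (i, False)), moved_in (insert e S) (raw (i, True))) | i. i \<in> {1..n} \<and> v = n + 1 - i}"
    proof -
      have "moved_in S (raw (i, b)) = moved_in (insert e S) (raw (i, b))" if "v = n + 1 - i" for i b
        using that False by (auto simp: moved_in_def e)
      then show ?thesis by (intro Collect_cong ex_cong1) auto
    qed
    finally show ?thesis .
  qed
  have outb: "out_order (m_move e F) v =
      {(moved_out (insert e S) (raw (i, False)), moved_out (insert e S) (raw (i, True))) | i. i \<in> {1..<n} \<and> v = n - i}" for v
  proof (cases "v = n - j")
    case True
    have "out_order (m_move e F) v =
        map_prod (id(e := ToSink e)) (id(e := ToSink e)) ` out_order F v"
      by (simp add: m_move_def Let_def tail True)
    also have "out_order F v = {(moved_out S (raw (i, False)), moved_out S (raw (i, True))) | i. i \<in> {1..<n} \<and> v = n - i}"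
      using F unfolding moved_oruga_def by blast
    also have "map_prod (id(e := ToSink e)) (id(e := ToSink e)) ` \<dots> =
      {(moved_out (insert e S) (raw (i, False)), moved_out (insert e S) (raw (i, True))) | i. i \<in> {1..<n} \<and> v = n - i}"
      by (rule moved_image[of e]) (use new e_neq in \<open>auto simp: moved_out_def\<close>)
    finally show ?thesis .
  next
    case False
    have "out_order (m_move e F) v = out_order F v"
      using False by (simp add: m_move_def Let_def tail)
    also have "\<dots> = {(moved_out S (raw (i, False)), moved_out S (raw (i, True))) | i. i \<in> {1..<n} \<and> v = n - i}"
      using F unfolding moved_oruga_def by blast
    also have "\<dots> = {(moved_out (insert e S) (raw (i, False)), moved_out (insert e S) (raw (i, True))) | i. i \<in> {1..<n} \<and> v = n - i}"
    proof -
      have "moved_out S (raw (i, b)) = moved_out (insert e S) (raw (i, b))" if "v = n - i" for i b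
        using that False by (auto simp: moved_out_def e)
      then show ?thesis by (intro Collect_cong ex_cong1) auto
    qed
    finally show ?thesis .
  qed
  have "arcs (dgraph (m_move e F)) =
      (raw ` ({1..n} \<times> UNIV) - insert e S) \<union> FromSource ` insert e S \<union> ToSink ` insert e S"
    using F e_neq unfolding moved_oruga_def by (auto simp: m_move_def Let_def)
  moreover have "\<forall>x\<in>insert e S. tail (dgraph (m_move e F)) (FromSource x) = 0 \<and>
      head (dgraph (m_move e F)) (FromSource x) = head (dgraph (m_move e F)) x \<and>
      tail (dgraph (m_move e F)) (ToSink x) = tail (dgraph (m_move e F)) x \<and>
      head (dgraph (m_move e F)) (ToSink x) = n"
    using F e_neq raw_S src unfolding moved_oruga_def by (simp add: m_move_def Let_def)
  ultimately show ?thesis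
    using F inb outb unfolding moved_oruga_def by (simp add: m_move_def Let_def)
qed

lemma moved_oruga_fold:
  "moved_oruga n S F \<Longrightarrow> S \<subseteq> raw ` ({1..n} \<times> UNIV) \<Longrightarrow> set es \<subseteq> raw ` ({1..n} \<times> UNIV) \<Longrightarrow>
    distinct es \<Longrightarrow> S \<inter> set es = {} \<Longrightarrow> moved_oruga n (S \<union> set es) (fold m_move es F)"
proof (induction es arbitrary: S F)
  case (Cons e es)
  obtain j c where e: "e = raw (j, c)" "j \<in> {1..n}" using Cons.prems(3) by auto
  have "moved_oruga n (insert e S) (m_move e F)"
    using Cons.prems by (intro moved_oruga_m_move[OF _ e]) auto
  then have "moved_oruga n (insert e S \<union> set es) (fold m_move es (m_move e F))"
    using Cons.prems by (intro Cons.IH) auto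
  then show ?case by simp
qed simp

definition cut_edges :: "nat \<Rightarrow> (nat \<Rightarrow> decoration) \<Rightarrow> edge set" where
  "cut_edges n \<delta> = {raw (i, b) | i b. i \<in> {1..n} \<and> cut_at \<delta> i b}"

lemma moved_oruga_bicho: "moved_oruga n (cut_edges n \<delta>) (bicho n \<delta>)"
proof -
  let ?es = "map Bump (filter (\<lambda>i. \<delta> i \<in> {U, decoration.X}) [1..<n + 1]) @
        map Dip (filter (\<lambda>i. \<delta> i \<in> {D, decoration.X}) [1..<n + 1])"
  have "cut_edges n \<delta> = Bump ` {i \<in> {1..n}. cut_at \<delta> i False} \<union> Dip ` {i \<in> {1..n}. cut_at \<delta> i True}"
  proof (intro equalityI subsetI)
    fix e assume "e \<in> cut_edges n \<delta>"
    then obtain i b where "e = raw (i, b)" "i \<in> {1..n}" "cut_at \<delta> i b" unfolding cut_edges_def by blast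
    then show "e \<in> Bump ` {i \<in> {1..n}. cut_at \<delta> i False} \<union> Dip ` {i \<in> {1..n}. cut_at \<delta> i True}"
      by (cases b) (simp_all add: raw_def)
  next
    fix e assume "e \<in> Bump ` {i \<in> {1..n}. cut_at \<delta> i False} \<union> Dip ` {i \<in> {1..n}. cut_at \<delta> i True}"
    then consider i where "e = raw (i, False)" "i \<in> {1..n}" "cut_at \<delta> i False"
      | i where "e = raw (i, True)" "i \<in> {1..n}" "cut_at \<delta> i True"
      unfolding raw_def by auto
    then show "e \<in> cut_edges n \<delta>" unfolding cut_edges_def by cases blast+
  qed
  then have es: "set ?es = cut_edges n \<delta>"
    by (auto simp: cut_at_def)
  have "moved_oruga n ({} \<union> set ?es) (fold m_move ?es (oruga n))"
  proof (rule moved_oruga_fold[OF moved_oruga_oruga])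
    show "set ?es \<subseteq> raw ` ({1..n} \<times> UNIV)" unfolding es cut_edges_def by auto
    show "distinct ?es" by (auto simp: distinct_map inj_on_def)
  qed simp_all
  then show ?thesis unfolding bicho_def es by simp
qed

text \<open>The edge of a letter as seen from its head; \<open>rout\<close> is the one seen from its
  tail. They differ for cut letters only. The framing compares entering edges of the form
  \<open>rin\<close> and leaving edges of the form \<open>rout\<close>.\<close>

definition rin :: "(nat \<Rightarrow> decoration) \<Rightarrow> nat \<times> bool \<Rightarrow> edge" where
  "rin \<delta> x = (if cut_at \<delta> (fst x) (snd x) then FromSource (raw x) else raw x)"

definition rout :: "(nat \<Rightarrow> decoration) \<Rightarrow> nat \<times> bool \<Rightarrow> edge" where
  "rout \<delta> x = (if cut_at \<delta> (fst x) (snd x) then ToSink (raw x) else raw x)"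

text \<open>
  A cut letter can only be the first or the last one of a route; its position decides which of
  the two edges of the M-move is meant.
\<close>

definition route_of :: "(nat \<Rightarrow> decoration) \<Rightarrow> word \<Rightarrow> edge list" where
  "route_of \<delta> P = rin \<delta> (hd P) # map (rout \<delta>) (tl P)"

lemma rin_eq_iff [simp]: "rin \<delta> x = rin \<delta> y \<longleftrightarrow> x = y"
  by (auto simp: rin_def split: if_splits)

lemma rout_eq_iff [simp]: "rout \<delta> x = rout \<delta> y \<longleftrightarrow> x = y"
  by (auto simp: rout_def split: if_splits)

lemma inj_rout: "inj (rout \<delta>)"
  by (rule injI) simp

lemma route_of_inj: "P \<noteq> [] \<Longrightarrow> Q \<noteq> [] \<Longrightarrow> route_of \<delta> P = route_of \<delta> Q \<Longrightarrow> P = Q"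
  by (cases P; cases Q) (auto simp: route_of_def inj_map_eq_map[OF inj_rout])

text \<open>Here n = \<open>Suc m\<close>, and the routes will be the words of level
  \<open>m\<close>, in which the label n is uncut.\<close>

locale bicho_graph =
  fixes \<delta> :: "nat \<Rightarrow> decoration" and m :: nat
  assumes m: "1 \<le> m" and one: "\<delta> 1 = I" and last: "\<delta> (Suc m) = I"
begin

abbreviation F where "F \<equiv> bicho (Suc m) \<delta>"
abbreviation G where "G \<equiv> dgraph F"
abbreviation letters where "letters \<equiv> {1..Suc m} \<times> (UNIV :: bool set)"

lemma not_cut: "\<not> cut_at \<delta> 1 b" "\<not> cut_at \<delta> (Suc 0) b" "\<not> cut_at \<delta> (Suc m) b"
  using one last by (auto simp: cut_at_def)

lemma moved: "moved_oruga (Suc m) (cut_edges (Suc m) \<delta>) F"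
  by (rule moved_oruga_bicho)

lemma in_cut_edges: "x \<in> letters \<Longrightarrow> raw x \<in> cut_edges (Suc m) \<delta> \<longleftrightarrow> cut_at \<delta> (fst x) (snd x)"
  by (cases x) (auto simp: cut_edges_def)

lemma moved_rin: "x \<in> letters \<Longrightarrow> moved_in (cut_edges (Suc m) \<delta>) (raw x) = rin \<delta> x"
  and moved_rout: "x \<in> letters \<Longrightarrow> moved_out (cut_edges (Suc m) \<delta>) (raw x) = rout \<delta> x"
  using in_cut_edges[of x] by (auto simp: moved_in_def moved_out_def rin_def rout_def)

lemma basic [simp]: "verts G = {0..Suc m}" "source F = 0" "sink F = Suc m"
  using moved unfolding moved_oruga_def by simp_all

lemma arcs: "arcs G = rin \<delta> ` letters \<union> rout \<delta> ` letters"
proof -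
  have arcs: "arcs G = (raw ` letters - cut_edges (Suc m) \<delta>) \<union>
      FromSource ` cut_edges (Suc m) \<delta> \<union> ToSink ` cut_edges (Suc m) \<delta>"
    using moved unfolding moved_oruga_def by simp
  have cuts: "cut_edges (Suc m) \<delta> = raw ` {x \<in> letters. cut_at \<delta> (fst x) (snd x)}"
    unfolding cut_edges_def by force
  show ?thesis
  proof (intro equalityI subsetI)
    fix e assume "e \<in> arcs G"
    then consider x where "x \<in> letters" "e = raw x" "\<not> cut_at \<delta> (fst x) (snd x)"
      | x where "x \<in> letters" "e = FromSource (raw x)" "cut_at \<delta> (fst x) (snd x)"
      | x where "x \<in> letters" "e = ToSink (raw x)" "cut_at \<delta> (fst x) (snd x)"
      unfolding arcs cuts by blast
    then show "e \<in> rin \<delta> ` letters \<union> rout \<delta> ` letters"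
    proof cases
      case (1 x)
      then have "e = rin \<delta> x" by (simp add: rin_def)
      then show ?thesis using 1(1) by blast
    next
      case (2 x)
      then have "e = rin \<delta> x" by (simp add: rin_def)
      then show ?thesis using 2(1) by blast
    next
      case (3 x)
      then have "e = rout \<delta> x" by (simp add: rout_def)
      then show ?thesis using 3(1) by blast
    qed
  next
    fix e assume "e \<in> rin \<delta> ` letters \<union> rout \<delta> ` letters"
    then obtain x where x: "x \<in> letters" "e = rin \<delta> x \<or> e = rout \<delta> x" by blast
    then show "e \<in> arcs G"
      using in_cut_edges[OF x(1)] unfolding arcs rin_def rout_def
      by (cases "cut_at \<delta> (fst x) (snd x)") auto
  qed
qed

lemma ends_rin_rout:
  assumes "i \<in> {1..Suc m}"
  shows "head G (rin \<delta> (i, b)) = Suc (Suc m) - i"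
    "tail G (rin \<delta> (i, b)) = (if cut_at \<delta> i b then 0 else Suc m - i)"
    "tail G (rout \<delta> (i, b)) = Suc m - i"
    "head G (rout \<delta> (i, b)) = (if cut_at \<delta> i b then Suc m else Suc (Suc m) - i)"
  using moved in_cut_edges[of "(i, b)"] assms
  unfolding moved_oruga_def rin_def rout_def by auto

lemma in_order_F: "in_order F v = {(rin \<delta> (i, False), rin \<delta> (i, True)) | i. i \<in> {1..Suc m} \<and> v = Suc (Suc m) - i}"
proof -
  have "in_order F v = {(moved_in (cut_edges (Suc m) \<delta>) (raw (i, False)), moved_in (cut_edges (Suc m) \<delta>) (raw (i, True))) | i.
      i \<in> {1..Suc m} \<and> v = Suc m + 1 - i}"
    using moved unfolding moved_oruga_def by blast
  also have "\<dots> = {(rin \<delta> (i, False), rin \<delta> (i, True)) | i. i \<in> {1..Suc m} \<and> v = Suc (Suc m) - i}"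
    by (intro Collect_cong ex_cong1) (auto simp: moved_rin)
  finally show ?thesis .
qed

lemma out_order_F: "out_order F v = {(rout \<delta> (i, False), rout \<delta> (i, True)) | i. i \<in> {1..<Suc m} \<and> v = Suc m - i}"
proof -
  have "out_order F v = {(moved_out (cut_edges (Suc m) \<delta>) (raw (i, False)), moved_out (cut_edges (Suc m) \<delta>) (raw (i, True))) | i.
      i \<in> {1..<Suc m} \<and> v = Suc m - i}"
    using moved unfolding moved_oruga_def by blast
  also have "\<dots> = {(rout \<delta> (i, False), rout \<delta> (i, True)) | i. i \<in> {1..<Suc m} \<and> v = Suc m - i}"
    by (intro Collect_cong ex_cong1) (auto simp: moved_rout)
  finally show ?thesis .
qed

lemma arc_cases:
  assumes "e \<in> arcs G"
  obtains i b where "i \<in> {1..Suc m}" "e = rin \<delta> (i, b)" | i b where "i \<in> {1..Suc m}" "e = rout \<delta> (i, b)"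
  using assms unfolding arcs by blast

text \<open>Vertices grow along arcs, so every walk is a path and has at most one edge into and one
  edge out of each vertex.\<close>

lemma arc_less: "e \<in> arcs G \<Longrightarrow> tail G e < head G e \<and> head G e \<le> Suc m"
  by (elim arc_cases) (auto simp: ends_rin_rout)

sublocale wf_digraph G
proof
  fix e assume "e \<in> arcs G"
  from arc_less[OF this] show "tail G e \<in> verts G" "head G e \<in> verts G" by simp_all
qed

lemma awalk_increasing:
  "awalk u p v \<Longrightarrow> distinct (awalk_verts u p) \<and> (\<forall>x\<in>set (awalk_verts u p). u \<le> x)"
proof (induction p arbitrary: u)
  case (Cons e p)
  then have e: "e \<in> arcs G" "u = tail G e" "awalk (head G e) p v" by (auto simp: awalk_Cons_iff)
  then show ?case using Cons.IH[OF e(3)] arc_less[OF e(1)] by fastforce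
qed simp

lemma routes_eq_awalk: "routes F = {P. awalk 0 P (Suc m)}"
  using awalk_increasing by (auto simp: routes_def apath_def)

lemma awalk_le:
  assumes "awalk u p v"
  shows "u \<le> v"
proof -
  have "awlast u p = v" using assms by auto
  then have "v \<in> set (awalk_verts u p)" using last_in_set[OF awalk_verts_non_Nil] by metis
  then show ?thesis using awalk_increasing[OF assms] by blast
qed

lemma tail_inj: "awalk u p v \<Longrightarrow> e \<in> set p \<Longrightarrow> f \<in> set p \<Longrightarrow> tail G e = tail G f \<Longrightarrow> e = f"
  using awalk_increasing[of u p v] by (auto simp: awalk_verts_conv distinct_map inj_on_def split: if_splits)

lemma head_inj: "awalk u p v \<Longrightarrow> e \<in> set p \<Longrightarrow> f \<in> set p \<Longrightarrow> head G e = head G f \<Longrightarrow> e = f"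
  using awalk_increasing[of u p v] awalk_verts_conv'[of u p v]
  by (auto simp: distinct_map inj_on_def awalk_def split: if_splits)

text \<open>The bound on \<open>i\<close> excludes the source, where all the edges
  \<open>FromSource\<close> begin. For \<open>i = 0\<close> the conclusion \<open>1 \<le> i\<close>
  says that no arc leaves the sink.\<close>

lemma out_arc:
  assumes "e \<in> arcs G" "tail G e = Suc m - i" "i \<le> m"
  obtains b where "1 \<le> i" "e = rout \<delta> (i, b)"
  using assms(1)
proof (cases rule: arc_cases)
  case (1 k b)
  then have "\<not> cut_at \<delta> k b" "k = i"
    using assms(2,3) by (auto simp: ends_rin_rout split: if_splits)
  then have "e = rout \<delta> (i, b)" using 1 by (simp add: rin_def rout_def)
  then show ?thesis using that 1 \<open>k = i\<close> by auto
next
  case (2 k b)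
  then have "k = i" using assms(2,3) by (auto simp: ends_rin_rout)
  then show ?thesis using that 2 by auto
qed

lemma walks_to_sink: "i \<le> m \<Longrightarrow> awalk (Suc m - i) P (Suc m) \<longleftrightarrow> P \<in> map (rout \<delta>) ` suffixes \<delta> i"
proof (induction i arbitrary: P)
  case 0
  have "P = []" if "awalk (Suc m) P (Suc m)"
  proof (cases P)
    case (Cons e Q)
    then have "e \<in> arcs G" "tail G e = Suc m - 0" using that by (auto simp: awalk_Cons_iff)
    then show ?thesis by (rule out_arc) simp_all
  qed simp
  then show ?case by (auto simp: awalk_Nil_iff)
next
  case (Suc i)
  have head: "head G (rout \<delta> (Suc i, b)) = (if cut_at \<delta> (Suc i) b then Suc m else Suc m - i)"
    "tail G (rout \<delta> (Suc i, b)) = Suc m - Suc i" "rout \<delta> (Suc i, b) \<in> arcs G" for b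
    using Suc.prems ends_rin_rout[of "Suc i" b] by (auto simp: arcs)
  have step: "awalk (head G (rout \<delta> (Suc i, b))) Q (Suc m) \<longleftrightarrow>
      Q \<in> map (rout \<delta>) ` (if cut_at \<delta> (Suc i) b then {[]} else suffixes \<delta> i)" for b Q
  proof (cases "cut_at \<delta> (Suc i) b")
    case True
    have "awalk (Suc m) Q (Suc m) \<longleftrightarrow> Q = []"
    proof
      assume w: "awalk (Suc m) Q (Suc m)"
      show "Q = []"
      proof (cases Q)
        case (Cons e R)
        then have "e \<in> arcs G" "tail G e = Suc m - 0" using w by (auto simp: awalk_Cons_iff)
        then show ?thesis by (rule out_arc) simp_all
      qed
    qed (simp add: awalk_Nil_iff)
    then show ?thesis using True head(1)[of b] by simp
  next
    case False
    then show ?thesis using Suc.IH[of Q] Suc.prems head(1)[of b] by simp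
  qed
  show ?case
  proof
    assume w: "awalk (Suc m - Suc i) P (Suc m)"
    show "P \<in> map (rout \<delta>) ` suffixes \<delta> (Suc i)"
    proof (cases P)
      case Nil
      then show ?thesis using w Suc.prems diff_le_self[of m i] by (simp add: awalk_Nil_iff)
    next
      case (Cons e Q)
      then have "e \<in> arcs G" "tail G e = Suc m - Suc i" and Q: "awalk (head G e) Q (Suc m)"
        using w by (auto simp: awalk_Cons_iff)
      then obtain b where e: "e = rout \<delta> (Suc i, b)" using Suc.prems by (elim out_arc)
      obtain h where "Q = map (rout \<delta>) h" "h \<in> (if cut_at \<delta> (Suc i) b then {[]} else suffixes \<delta> i)"
        using Q step unfolding e by blast
      then have "P = map (rout \<delta>) ((Suc i, b) # h)" "(Suc i, b) # h \<in> suffixes \<delta> (Suc i)"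
        using Cons e by (simp_all add: suffixes.simps(2))
      then show ?thesis by blast
    qed
  next
    assume "P \<in> map (rout \<delta>) ` suffixes \<delta> (Suc i)"
    then obtain b h where h: "P = rout \<delta> (Suc i, b) # map (rout \<delta>) h"
        "h \<in> (if cut_at \<delta> (Suc i) b then {[]} else suffixes \<delta> i)"
      by (auto simp: suffixes.simps(2))
    then have "awalk (head G (rout \<delta> (Suc i, b))) (map (rout \<delta>) h) (Suc m)"
      unfolding step by blast
    then show "awalk (Suc m - Suc i) P (Suc m)"
      using head by (simp add: h(1) awalk_Cons_iff)
  qed
qed

lemma words_alt:
  "words \<delta> m = {(Suc s, b) # h | s b h. s \<le> m \<and> (s = m \<or> cut_at \<delta> (Suc s) b) \<and> h \<in> suffixes \<delta> s}"
  unfolding words_def top_words_def low_words_def by (auto simp: le_less)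

lemma routes_eq: "routes F = route_of \<delta> ` words \<delta> m"
proof (intro equalityI subsetI)
  fix P assume "P \<in> routes F"
  then have w: "awalk 0 P (Suc m)" by (simp add: routes_eq_awalk)
  then obtain e Q where P: "P = e # Q" by (cases P) (auto simp: awalk_Nil_iff)
  then have e: "e \<in> arcs G" "tail G e = 0" and Q: "awalk (head G e) Q (Suc m)"
    using w by (auto simp: awalk_Cons_iff)
  obtain s b where s: "s \<le> m" "e = rin \<delta> (Suc s, b)" "s = m \<or> cut_at \<delta> (Suc s) b"
    using e(1)
  proof (cases rule: arc_cases)
    case (1 i b)
    then show ?thesis
      using that[of "i - 1" b] e(2) by (cases i) (auto simp: ends_rin_rout split: if_splits)
  next
    case (2 i b)
    \<comment> \<open>An edge \<open>rout\<close> that leaves the source belongs to the top label,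
      which is uncut, so it is \<open>rin\<close> as well.\<close>
    then have "i = Suc m" using e(2) by (auto simp: ends_rin_rout)
    then show ?thesis
      using that[of m b] 2 not_cut(3) by (simp add: rin_def rout_def)
  qed
  then have "head G e = Suc m - s" using ends_rin_rout(1)[of "Suc s" b] by simp
  then obtain h where "Q = map (rout \<delta>) h" "h \<in> suffixes \<delta> s"
    using Q walks_to_sink[OF s(1)] by auto
  then have "P = route_of \<delta> ((Suc s, b) # h)" "(Suc s, b) # h \<in> words \<delta> m"
    using P s unfolding words_alt by (auto simp: route_of_def)
  then show "P \<in> route_of \<delta> ` words \<delta> m" by blast
next
  fix P assume "P \<in> route_of \<delta> ` words \<delta> m"
  then obtain s b h where P: "P = rin \<delta> (Suc s, b) # map (rout \<delta>) h" and h: "h \<in> suffixes \<delta> s"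
    and s: "s \<le> m" "s = m \<or> cut_at \<delta> (Suc s) b"
    unfolding words_alt by (auto simp: route_of_def)
  have "rin \<delta> (Suc s, b) \<in> arcs G" using s by (auto simp: arcs)
  moreover have "tail G (rin \<delta> (Suc s, b)) = 0" "head G (rin \<delta> (Suc s, b)) = Suc m - s"
    using s ends_rin_rout[of "Suc s" b] by auto
  moreover have "awalk (Suc m - s) (map (rout \<delta>) h) (Suc m)"
    using walks_to_sink[OF s(1)] h by blast
  ultimately show "P \<in> routes F"
    by (simp add: routes_eq_awalk P awalk_Cons_iff)
qed

lemma words_levels: "P \<in> words \<delta> m \<Longrightarrow> (i, b) \<in> set P \<Longrightarrow> i \<in> {1..Suc m}"
  unfolding words_alt by (auto dest: suffixes_levels)

lemma route_walk: "P \<in> words \<delta> m \<Longrightarrow> awalk 0 (route_of \<delta> P) (Suc m)"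
  using routes_eq routes_eq_awalk by blast

text \<open>A \<open>ToSink\<close> edge ends in the sink, so at any other vertex the entering edge
  has the form \<open>rin\<close>. Dually in \<open>leaving_edge\<close>, a
  \<open>FromSource\<close> edge leaves the source.\<close>

lemma entering_edge:
  assumes P: "P \<in> words \<delta> m" and e: "e \<in> set (route_of \<delta> P)" "head G e = v" "v \<noteq> Suc m"
  obtains i b where "(i, b) \<in> set P" "e = rin \<delta> (i, b)" "v = Suc (Suc m) - i" "i \<in> {1..Suc m}"
proof -
  obtain x h where Ph: "P = x # h" using P unfolding words_alt by blast
  show thesis
  proof (cases "e = rin \<delta> x")
    case True
    obtain i b where x: "x = (i, b)" by (cases x)
    have "i \<in> {1..Suc m}" using words_levels[OF P, of i b] by (simp add: Ph x)
    then show thesis using that[of i b] e True ends_rin_rout(1)[of i b] by (simp add: x Ph)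
  next
    case False
    then obtain i b where ib: "(i, b) \<in> set h" "e = rout \<delta> (i, b)"
      using e(1) by (auto simp: Ph route_of_def)
    have i: "i \<in> {1..Suc m}" using words_levels[OF P, of i b] ib(1) by (simp add: Ph)
    then have "\<not> cut_at \<delta> i b" "v = Suc (Suc m) - i"
      using e ends_rin_rout(4)[OF i, of b] by (auto simp: ib(2) split: if_splits)
    then show thesis using that[of i b] ib i by (simp add: Ph rin_def rout_def)
  qed
qed

lemma leaving_edge:
  assumes P: "P \<in> words \<delta> m" and e: "e \<in> set (route_of \<delta> P)" "tail G e = v" "v \<noteq> 0"
  obtains j b where "(j, b) \<in> set P" "e = rout \<delta> (j, b)" "v = Suc m - j" "j \<in> {1..<Suc m}"
proof -
  obtain s b h where Ph: "P = (Suc s, b) # h" and s: "s = m \<or> cut_at \<delta> (Suc s) b" "s \<le> m"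
    using P unfolding words_alt by blast
  have "tail G (rin \<delta> (Suc s, b)) = 0" using s ends_rin_rout(2)[of "Suc s" b] by auto
  then have "e \<noteq> rin \<delta> (Suc s, b)" using e by auto
  then obtain j c where jc: "(j, c) \<in> set h" "e = rout \<delta> (j, c)"
    using e(1) by (auto simp: Ph route_of_def)
  have j: "j \<in> {1..Suc m}" using words_levels[OF P, of j c] jc(1) by (simp add: Ph)
  then have "v = Suc m - j" using e ends_rin_rout(3)[OF j, of c] by (simp add: jc(2))
  moreover from this have "j \<in> {1..<Suc m}" using j e(3) by auto
  ultimately show thesis using that[of j c] jc by (simp add: Ph)
qed

lemma in_order_iff:
  assumes "i \<in> {1..Suc m}"
  shows "(rin \<delta> (i, p), rin \<delta> (i, q)) \<in> in_order F (Suc (Suc m) - i) \<longleftrightarrow> \<not> p \<and> q"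
  using assms unfolding in_order_F by (auto intro!: exI[of _ i])

lemma out_order_iff:
  assumes "j \<in> {1..<Suc m}"
  shows "(rout \<delta> (j, p), rout \<delta> (j, q)) \<in> out_order F (Suc m - j) \<longleftrightarrow> \<not> p \<and> q"
  using assms unfolding out_order_F by (auto intro!: exI[of _ j])

end

section \<open>Coherence of routes and of words\<close>

definition descending :: "word \<Rightarrow> bool" where
  "descending P \<longleftrightarrow> successively (\<lambda>x y. fst x = Suc (fst y)) P"

lemma descending_suffix: "h \<in> suffixes \<delta> i \<Longrightarrow> descending h \<and> (h = [] \<or> fst (hd h) = i)"
proof (induction i arbitrary: h)
  case (Suc i)
  obtain b t where "h = (Suc i, b) # t" "t = [] \<or> t \<in> suffixes \<delta> i"
    using Suc.prems unfolding suffixes_Suc by auto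
  then show ?case using Suc.IH[of t] by (auto simp: descending_def successively_Cons)
qed (simp add: descending_def)

lemma descending_words: "P \<in> words \<delta> m \<Longrightarrow> descending P"
  using descending_suffix
  by (fastforce simp: words_def top_words_def low_words_def descending_def successively_Cons)

lemma descending_between:
  "descending ((i, p) # M @ (j, q) # B) \<Longrightarrow> j < i \<and> map fst M = rev [Suc j..<i]"
proof (induction M arbitrary: i p)
  case (Cons x M)
  obtain k r where x: "x = (k, r)" by (cases x)
  have "i = Suc k" "j < k \<and> map fst M = rev [Suc j..<k]"
    using Cons.prems Cons.IH[of k r] by (simp_all add: x descending_def)
  then show ?case by (simp add: x)
qed (simp add: descending_def)

lemma descending_split:
  assumes P: "descending P" and ip: "(i, p) \<in> set P" and jq: "(j, q) \<in> set P" and ji: "j < i"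
  obtains A M B where "P = A @ (i, p) # M @ (j, q) # B" "map fst M = rev [Suc j..<i]"
proof -
  obtain A C where AC: "P = A @ (i, p) # C" using ip by (meson split_list)
  have "(j, q) \<notin> set A"
  proof
    assume "(j, q) \<in> set A"
    then obtain A1 A2 where "A = A1 @ (j, q) # A2" by (meson split_list)
    then have "descending ((j, q) # A2 @ (i, p) # C)"
      using P by (simp add: AC descending_def successively_append_iff)
    then show False using descending_between[of j q A2 i p C] ji by simp
  qed
  then have "(j, q) \<in> set C" using jq ji by (auto simp: AC)
  then obtain M B where C: "C = M @ (j, q) # B" by (meson split_list)
  have "descending ((i, p) # M @ (j, q) # B)"
    using P by (simp add: AC C descending_def successively_append_iff)
  then show thesis using that[of A M B] descending_between by (simp add: AC C)
qed

lemma functionalD: "functional P \<Longrightarrow> (i, b) \<in> set P \<Longrightarrow> (i, c) \<in> set P \<Longrightarrow> b = c"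
  unfolding functional_def by (cases b; cases c) auto

text \<open>Two opposite differences closest to each other bound a common subword.\<close>

lemma opposite_differences:
  assumes "functional P" "functional Q" "\<not> coh P Q"
  obtains i j p where "j < i" "(i, p) \<in> set P" "(i, \<not> p) \<in> set Q" "(j, \<not> p) \<in> set P" "(j, p) \<in> set Q"
    "\<And>k b c. j < k \<Longrightarrow> k < i \<Longrightarrow> (k, b) \<in> set P \<Longrightarrow> (k, c) \<in> set Q \<Longrightarrow> b = c"
proof -
  define opp where "opp i j p \<longleftrightarrow> j < i \<and> (i, p) \<in> set P \<and> (i, \<not> p) \<in> set Q \<and>
    (j, \<not> p) \<in> set P \<and> (j, p) \<in> set Q" for i j p
  define K where "K d \<longleftrightarrow> (\<exists>i j p. opp i j p \<and> i = j + d)" for d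
  have "\<exists>d. K d"
  proof -
    obtain i j where ij: "(i, False) \<in> set P" "(i, True) \<in> set Q" "(j, True) \<in> set P" "(j, False) \<in> set Q"
      using assms(3) unfolding coh_def lt_def by blast
    then have "i \<noteq> j" using functionalD[OF assms(1), of i False True] by auto
    then have "opp i j False \<or> opp j i True" using ij by (auto simp: opp_def)
    then obtain i' j' p where opp: "opp i' j' p" by blast
    then have "i' = j' + (i' - j')" by (simp add: opp_def)
    then show ?thesis using opp unfolding K_def by blast
  qed
  then obtain d where "K d" and least: "\<And>d'. d' < d \<Longrightarrow> \<not> K d'"
    using exists_least_iff[of K] by blast
  then obtain i j p where ij: "opp i j p" "i = j + d" unfolding K_def by blast
  have "b = c" if k: "j < k" "k < i" "(k, b) \<in> set P" "(k, c) \<in> set Q" for k b c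
  proof (rule ccontr)
    assume "b \<noteq> c"
    then have c: "c \<longleftrightarrow> \<not> b" by auto
    show False
    proof (cases "b = p")
      case True
      then have "opp k j p" "k = j + (k - j)" "k - j < d" using ij k c by (auto simp: opp_def)
      then show False using least unfolding K_def by blast
    next
      case False
      then have "b \<longleftrightarrow> \<not> p" by auto
      then have "opp i k p" "i = k + (i - k)" "i - k < d" using ij k c by (auto simp: opp_def)
      then show False using least unfolding K_def by blast
    qed
  qed
  then show thesis using that[of j i p] ij(1) unfolding opp_def by blast
qed

context bicho_graph
begin

lemma awalk_last_head:
  assumes "awalk u p v" "p \<noteq> []"
  shows "head G (last p) = v"
proof -
  have "awlast u p = v" using assms(1) by auto
  then show ?thesis using assms(2) by (simp add: awalk_verts_conv)
qed

lemma subpathD: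
  assumes P: "P \<in> words \<delta> m" and s: "subpath_of F (a, R, b) (route_of \<delta> P)"
  obtains P1 P2 where "route_of \<delta> P = P1 @ R @ P2" "awalk 0 P1 a" "awalk a R b" "awalk b P2 (Suc m)"
  using s unfolding subpath_of_def by auto

text \<open>At both ends of a maximal common subpath the routes differ, as a shared edge would
  extend it. So they have opposite letters at two labels, and by \<open>coh\<close> the same route
  has the bump at both; each order puts the bump before the dip.\<close>

lemma coh_imp_coherent:
  assumes P: "P \<in> words \<delta> m" and Q: "Q \<in> words \<delta> m" and coh: "coh P Q"
  shows "coherent F (route_of \<delta> P) (route_of \<delta> Q)"
  unfolding coherent_def
proof (intro allI impI ballI)
  fix a R b eP eQ fP fQ
  let ?P = "route_of \<delta> P" and ?Q = "route_of \<delta> Q"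
  assume "max_common_subpath F ?P ?Q (a, R, b) \<and> a \<noteq> source F \<and> b \<noteq> sink F"
  then have subs: "subpath_of F (a, R, b) ?P" "subpath_of F (a, R, b) ?Q"
    and max: "\<And>s. subpath_of F s ?P \<Longrightarrow> subpath_of F s ?Q \<Longrightarrow> extends_path F s (a, R, b) \<Longrightarrow> s = (a, R, b)"
    and ab: "a \<noteq> 0" "b \<noteq> Suc m"
    unfolding max_common_subpath_def by auto
  assume in_sets: "eP \<in> set ?P" "eQ \<in> set ?Q" "fP \<in> set ?P" "fQ \<in> set ?Q"
    and "head G eP = a \<and> head G eQ = a \<and> tail G fP = b \<and> tail G fQ = b"
  then have ends: "head G eP = a" "head G eQ = a" "tail G fP = b" "tail G fQ = b" by auto
  obtain P1 P2 where P12: "?P = P1 @ R @ P2" "awalk 0 P1 a" "awalk a R b" "awalk b P2 (Suc m)"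
    using subs(1) by (rule subpathD[OF P])
  obtain Q1 Q2 where Q12: "?Q = Q1 @ R @ Q2" "awalk 0 Q1 a" "awalk a R b" "awalk b Q2 (Suc m)"
    using subs(2) by (rule subpathD[OF Q])
  have "a \<le> b" "b \<le> Suc m" using awalk_le P12 by blast+
  then have a: "a \<noteq> Suc m" and b: "b \<noteq> 0" using ab by auto
  have last_edge: "\<exists>S. S1 = S @ [e] \<and> awalk 0 S (tail G e) \<and> awalk (tail G e) [e] a"
    if S1: "awalk 0 S1 a" and e: "e \<in> set (S1 @ R @ S2)" "head G e = a" and w: "awalk 0 (S1 @ R @ S2) (Suc m)" for S1 S2 e
  proof -
    have "S1 \<noteq> []" using S1 ab(1) by (auto simp: awalk_Nil_iff)
    then obtain S f where S: "S1 = S @ [f]" by (meson rev_exhaust)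
    then have f: "awalk 0 S (tail G f)" "awalk (tail G f) [f] a"
      using S1 by (auto simp: awalk_Cons_iff awalk_Nil_iff)
    then have "head G f = a" by (auto simp: awalk_Cons_iff awalk_Nil_iff)
    then have "f = e" using head_inj[OF w _ e(1)] e(2) by (simp add: S)
    then show ?thesis using S f by blast
  qed
  have first_edge: "\<exists>S. S2 = e # S \<and> awalk b [e] (head G e) \<and> awalk (head G e) S (Suc m)"
    if S2: "awalk b S2 (Suc m)" and e: "e \<in> set (S1 @ R @ S2)" "tail G e = b" and w: "awalk 0 (S1 @ R @ S2) (Suc m)" for S1 S2 e
  proof -
    have "S2 \<noteq> []" using S2 ab(2) by (auto simp: awalk_Nil_iff)
    then obtain S f where S: "S2 = f # S" by (meson neq_Nil_conv)
    then have f: "awalk (head G f) S (Suc m)" "f \<in> arcs G" "b = tail G f"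
      using S2 by (auto simp: awalk_Cons_iff)
    then have "f = e" using tail_inj[OF w _ e(1)] e(2) by (simp add: S)
    then show ?thesis using S f arc_implies_awalk by blast
  qed
  note wP = route_walk[OF P, unfolded P12(1)] and wQ = route_walk[OF Q, unfolded Q12(1)]
  have "eP \<noteq> eQ"
  proof
    assume eq: "eP = eQ"
    obtain S where S: "P1 = S @ [eP]" "awalk 0 S (tail G eP)" "awalk (tail G eP) [eP] a"
      using last_edge[OF P12(2) _ ends(1) wP] in_sets(1) P12(1) by metis
    obtain S' where S': "Q1 = S' @ [eP]" "awalk 0 S' (tail G eP)"
      using last_edge[OF Q12(2) _ ends(2) wQ] in_sets(2) Q12(1) eq by metis
    have R: "awalk (tail G eP) ([eP] @ R) b" using S(3) P12(3) by (rule awalk_appendI)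
    have "(tail G eP, [eP] @ R, b) = (a, R, b)"
    proof (rule max)
      show "subpath_of F (tail G eP, [eP] @ R, b) ?P"
        unfolding subpath_of_def using S R P12 by (simp del: awalk_append_iff) blast
      show "subpath_of F (tail G eP, [eP] @ R, b) ?Q"
        unfolding subpath_of_def using S' R Q12 by (simp del: awalk_append_iff) blast
      show "extends_path F (tail G eP, [eP] @ R, b) (a, R, b)"
        unfolding extends_path_def prod.case using S(3) awalk_last_in_verts[OF P12(3)]
        by (intro exI[of _ "[eP]"] exI[of _ "[]"]) (simp add: awalk_Nil_iff)
    qed
    then show False by simp
  qed
  have "fP \<noteq> fQ"
  proof
    assume eq: "fP = fQ"
    obtain S where S: "P2 = fP # S" "awalk b [fP] (head G fP)" "awalk (head G fP) S (Suc m)"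
      using first_edge[OF P12(4) _ ends(3) wP] in_sets(3) P12(1) by metis
    obtain S' where S': "Q2 = fP # S'" "awalk (head G fP) S' (Suc m)"
      using first_edge[OF Q12(4) _ ends(4) wQ] in_sets(4) Q12(1) eq by metis
    have R: "awalk a (R @ [fP]) (head G fP)" using P12(3) S(2) by (rule awalk_appendI)
    have "(a, R @ [fP], head G fP) = (a, R, b)"
    proof (rule max)
      show "subpath_of F (a, R @ [fP], head G fP) ?P"
        unfolding subpath_of_def using S R P12 by (simp del: awalk_append_iff) blast
      show "subpath_of F (a, R @ [fP], head G fP) ?Q"
        unfolding subpath_of_def using S' R Q12 by (simp del: awalk_append_iff) blast
      show "extends_path F (a, R @ [fP], head G fP) (a, R, b)"
        unfolding extends_path_def prod.case using S(2) awalk_hd_in_verts[OF P12(3)]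
        by (intro exI[of _ "[]"] exI[of _ "[fP]"]) (simp add: awalk_Nil_iff)
    qed
    then show False by simp
  qed
  obtain i p where i: "(i, p) \<in> set P" "eP = rin \<delta> (i, p)" "a = Suc (Suc m) - i" "i \<in> {1..Suc m}"
    by (rule entering_edge[OF P in_sets(1) ends(1) a])
  obtain i' q where i': "(i', q) \<in> set Q" "eQ = rin \<delta> (i', q)" "a = Suc (Suc m) - i'" "i' \<in> {1..Suc m}"
    by (rule entering_edge[OF Q in_sets(2) ends(2) a])
  obtain j p' where j: "(j, p') \<in> set P" "fP = rout \<delta> (j, p')" "b = Suc m - j" "j \<in> {1..<Suc m}"
    by (rule leaving_edge[OF P in_sets(3) ends(3) b])
  obtain j' q' where j': "(j', q') \<in> set Q" "fQ = rout \<delta> (j', q')" "b = Suc m - j'" "j' \<in> {1..<Suc m}"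
    by (rule leaving_edge[OF Q in_sets(4) ends(4) b])
  have "i' = i" "j' = j" using i(3,4) i'(3,4) j(3,4) j'(3,4) by auto
  then have "q \<longleftrightarrow> \<not> p" "q' \<longleftrightarrow> \<not> p'"
    using \<open>eP \<noteq> eQ\<close> \<open>fP \<noteq> fQ\<close> i(2) i'(2) j(2) j'(2) by auto
  then have "p = p'"
    using coh i(1) i'(1) j(1) j'(1) unfolding coh_def lt_def \<open>i' = i\<close> \<open>j' = j\<close>
    by (cases p; cases p') auto
  moreover have "(eP, eQ) \<in> in_order F a \<longleftrightarrow> \<not> p"
    unfolding i(2,3) i'(2) \<open>i' = i\<close> in_order_iff[OF i(4)] using \<open>q \<longleftrightarrow> \<not> p\<close> by blast
  moreover have "(fP, fQ) \<in> out_order F b \<longleftrightarrow> \<not> p'"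
    unfolding j(2,3) j'(2) \<open>j' = j\<close> out_order_iff[OF j(4)] using \<open>q' \<longleftrightarrow> \<not> p'\<close> by blast
  ultimately show "(eP, eQ) \<in> in_order F a \<longleftrightarrow> (fP, fQ) \<in> out_order F b" by simp
qed

lemma route_split:
  assumes P: "P \<in> words \<delta> m" and split: "P = A @ (i, p) # M @ (j, q) # B"
    and M: "map fst M = rev [Suc j..<i]" and ji: "j < i"
  defines "a \<equiv> Suc (Suc m) - i" and "b \<equiv> Suc m - j"
  obtains P1 P2 where "route_of \<delta> P = (P1 @ [rin \<delta> (i, p)]) @ map (rout \<delta>) M @ (rout \<delta> (j, q) # P2)"
    "awalk 0 (P1 @ [rin \<delta> (i, p)]) a" "awalk a (map (rout \<delta>) M) b" "awalk b (rout \<delta> (j, q) # P2) (Suc m)"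
proof -
  let ?P1 = "route_of \<delta> (A @ [(i, p)])" and ?R = "map (rout \<delta>) M" and ?P2 = "map (rout \<delta>) ((j, q) # B)"
  have eq: "route_of \<delta> P = ?P1 @ ?R @ ?P2"
    unfolding split by (cases A) (simp_all add: route_of_def)
  have i: "i \<in> {1..Suc m}" and j: "j \<in> {1..Suc m}"
    using words_levels[OF P] by (auto simp: split)
  have w: "awalk 0 (?P1 @ ?R @ ?P2) (Suc m)" using route_walk[OF P] unfolding eq .
  then have w1: "awalk 0 ?P1 (awlast 0 ?P1)" and w2: "awalk (awlast 0 ?P1) (?R @ ?P2) (Suc m)" by auto
  have tail_b: "tail G (rout \<delta> (j, q)) = b" using ends_rin_rout(3)[OF j] by (simp add: b_def)
  have "awlast 0 ?P1 = a"
  proof (cases M)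
    case Nil
    then have "i = Suc j" using M ji by (cases "i = Suc j") auto
    then show ?thesis using w2 tail_b by (simp add: Nil awalk_Cons_iff a_def b_def)
  next
    case (Cons x M')
    obtain k c where x: "x = (k, c)" by (cases x)
    have "rev [Suc j..<i] = k # map fst M'" using M by (simp add: Cons x)
    then have "i = Suc k" by (cases i) (auto split: if_splits)
    moreover have "k \<in> {1..Suc m}" using words_levels[OF P, of k c] by (simp add: split Cons x)
    then have "tail G (rout \<delta> (k, c)) = Suc m - k" by (rule ends_rin_rout(3))
    ultimately show ?thesis using w2 by (simp add: Cons x awalk_Cons_iff a_def)
  qed
  then have w1: "awalk 0 ?P1 a" and w2: "awalk a (?R @ ?P2) (Suc m)" using w1 w2 by simp_all
  then have R: "awalk a ?R (awlast a ?R)" and w3: "awalk (awlast a ?R) ?P2 (Suc m)" by auto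
  have "awlast a ?R = b" using w3 tail_b by (simp add: awalk_Cons_iff)
  then have R: "awalk a ?R b" and w3: "awalk b ?P2 (Suc m)" using R w3 by simp_all
  \<comment> \<open>Unless the letter comes first, \<open>route_of\<close> writes it as
    \<open>rout\<close>. The vertex \<open>a\<close> is not the sink, so the edge entering it is
    also \<open>rin\<close> of the letter.\<close>
  have "last ?P1 = rin \<delta> (i, p)"
  proof -
    have "?P1 \<noteq> []" by (simp add: route_of_def)
    then have last: "last ?P1 \<in> set (route_of \<delta> P)" "head G (last ?P1) = a"
      using awalk_last_head[OF w1] unfolding eq by auto
    have "a \<noteq> Suc m" using i ji j by (auto simp: a_def)
    then obtain i' p' where ip': "(i', p') \<in> set P" "last ?P1 = rin \<delta> (i', p')"
        "a = Suc (Suc m) - i'" "i' \<in> {1..Suc m}"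
      by (rule entering_edge[OF P last])
    then have "i' = i" using i by (auto simp: a_def)
    moreover from this have "p' = p"
      using functionalD[OF words_functional[OF P], of i p' p] ip'(1) by (simp add: split)
    ultimately show ?thesis using ip'(2) by simp
  qed
  then obtain P1 where P1: "?P1 = P1 @ [rin \<delta> (i, p)]"
    by (metis append_butlast_last_id list.distinct(1) route_of_def)
  show thesis
    using that[of P1 "map (rout \<delta>) B"] eq w1 R w3 unfolding P1 by simp
qed

text \<open>If the words are incomparable, take two opposite differences with agreement between
  them. Words skip no label, so the pieces in between are one common path; the differing letters
  around it make it maximal, and there the two orders disagree.\<close>

lemma coherent_imp_coh:
  assumes P: "P \<in> words \<delta> m" and Q: "Q \<in> words \<delta> m"
    and coherent: "coherent F (route_of \<delta> P) (route_of \<delta> Q)"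
  shows "coh P Q"
proof (rule ccontr)
  let ?P = "route_of \<delta> P" and ?Q = "route_of \<delta> Q"
  assume "\<not> coh P Q"
  then obtain i j p where ji: "j < i" and mem: "(i, p) \<in> set P" "(i, \<not> p) \<in> set Q" "(j, \<not> p) \<in> set P" "(j, p) \<in> set Q"
    and agree: "\<And>k b c. j < k \<Longrightarrow> k < i \<Longrightarrow> (k, b) \<in> set P \<Longrightarrow> (k, c) \<in> set Q \<Longrightarrow> b = c"
    using opposite_differences[OF words_functional[OF P] words_functional[OF Q]] by metis
  obtain A M B where AM: "P = A @ (i, p) # M @ (j, \<not> p) # B" and M: "map fst M = rev [Suc j..<i]"
    by (rule descending_split[OF descending_words[OF P] mem(1,3) ji])
  obtain A' M' B' where AM': "Q = A' @ (i, \<not> p) # M' @ (j, p) # B'" and M': "map fst M' = rev [Suc j..<i]"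
    by (rule descending_split[OF descending_words[OF Q] mem(2,4) ji])
  have "M = M'"
  proof (rule nth_equalityI)
    show len: "length M = length M'" using arg_cong[OF trans[OF M M'[symmetric]], of length] by simp
    fix r assume r: "r < length M"
    obtain k x where kx: "M ! r = (k, x)" by (cases "M ! r")
    obtain l y where ly: "M' ! r = (l, y)" by (cases "M' ! r")
    have "map fst M ! r = map fst M' ! r" using M M' by simp
    then have "l = k" using r len kx ly by simp
    have "(k, x) \<in> set M" "(l, y) \<in> set M'" using kx ly r len by (metis nth_mem)+
    moreover from this have "k \<in> set (map fst M)" by force
    then have "j < k" "k < i" unfolding M by auto
    ultimately have "x = y" using agree[of k x y] AM AM' \<open>l = k\<close> by auto
    then show "M ! r = M' ! r" using kx ly \<open>l = k\<close> by simp
  qed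
  define a b R where "a = Suc (Suc m) - i" and "b = Suc m - j" and "R = map (rout \<delta>) M"
  have i: "i \<in> {1..Suc m}" and j: "j \<in> {1..<Suc m}"
    using words_levels[OF P mem(1)] words_levels[OF P mem(3)] ji by auto
  obtain P1 P2 where P12: "?P = (P1 @ [rin \<delta> (i, p)]) @ R @ (rout \<delta> (j, \<not> p) # P2)"
    "awalk 0 (P1 @ [rin \<delta> (i, p)]) a" "awalk a R b" "awalk b (rout \<delta> (j, \<not> p) # P2) (Suc m)"
    unfolding a_def b_def R_def by (rule route_split[OF P AM M ji])
  obtain Q1 Q2 where Q12: "?Q = (Q1 @ [rin \<delta> (i, \<not> p)]) @ R @ (rout \<delta> (j, p) # Q2)"
    "awalk 0 (Q1 @ [rin \<delta> (i, \<not> p)]) a" "awalk a R b" "awalk b (rout \<delta> (j, p) # Q2) (Suc m)"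
    unfolding a_def b_def R_def \<open>M = M'\<close> by (rule route_split[OF Q AM' M' ji])
  have heads: "head G (rin \<delta> (i, c)) = a" for c using ends_rin_rout(1)[OF i] by (simp add: a_def)
  have tails: "tail G (rout \<delta> (j, c)) = b" for c using ends_rin_rout(3)[of j] j by (simp add: b_def)
  have sub: "subpath_of F (a, R, b) ?P" "subpath_of F (a, R, b) ?Q"
    unfolding subpath_of_def using P12 Q12 by (simp_all del: awalk_append_iff append_assoc) blast+
  have "max_common_subpath F ?P ?Q (a, R, b)"
    unfolding max_common_subpath_def
  proof (intro conjI allI impI sub)
    fix s assume s: "subpath_of F s ?P \<and> subpath_of F s ?Q \<and> extends_path F s (a, R, b)"
    obtain a' R' b' where s_def: "s = (a', R', b')" by (cases s)
    obtain S1 S2 where S: "R' = S1 @ R @ S2" "awalk a' S1 a" "awalk b S2 b'"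
      using s unfolding s_def extends_path_def by auto
    have sets: "set R' \<subseteq> set ?P" "set R' \<subseteq> set ?Q"
      using s unfolding s_def subpath_of_def by auto
    \<comment> \<open>A longer common subpath would contain the unique edge of each route that
      enters \<open>a\<close>, but these two edges differ.\<close>
    have "S1 = []"
    proof (rule ccontr)
      assume "S1 \<noteq> []"
      then have e: "last S1 \<in> set R'" "head G (last S1) = a"
        using awalk_last_head[OF S(2)] by (auto simp: S(1))
      have "last S1 = rin \<delta> (i, p)"
        by (rule head_inj[OF route_walk[OF P]]) (use e sets(1) heads P12(1) in auto)
      moreover have "last S1 = rin \<delta> (i, \<not> p)"
        by (rule head_inj[OF route_walk[OF Q]]) (use e sets(2) heads Q12(1) in auto)
      ultimately show False by simp
    qed
    moreover have "S2 = []"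
    proof (rule ccontr)
      assume "S2 \<noteq> []"
      then obtain f S where "S2 = f # S" by (meson neq_Nil_conv)
      then have f: "f \<in> set R'" "tail G f = b" using S by (auto simp: awalk_Cons_iff)
      have "f = rout \<delta> (j, \<not> p)"
        by (rule tail_inj[OF route_walk[OF P]]) (use f sets(1) tails P12(1) in auto)
      moreover have "f = rout \<delta> (j, p)"
        by (rule tail_inj[OF route_walk[OF Q]]) (use f sets(2) tails Q12(1) in auto)
      ultimately show False by simp
    qed
    ultimately show "s = (a, R, b)" using S by (auto simp: s_def awalk_Nil_iff)
  qed
  moreover have "a \<noteq> source F" "b \<noteq> sink F" using i j by (auto simp: a_def b_def)
  ultimately have "(rin \<delta> (i, p), rin \<delta> (i, \<not> p)) \<in> in_order F a \<longleftrightarrow>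
      (rout \<delta> (j, \<not> p), rout \<delta> (j, p)) \<in> out_order F b"
    using coherent heads tails unfolding coherent_def by (simp add: P12(1) Q12(1))
  then show False
    unfolding a_def b_def in_order_iff[OF i] out_order_iff[OF j] by simp
qed

section \<open>From words to maximal cliques of routes\<close>

lemma route_of_inj_on: "inj_on (route_of \<delta>) (words \<delta> m)"
  by (rule inj_onI, rule route_of_inj) (auto simp: words_alt)

lemma clique_image_iff:
  assumes C: "C \<subseteq> words \<delta> m"
  shows "clique F (route_of \<delta> ` C) \<longleftrightarrow> (\<forall>P\<in>C. \<forall>Q\<in>C. coh P Q)"
proof -
  have "pairwise (coherent F) (route_of \<delta> ` C) \<longleftrightarrow> (\<forall>P\<in>C. \<forall>Q\<in>C. coh P Q)"
  proof
    assume pw: "pairwise (coherent F) (route_of \<delta> ` C)"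
    show "\<forall>P\<in>C. \<forall>Q\<in>C. coh P Q"
    proof (intro ballI)
      fix P Q assume PQ: "P \<in> C" "Q \<in> C"
      show "coh P Q"
      proof (cases "P = Q")
        case True
        then show ?thesis using coh_refl words_functional C PQ by blast
      next
        case False
        then have "route_of \<delta> P \<noteq> route_of \<delta> Q"
          using inj_onD[OF route_of_inj_on] C PQ by blast
        then have "coherent F (route_of \<delta> P) (route_of \<delta> Q)"
          using pw PQ unfolding pairwise_def by blast
        then show ?thesis using coherent_imp_coh C PQ by blast
      qed
    qed
  next
    assume "\<forall>P\<in>C. \<forall>Q\<in>C. coh P Q"
    then show "pairwise (coherent F) (route_of \<delta> ` C)"
      unfolding pairwise_def using coh_imp_coherent C by blast
  qed
  then show ?thesis unfolding clique_def routes_eq using C by blast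
qed

lemma maximal_cliques_eq: "maximal_cliques F = (\<lambda>C. route_of \<delta> ` C) ` word_cliques \<delta> m"
proof (intro equalityI subsetI)
  fix D assume D: "D \<in> maximal_cliques F"
  then have "clique F D" and max: "\<And>C'. clique F C' \<Longrightarrow> D \<subseteq> C' \<Longrightarrow> C' = D"
    unfolding maximal_cliques_def by blast+
  then have "D \<subseteq> route_of \<delta> ` words \<delta> m" unfolding clique_def routes_eq by blast
  then obtain C where C: "C \<subseteq> words \<delta> m" "D = route_of \<delta> ` C" by (meson subset_imageE)
  then have coh_C: "\<forall>P\<in>C. \<forall>Q\<in>C. coh P Q" using clique_image_iff \<open>clique F D\<close> by blast
  have "P \<in> C" if P: "P \<in> words \<delta> m" and coh_P: "\<forall>Q\<in>C. coh P Q" for P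
  proof -
    have "coh P P" using coh_refl words_functional[OF P] by blast
    then have "\<forall>P'\<in>insert P C. \<forall>Q\<in>insert P C. coh P' Q"
      using coh_C coh_P coh_sym by blast
    then have "clique F (route_of \<delta> ` insert P C)"
      using clique_image_iff[of "insert P C"] P C(1) by blast
    then have "route_of \<delta> ` insert P C = D" by (rule max) (use C(2) in blast)
    then have "route_of \<delta> P \<in> route_of \<delta> ` C" using C(2) by blast
    then show ?thesis using inj_on_image_mem_iff[OF route_of_inj_on P C(1)] by blast
  qed
  then have "C \<in> word_cliques \<delta> m" unfolding word_cliques_def using C(1) coh_C by blast
  then show "D \<in> (\<lambda>C. route_of \<delta> ` C) ` word_cliques \<delta> m" using C(2) by blast
next
  fix D assume "D \<in> (\<lambda>C. route_of \<delta> ` C) ` word_cliques \<delta> m"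
  then obtain C where C: "C \<in> word_cliques \<delta> m" "D = route_of \<delta> ` C" by blast
  note CD = word_cliquesD[OF C(1)]
  have "C' = D" if C': "clique F C'" "D \<subseteq> C'" for C'
  proof -
    have "C' \<subseteq> route_of \<delta> ` words \<delta> m" using C'(1) unfolding clique_def routes_eq by blast
    then obtain K where K: "K \<subseteq> words \<delta> m" "C' = route_of \<delta> ` K" by (meson subset_imageE)
    then have coh_K: "\<forall>P\<in>K. \<forall>Q\<in>K. coh P Q" using clique_image_iff C'(1) by blast
    have "C \<subseteq> K"
    proof
      fix P assume P: "P \<in> C"
      then have "route_of \<delta> P \<in> route_of \<delta> ` K" using C'(2) C(2) K(2) by blast
      then show "P \<in> K" using inj_on_image_mem_iff[OF route_of_inj_on _ K(1)] P CD(1) by blast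
    qed
    then have "K \<subseteq> C" using CD(3) K(1) coh_K by blast
    then show ?thesis using \<open>C \<subseteq> K\<close> K(2) C(2) by blast
  qed
  moreover have "clique F D" using clique_image_iff[OF CD(1)] CD(2) C(2) by blast
  ultimately show "D \<in> maximal_cliques F" unfolding maximal_cliques_def by blast
qed

end

section \<open>Inserting and deleting the largest node\<close>

definition lnk :: "'a rel \<Rightarrow> 'a rel" where
  "lnk E = (E \<union> E\<inverse>)\<^sup>*"

lemma lnk_refl [simp]: "(a, a) \<in> lnk E"
  by (simp add: lnk_def)

lemma lnk_trans: "(a, b) \<in> lnk E \<Longrightarrow> (b, c) \<in> lnk E \<Longrightarrow> (a, c) \<in> lnk E"
  unfolding lnk_def by (rule rtrancl_trans)

lemma lnk_sym: "(a, b) \<in> lnk E \<Longrightarrow> (b, a) \<in> lnk E"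
  unfolding lnk_def by (meson sym_Un_converse sym_rtrancl symD)

lemma lnk_arc: "(a, b) \<in> E \<Longrightarrow> (a, b) \<in> lnk E"
  unfolding lnk_def by blast

lemma lnk_converse [simp]: "lnk (E\<inverse>) = lnk E"
  unfolding lnk_def by (simp add: Un_commute)

lemma lnk_map:
  assumes "(a, b) \<in> lnk E" and step: "\<And>x y. (x, y) \<in> E \<Longrightarrow> (h x, h y) \<in> lnk F"
  shows "(h a, h b) \<in> lnk F"
  using assms(1) unfolding lnk_def[of E]
proof (induction rule: rtrancl_induct)
  case (step y z)
  then show ?case using assms(2) lnk_sym lnk_trans by (metis Un_iff converse_iff)
qed simp

lemma lnk_subset: "(\<And>x y. (x, y) \<in> E \<Longrightarrow> (x, y) \<in> lnk F) \<Longrightarrow> (a, b) \<in> lnk E \<Longrightarrow> (a, b) \<in> lnk F"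
  using lnk_map[of a b E "\<lambda>x. x" F] by blast

lemma lnk_mono: "E \<subseteq> F \<Longrightarrow> (a, b) \<in> lnk E \<Longrightarrow> (a, b) \<in> lnk F"
  by (rule lnk_subset) (auto intro: lnk_arc)

lemma lnk_closed: "(a, b) \<in> lnk E \<Longrightarrow> a \<in> V \<Longrightarrow> E \<subseteq> V \<times> V \<Longrightarrow> b \<in> V"
  unfolding lnk_def by (induction rule: rtrancl_induct) auto

lemma lnk_last_step:
  assumes "(a, b) \<in> lnk E" "a \<noteq> b"
  obtains z where "(a, z) \<in> lnk E" "(z, b) \<in> E \<or> (b, z) \<in> E"
  using assms(1)[unfolded lnk_def] assms(2) unfolding lnk_def by (cases rule: rtranclE) auto

lemma successively_lnk:
  "successively (\<lambda>x y. (x, y) \<in> F) w \<Longrightarrow> x \<in> set w \<Longrightarrow> y \<in> set w \<Longrightarrow> (x, y) \<in> lnk F"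
proof (induction w arbitrary: x y rule: induct_list012)
  case (3 a b w)
  have ab: "(a, b) \<in> lnk F" using 3(3) by (auto intro: lnk_arc)
  have "(b, z) \<in> lnk F" if "z \<in> set (a # b # w)" for z
    using that 3(2)[of b z] 3(3) ab lnk_sym by auto
  then show ?case using 3(4,5) lnk_sym lnk_trans by meson
qed simp_all

text \<open>The conditions on the parent slots, \<open>A\<close> being the nodes with two of them:
  the whole component behind a parent lies on the side of that parent, and no two parents share a
  slot. The child slots are covered by \<open>half B (E\<inverse>)\<close>.\<close>

definition half :: "nat set \<Rightarrow> nat rel \<Rightarrow> bool" where
  "half A E \<longleftrightarrow>
     (\<forall>c p k. (c, p) \<in> E \<longrightarrow> c \<in> A \<longrightarrow> (p, k) \<in> lnk (E - {(c, p)}) \<longrightarrow> (k < c \<longleftrightarrow> p < c)) \<and>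
     (\<forall>c p q. (c, p) \<in> E \<longrightarrow> (c, q) \<in> E \<longrightarrow> (c \<in> A \<longrightarrow> (p < c \<longleftrightarrow> q < c)) \<longrightarrow> p = q)"

definition connects :: "nat \<Rightarrow> nat rel \<Rightarrow> bool" where
  "connects n E \<longleftrightarrow> (\<forall>i\<in>{1..n}. \<forall>j\<in>{1..n}. (i, j) \<in> lnk E)"

text \<open>Together with \<open>connects\<close> this makes the underlying graph a tree. Loops and
  antiparallel pairs are excluded too, since the ends of such an edge stay linked without
  it.\<close>

definition bridges :: "nat rel \<Rightarrow> bool" where
  "bridges E \<longleftrightarrow> (\<forall>c p. (c, p) \<in> E \<longrightarrow> (c, p) \<notin> lnk (E - {(c, p)}))"

text \<open>
  A pair \<open>(c, p)\<close> of \<open>E\<close> is an edge from the child \<open>c\<close> to its parent \<open>p\<close>; \<open>A\<close> and \<open>B\<close> are the sets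
  of nodes with two parent and with two child slots. The slots of an edge are determined by the
  labels of its ends, except at the largest node, where they do not matter.
\<close>

definition ptree :: "nat set \<Rightarrow> nat set \<Rightarrow> nat \<Rightarrow> nat rel \<Rightarrow> bool" where
  "ptree A B n E \<longleftrightarrow> E \<subseteq> {1..n} \<times> {1..n} \<and> connects n E \<and> bridges E \<and> half A E \<and> half B (E\<inverse>)"

text \<open>A climb that always uses the right parent slot, or the only one, and stops where that
  slot is empty: a parent still present at the end sits in a left slot.\<close>

definition up_vis :: "nat set \<Rightarrow> nat rel \<Rightarrow> nat list \<Rightarrow> bool" where
  "up_vis A E w \<longleftrightarrow> successively (\<lambda>x y. (x, y) \<in> E \<and> (x \<in> A \<longrightarrow> x < y)) w \<and>
     (\<forall>y. (last w, y) \<in> E \<longrightarrow> last w \<in> A \<and> y < last w)"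

text \<open>
  \<open>w\<close> is the upward path of the nodes that can be seen from a point to the right of the whole tree.
\<close>

definition vis :: "nat set \<Rightarrow> nat set \<Rightarrow> nat \<Rightarrow> nat rel \<Rightarrow> nat list \<Rightarrow> bool" where
  "vis A B n E w \<longleftrightarrow> n \<in> set w \<and> distinct w \<and> set w \<subseteq> {1..n} \<and>
     up_vis A E w \<and> up_vis B (E\<inverse>) (rev w)"

text \<open>By \<open>spot\<close>, \<open>S\<close> and \<open>T\<close> have at most one element:
  the node below and the node above \<open>N\<close>. If both exist, \<open>N\<close> subdivides
  their edge; if one is missing, \<open>N\<close> fills a dangling slot. Sets treat these cases at
  once.\<close>

definition ins :: "nat \<Rightarrow> nat set \<Rightarrow> nat set \<Rightarrow> nat rel \<Rightarrow> nat rel" where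
  "ins N S T E = (E - S \<times> T) \<union> S \<times> {N} \<union> {N} \<times> T"

definition del :: "nat \<Rightarrow> nat rel \<Rightarrow> nat rel" where
  "del N E = {(a, b) \<in> E. a \<noteq> N \<and> b \<noteq> N} \<union> {(a, b). (a, N) \<in> E \<and> (N, b) \<in> E}"

definition spot :: "nat \<Rightarrow> nat set \<Rightarrow> nat set \<Rightarrow> nat rel \<Rightarrow> bool" where
  "spot N S T E \<longleftrightarrow> N \<notin> Field E \<and> N \<notin> S \<and> N \<notin> T \<and> S \<times> T \<subseteq> E \<and> S \<union> T \<noteq> {} \<and>
     (\<forall>x\<in>S. \<forall>y\<in>S. x = y) \<and> (\<forall>x\<in>T. \<forall>y\<in>T. x = y)"

lemma half_sideD:
  "half A E \<Longrightarrow> (c, p) \<in> E \<Longrightarrow> c \<in> A \<Longrightarrow> (p, k) \<in> lnk (E - {(c, p)}) \<Longrightarrow> k < c \<longleftrightarrow> p < c"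
  unfolding half_def by blast

lemma half_uniqD:
  "half A E \<Longrightarrow> (c, p) \<in> E \<Longrightarrow> (c, q) \<in> E \<Longrightarrow> (c \<in> A \<Longrightarrow> p < c \<longleftrightarrow> q < c) \<Longrightarrow> p = q"
  unfolding half_def by blast

lemma bridgesD: "bridges E \<Longrightarrow> (c, p) \<in> E \<Longrightarrow> (c, p) \<notin> lnk (E - {(c, p)})"
  unfolding bridges_def by blast

lemma converse_del: "(E - {(a, b)})\<inverse> = E\<inverse> - {(b, a)}"
  by auto

lemma bridges_converse [simp]: "bridges (E\<inverse>) \<longleftrightarrow> bridges E"
proof -
  have "bridges (F\<inverse>)" if F: "bridges F" for F
    unfolding bridges_def
  proof (intro allI impI notI)
    fix c p assume "(c, p) \<in> F\<inverse>" "(c, p) \<in> lnk (F\<inverse> - {(c, p)})"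
    then show False
      using bridgesD[OF F, of p c] lnk_sym[of c p] by (metis converse_del converse_iff lnk_converse)
  qed
  from this[of E] this[of "E\<inverse>"] show ?thesis by auto
qed

text \<open>Reversing all edges exchanges parents with children and \<open>A\<close> with
  \<open>B\<close>, and it reverses the visible path. Hence the slot arguments below are given for
  parents only.\<close>

lemma ptree_converse: "ptree A B n (E\<inverse>) \<longleftrightarrow> ptree B A n E"
  unfolding ptree_def connects_def by auto

lemma vis_converse: "vis A B n (E\<inverse>) (rev w) \<longleftrightarrow> vis B A n E w"
  unfolding vis_def by auto

lemma spot_converse: "spot N S T (E\<inverse>) \<longleftrightarrow> spot N T S E"
  unfolding spot_def by auto

lemma ins_converse: "(ins N S T E)\<inverse> = ins N T S (E\<inverse>)"
  unfolding ins_def by auto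

section \<open>Links before and after an insertion\<close>

lemma lnk_contract:
  assumes N: "N \<notin> Field F" "N \<notin> S" "N \<notin> T"
    and single: "\<And>x y. x \<in> S \<Longrightarrow> y \<in> S \<Longrightarrow> x = y" "\<And>x y. x \<in> T \<Longrightarrow> y \<in> T \<Longrightarrow> x = y"
    and ab: "a \<noteq> N" "b \<noteq> N"
  shows "(a, b) \<in> lnk (F \<union> S \<times> {N} \<union> {N} \<times> T) \<longleftrightarrow> (a, b) \<in> lnk (F \<union> S \<times> T)"
    (is "_ \<in> lnk ?E' \<longleftrightarrow> _ \<in> lnk ?E")
proof
  assume *: "(a, b) \<in> lnk ?E'"
  show "(a, b) \<in> lnk ?E"
  proof (cases "S \<union> T = {}")
    case True
    then show ?thesis using * by simp
  next
    case False
    then obtain z where z: "z \<in> S \<union> T" by blast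
    \<comment> \<open>Collapses \<open>N\<close> onto a neighbour. The edges at \<open>N\<close>
      become trivial or turn into the edge that \<open>N\<close> subdivides.\<close>
    define h where "h x = (if x = N then z else x)" for x
    have "(h x, h y) \<in> lnk ?E" if xy: "(x, y) \<in> ?E'" for x y
    proof -
      consider "(x, y) \<in> F" | "x \<in> S" "y = N" | "x = N" "y \<in> T" using xy by blast
      then show ?thesis
      proof cases
        case 1
        then have "h x = x" "h y = y" using N(1) by (auto simp: h_def Field_def)
        then show ?thesis using 1 by (auto intro: lnk_arc)
      next
        case 2
        then have "h x = x" "h y = z" using N by (auto simp: h_def)
        moreover have "x = z \<or> (x, z) \<in> ?E" using 2 z single by blast
        ultimately show ?thesis by (auto intro: lnk_arc)
      next
        case 3
        then have "h x = z" "h y = y" using N by (auto simp: h_def)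
        moreover have "z = y \<or> (z, y) \<in> ?E" using 3 z single by blast
        ultimately show ?thesis by (auto intro: lnk_arc)
      qed
    qed
    then have "(h a, h b) \<in> lnk ?E" using lnk_map[OF *] by blast
    then show ?thesis using ab by (simp add: h_def)
  qed
next
  assume "(a, b) \<in> lnk ?E"
  then show "(a, b) \<in> lnk ?E'"
  proof (rule lnk_subset[rotated])
    fix x y assume "(x, y) \<in> ?E"
    then consider "(x, y) \<in> ?E'" | "(x, N) \<in> ?E'" "(N, y) \<in> ?E'" by blast
    then show "(x, y) \<in> lnk ?E'"
      by cases (blast intro: lnk_arc lnk_trans)+
  qed
qed

lemma spotD:
  assumes "spot N S T E"
  shows "N \<notin> Field E" "N \<notin> S" "N \<notin> T" "S \<times> T \<subseteq> E" "S \<union> T \<noteq> {}"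
    "x \<in> S \<Longrightarrow> y \<in> S \<Longrightarrow> x = y" "x \<in> T \<Longrightarrow> y \<in> T \<Longrightarrow> x = y"
    "(N, z) \<notin> E" "(z, N) \<notin> E"
  using assms unfolding spot_def Field_def by blast+

lemma lnk_ins_delete:
  assumes sp: "spot N S T E" and ab: "a \<noteq> N" "b \<noteq> N" and K: "K \<subseteq> E - S \<times> T"
  shows "(a, b) \<in> lnk (ins N S T E - K) \<longleftrightarrow> (a, b) \<in> lnk (E - K)"
proof -
  have "ins N S T E - K = (E - S \<times> T - K) \<union> S \<times> {N} \<union> {N} \<times> T"
    using K spotD[OF sp] unfolding ins_def by blast
  moreover have "E - K = (E - S \<times> T - K) \<union> S \<times> T"
    using K spotD(4)[OF sp] by blast
  moreover have "N \<notin> Field (E - S \<times> T - K)"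
    using spotD(1)[OF sp] unfolding Field_def by blast
  ultimately show ?thesis
    using lnk_contract[of N "E - S \<times> T - K" S T a b] spotD(2,3,6,7)[OF sp] ab by metis
qed

text \<open>Once its edge from \<open>x\<close> is gone, \<open>N\<close> has at most one neighbour
  and links no two old nodes. So this deletion acts like deleting the subdivided edge, if there is
  one.\<close>

lemma lnk_ins_delete_child:
  assumes sp: "spot N S T E" and ab: "a \<noteq> N" "b \<noteq> N" and x: "x \<in> S"
  shows "(a, b) \<in> lnk (ins N S T E - {(x, N)}) \<longleftrightarrow> (a, b) \<in> lnk (E - S \<times> T)"
proof -
  have "ins N S T E - {(x, N)} = (E - S \<times> T) \<union> {} \<times> {N} \<union> {N} \<times> T"
    using x spotD[OF sp] unfolding ins_def by blast
  moreover have "N \<notin> Field (E - S \<times> T)"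
    using spotD(1)[OF sp] unfolding Field_def by blast
  ultimately show ?thesis
    using lnk_contract[of N "E - S \<times> T" "{}" T a b] spotD(2,3,7)[OF sp] ab by simp
qed

lemma ins_cases:
  assumes "(c, p) \<in> ins N S T E"
  obtains "(c, p) \<in> E" "(c, p) \<notin> S \<times> T" | "c \<in> S" "p = N" | "c = N" "p \<in> T"
  using assms unfolding ins_def by blast

lemma ins_neighbour:
  assumes sp: "spot N S T E" and "(z, N) \<in> ins N S T E \<or> (N, z) \<in> ins N S T E"
  shows "z \<in> S \<union> T"
  using assms spotD[OF sp] unfolding ins_def by blast

text \<open>A bypass of the subdivided edge, continued to the new node from above, would bypass the
  edge below the new node.\<close>

lemma bridges_insD:
  assumes sp: "spot N S T E" and br: "bridges (ins N S T E)"
  shows "bridges E"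
  unfolding bridges_def
proof (intro allI impI notI)
  fix c p assume cp: "(c, p) \<in> E" and lnk: "(c, p) \<in> lnk (E - {(c, p)})"
  have ne: "c \<noteq> N" "p \<noteq> N" using cp spotD(8,9)[OF sp] by auto
  show False
  proof (cases "(c, p) \<in> S \<times> T")
    case True
    then have ST: "S \<times> T = {(c, p)}" using spotD(6,7)[OF sp] by blast
    have c: "c \<in> S" and p: "p \<in> T" using True by auto
    have "(c, p) \<in> lnk (ins N S T E - {(c, N)})"
      using lnk lnk_ins_delete_child[OF sp ne c] ST by simp
    moreover have "(p, N) \<in> lnk (ins N S T E - {(c, N)})"
      using p ne by (intro lnk_sym[OF lnk_arc]) (auto simp: ins_def)
    moreover have "(c, N) \<in> ins N S T E" using c by (auto simp: ins_def)
    ultimately show False using bridgesD[OF br, of c N] lnk_trans[of c p _ N] by simp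
  next
    case False
    then have "(c, p) \<in> ins N S T E" using cp by (auto simp: ins_def)
    then show False
      using bridgesD[OF br, of c p] lnk lnk_ins_delete[OF sp ne, of "{(c, p)}"] cp False by simp
  qed
qed

lemma bridges_ins_child:
  assumes sp: "spot N S T E" and br: "bridges E" and x: "x \<in> S"
  shows "(x, N) \<notin> lnk (ins N S T E - {(x, N)})"
proof
  assume lnk: "(x, N) \<in> lnk (ins N S T E - {(x, N)})"
  have ne: "x \<noteq> N" using x spotD(2)[OF sp] by auto
  obtain y where y: "(x, y) \<in> lnk (ins N S T E - {(x, N)})"
      "(y, N) \<in> ins N S T E - {(x, N)} \<or> (N, y) \<in> ins N S T E - {(x, N)}"
    using lnk_last_step[OF lnk ne] .
  have "y \<in> T"
    using ins_neighbour[OF sp, of y] y(2) x spotD[OF sp] unfolding ins_def by blast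
  then have "y \<noteq> N" "(x, y) \<in> E" "S \<times> T = {(x, y)}"
    using spotD[OF sp] x by blast+
  then show False
    using y(1) lnk_ins_delete_child[OF sp ne _ x, of y] bridgesD[OF br, of x y] by simp
qed

lemma bridges_ins:
  assumes sp: "spot N S T E" and br: "bridges E"
  shows "bridges (ins N S T E)"
  unfolding bridges_def
proof (intro allI impI)
  fix c p assume "(c, p) \<in> ins N S T E"
  then show "(c, p) \<notin> lnk (ins N S T E - {(c, p)})"
  proof (cases rule: ins_cases)
    case 1
    then have "c \<noteq> N" "p \<noteq> N" using spotD(8,9)[OF sp] by auto
    then show ?thesis
      using lnk_ins_delete[OF sp, of c p "{(c, p)}"] 1 bridgesD[OF br] by blast
  next
    case 2
    then show ?thesis using bridges_ins_child[OF sp br] by blast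
  next
    case 3
    have "(p, N) \<notin> lnk (ins N T S (E\<inverse>) - {(p, N)})"
      by (rule bridges_ins_child) (use 3 sp br in \<open>simp_all add: spot_converse\<close>)
    then have "(p, N) \<notin> lnk (ins N S T E - {(N, p)})"
      by (metis ins_converse converse_del lnk_converse)
    then show ?thesis using 3 lnk_sym[of N p] by auto
  qed
qed

lemma connects_ins:
  assumes sp: "spot (Suc n) S T E" and ST: "S \<union> T \<subseteq> {1..n}"
  shows "connects (Suc n) (ins (Suc n) S T E) \<longleftrightarrow> connects n E"
proof -
  let ?N = "Suc n" and ?E' = "ins (Suc n) S T E"
  have eq: "(a, b) \<in> lnk ?E' \<longleftrightarrow> (a, b) \<in> lnk E" if "a \<in> {1..n}" "b \<in> {1..n}" for a b
    using lnk_ins_delete[OF sp, of a b "{}"] that by simp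
  obtain z where z: "z \<in> S \<union> T" using spotD(5)[OF sp] by blast
  then have zN: "(z, ?N) \<in> lnk ?E'"
    by (auto simp: ins_def intro: lnk_arc lnk_sym)
  show ?thesis
  proof
    assume "connects n E"
    then have az: "(a, z) \<in> lnk ?E'" if "a \<in> {1..?N}" for a
    proof (cases "a = ?N")
      case True
      then show ?thesis using lnk_sym[OF zN] by simp
    next
      case False
      then have "a \<in> {1..n}" using that by auto
      then show ?thesis
        using \<open>connects n E\<close> z ST eq[of a z] unfolding connects_def by blast
    qed
    show "connects ?N ?E'"
      unfolding connects_def by (intro ballI) (rule lnk_trans[OF az lnk_sym[OF az]])
  next
    assume "connects ?N ?E'"
    then have "(a, b) \<in> lnk ?E'" if "a \<in> {1..n}" "b \<in> {1..n}" for a b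
      using that unfolding connects_def by simp
    then show "connects n E" unfolding connects_def using eq by blast
  qed
qed

section \<open>Insertion at a gap of the visible path\<close>

definition last_set :: "'a list \<Rightarrow> 'a set" where
  "last_set u = (if u = [] then {} else {last u})"

definition hd_set :: "'a list \<Rightarrow> 'a set" where
  "hd_set v = (if v = [] then {} else {hd v})"

lemma last_set_rev [simp]: "last_set (rev v) = hd_set v"
  by (simp add: last_set_def hd_set_def last_rev)

lemma hd_set_rev [simp]: "hd_set (rev u) = last_set u"
  by (simp add: last_set_def hd_set_def hd_rev)

lemma last_set_subset: "last_set u \<subseteq> set u" and hd_set_subset: "hd_set v \<subseteq> set v"
  by (simp_all add: last_set_def hd_set_def)

lemma successively_split:
  "successively R (u @ v) \<Longrightarrow> x \<in> last_set u \<Longrightarrow> y \<in> hd_set v \<Longrightarrow> R x y"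
  by (auto simp: successively_append_iff last_set_def hd_set_def split: if_splits)

lemma visD:
  assumes "vis A B n E w"
  shows "n \<in> set w" "distinct w" "set w \<subseteq> {1..n}" "up_vis A E w" "up_vis B (E\<inverse>) (rev w)"
  using assms unfolding vis_def by blast+

lemma up_visD:
  assumes "up_vis A E w"
  shows "successively (\<lambda>x y. (x, y) \<in> E \<and> (x \<in> A \<longrightarrow> x < y)) w"
    "(last w, y) \<in> E \<Longrightarrow> last w \<in> A \<and> y < last w"
  using assms unfolding up_vis_def by blast+

lemma ptreeD:
  assumes "ptree A B n E"
  shows "E \<subseteq> {1..n} \<times> {1..n}" "connects n E" "bridges E" "half A E" "half B (E\<inverse>)"
  using assms unfolding ptree_def by blast+

lemma spot_vis:
  assumes t: "ptree A B n E" and v: "vis A B n E (u @ v)"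
  shows "spot (Suc n) (last_set u) (hd_set v) E"
proof -
  have "last_set u \<times> hd_set v \<subseteq> E"
    using successively_split[OF up_visD(1)[OF visD(4)[OF v]]] by blast
  moreover have "Suc n \<notin> Field E" using ptreeD(1)[OF t] by (auto simp: Field_def)
  moreover have "u @ v \<noteq> []" "Suc n \<notin> set (u @ v)"
    using visD(1,3)[OF v] by auto
  ultimately show ?thesis
    unfolding spot_def last_set_def hd_set_def by (auto split: if_splits)
qed

text \<open>
  The visible path crosses an edge only in a direction in which the slot allows larger labels;
  all other edges have the path, hence the largest node, on one side.
\<close>

lemma visible_side:
  assumes t: "ptree A B n E" and v: "vis A B n E w" and cp: "(c, p) \<in> E" and c: "c \<in> A"
    and z: "z \<in> set w" and lnk: "(p, z) \<in> lnk (E - {(c, p)})"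
  shows "\<not> p < c"
proof
  assume pc: "p < c"
  have "successively (\<lambda>x y. (x, y) \<in> E - {(c, p)}) w"
    using up_visD(1)[OF visD(4)[OF v]] by (rule successively_mono) (use pc c in auto)
  then have "(z, n) \<in> lnk (E - {(c, p)})"
    using z visD(1)[OF v] by (rule successively_lnk)
  then have "n < c"
    using half_sideD[OF ptreeD(4)[OF t] cp c lnk_trans[OF lnk]] pc by simp
  then show False using cp ptreeD(1)[OF t] by auto
qed

text \<open>An old edge with the new node behind it has a visible node behind it, so by
  \<open>visible_side\<close> its slot is not a left one. The edge from the lower neighbour up to
  the new node inherits the right side from the edge it subdivides. At the new node all other labels
  are smaller.\<close>

lemma half_ins:
  assumes t: "ptree A B n E" and v: "vis A B n E (u @ v)"
  shows "half A (ins (Suc n) (last_set u) (hd_set v) E)"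
proof -
  let ?N = "Suc n" and ?S = "last_set u" and ?T = "hd_set v"
  let ?E' = "ins ?N ?S ?T E"
  note sp = spot_vis[OF t v] and h = ptreeD(4)[OF t]
  have V: "E \<subseteq> {1..n} \<times> {1..n}" by (rule ptreeD(1)[OF t])
  have ST: "?S \<union> ?T \<subseteq> set (u @ v)" using last_set_subset hd_set_subset by fastforce
  then have STn: "?S \<union> ?T \<subseteq> {1..n}" using visD(3)[OF v] by blast
  have V': "?E' \<subseteq> {1..?N} \<times> {1..?N}" using V STn unfolding ins_def by auto
  have gap: "(x, y) \<in> E" "x \<in> A \<Longrightarrow> x < y" if "x \<in> ?S" "y \<in> ?T" for x y
    using successively_split[OF up_visD(1)[OF visD(4)[OF v]] that] by blast+
  have side: "k < c \<longleftrightarrow> p < c"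
    if cp: "(c, p) \<in> ?E'" and c: "c \<in> A" and k: "(p, k) \<in> lnk (?E' - {(c, p)})" for c p k
    using cp
  proof (cases rule: ins_cases)
    case 1
    then have ne: "c \<noteq> ?N" "p \<noteq> ?N" "c \<le> n" using V by auto
    note del = lnk_ins_delete[OF sp ne(2), of _ "{(c, p)}"]
    show ?thesis
    proof (cases "k = ?N")
      case False
      then have "(p, k) \<in> lnk (E - {(c, p)})" using k del 1 by simp
      then show ?thesis using half_sideD[OF h 1(1) c] by blast
    next
      case True
      obtain z where z: "(p, z) \<in> lnk (?E' - {(c, p)})"
          "(z, ?N) \<in> ?E' - {(c, p)} \<or> (?N, z) \<in> ?E' - {(c, p)}"
        using lnk_last_step[OF k[unfolded True] ne(2)] .
      then have zS: "z \<in> ?S \<union> ?T" using ins_neighbour[OF sp, of z] by blast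
      then have "(p, z) \<in> lnk (E - {(c, p)})"
        using z(1) del[of z] 1 STn by fastforce
      then have "\<not> p < c"
        using visible_side[OF t v 1(1) c] zS ST by blast
      then show ?thesis using True ne(3) by simp
    qed
  next
    case 2
    then have ne: "c \<noteq> ?N" "c < ?N" using STn by auto
    have "\<not> k < c"
    proof
      assume kc: "k < c"
      then have "?N \<noteq> k" using ne by simp
      then obtain z where z: "(k, z) \<in> lnk (?E' - {(c, ?N)})"
          "(z, ?N) \<in> ?E' - {(c, ?N)} \<or> (?N, z) \<in> ?E' - {(c, ?N)}"
        using lnk_last_step[OF lnk_sym[OF k[unfolded 2(2)]]] by metis
      have zT: "z \<in> ?T"
        using ins_neighbour[OF sp, of z] z(2) 2 spotD[OF sp] unfolding ins_def by blast
      then have "z \<noteq> ?N" "?S \<times> ?T = {(c, z)}" using 2 spotD[OF sp] by blast+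
      then have "(k, z) \<in> lnk (E - {(c, z)})"
        using z(1) lnk_ins_delete_child[OF sp _ _ 2(1), of k z] \<open>?N \<noteq> k\<close> by simp
      from half_sideD[OF h gap(1)[OF 2(1) zT] c lnk_sym[OF this]] have "z < c"
        using kc by simp
      then show False using gap(2)[OF 2(1) zT c] by simp
    qed
    then show ?thesis using 2 ne by simp
  next
    case 3
    then have p: "p \<in> {1..?N}" "p < ?N" using STn by auto
    have "k \<in> {1..?N}"
      using lnk_closed[OF k p(1)] V' by blast
    moreover have "k \<noteq> ?N"
      using bridgesD[OF bridges_ins[OF sp ptreeD(3)[OF t]] cp] lnk_sym[OF k] 3(1) by auto
    ultimately show ?thesis using 3 p by simp
  qed
  \<comment> \<open>The new node takes the slot of the subdivided edge, or at the top of the path a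
    slot that was free. An old parent in that slot would be the next visible node, whose edge is
    gone.\<close>
  have uniq_N: "q = ?N"
    if "c \<in> ?S" "(c, q) \<in> ?E'" and cond: "c \<in> A \<Longrightarrow> \<not> q < c" for c q
  proof (rule ccontr)
    assume "q \<noteq> ?N"
    then have q: "(c, q) \<in> E" "q \<notin> ?T" using that spotD(2)[OF sp] unfolding ins_def by blast+
    show False
    proof (cases "v = []")
      case True
      then have "c = last (u @ v)" using that(1) by (auto simp: last_set_def split: if_splits)
      then show False using up_visD(2)[OF visD(4)[OF v]] q cond by blast
    next
      case False
      then have "hd v \<in> ?T" by (simp add: hd_set_def)
      then have "hd v = q"
        using half_uniqD[OF h gap(1)[OF that(1)] q(1)] gap(2)[OF that(1)] cond by fastforce
      then show False using q(2) \<open>hd v \<in> ?T\<close> by simp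
    qed
  qed
  have uniq: "p = q"
    if cp: "(c, p) \<in> ?E'" and cq: "(c, q) \<in> ?E'" and cond: "c \<in> A \<Longrightarrow> p < c \<longleftrightarrow> q < c" for c p q
  proof (cases "c = ?N")
    case True
    then have "p \<in> ?T" "q \<in> ?T" using cp cq spotD[OF sp] unfolding ins_def by blast+
    then show ?thesis using spotD(7)[OF sp] by blast
  next
    case False
    have cn: "c < ?N" using False cp V' by auto
    consider "p = ?N" | "q = ?N" | "p \<noteq> ?N" "q \<noteq> ?N" by blast
    then show ?thesis
    proof cases
      case 1
      then have "c \<in> ?S" using cp False spotD[OF sp] unfolding ins_def by blast
      then show ?thesis using uniq_N[OF _ cq] cond 1 cn by auto
    next
      case 2
      then have "c \<in> ?S" using cq False spotD[OF sp] unfolding ins_def by blast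
      then show ?thesis using uniq_N[OF _ cp] cond 2 cn by auto
    next
      case 3
      then have "(c, p) \<in> E" "(c, q) \<in> E" using cp cq False unfolding ins_def by blast+
      then show ?thesis using half_uniqD[OF h] cond by blast
    qed
  qed
  show ?thesis unfolding half_def using side uniq by meson
qed

lemma ptree_ins:
  assumes t: "ptree A B n E" and v: "vis A B n E (u @ v)"
  shows "ptree A B (Suc n) (ins (Suc n) (last_set u) (hd_set v) E)"
proof -
  note sp = spot_vis[OF t v]
  have ST: "last_set u \<union> hd_set v \<subseteq> {1..n}"
    using last_set_subset[of u] hd_set_subset[of v] visD(3)[OF v] by auto
  have "half B (ins (Suc n) (last_set (rev v)) (hd_set (rev u)) (E\<inverse>))"
    by (rule half_ins[of B A]) (use t v in \<open>simp_all add: ptree_converse vis_converse flip: rev_append\<close>)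
  moreover have "ins (Suc n) (last_set u) (hd_set v) E \<subseteq> {1..Suc n} \<times> {1..Suc n}"
    using ST ptreeD(1)[OF t] unfolding ins_def by auto
  ultimately show ?thesis
    unfolding ptree_def using half_ins[OF t v] bridges_ins[OF sp ptreeD(3)[OF t]]
      connects_ins[OF sp ST] ptreeD(2)[OF t] by (simp add: ins_converse)
qed

text \<open>With two child slots \<open>N\<close> holds everything below it in the left one, as all
  labels are smaller; from the right one sees the empty right slot instead of \<open>u\<close>. The
  same holds for \<open>v\<close> and the parent slots.\<close>

definition visible_list :: "nat set \<Rightarrow> nat set \<Rightarrow> nat \<Rightarrow> nat list \<Rightarrow> nat list \<Rightarrow> nat list" where
  "visible_list A B N u v = (if N \<in> B then [] else u) @ [N] @ (if N \<in> A then [] else v)"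

lemma up_vis_ins:
  assumes t: "ptree A B n E" and v: "vis A B n E (u @ v)"
  shows "up_vis A (ins (Suc n) (last_set u) (hd_set v) E) (visible_list A B (Suc n) u v)"
proof -
  let ?N = "Suc n" and ?S = "last_set u" and ?T = "hd_set v"
  let ?E' = "ins ?N ?S ?T E" and ?w = "visible_list A B (Suc n) u v"
  let ?R = "\<lambda>x y. (x, y) \<in> E \<and> (x \<in> A \<longrightarrow> x < y)" and ?R' = "\<lambda>x y. (x, y) \<in> ?E' \<and> (x \<in> A \<longrightarrow> x < y)"
  note sp = spot_vis[OF t v]
  have dist: "set u \<inter> set v = {}" and ran: "set u \<subseteq> {1..n}" "set v \<subseteq> {1..n}"
    using visD(2,3)[OF v] by auto
  have "successively ?R u" "successively ?R v"
    using up_visD(1)[OF visD(4)[OF v]] by (simp_all add: successively_append_iff)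
  moreover have "?R' x y" if "?R x y" "{x, y} \<subseteq> set u \<or> {x, y} \<subseteq> set v" for x y
    using that dist hd_set_subset[of v] last_set_subset[of u] by (auto simp: ins_def)
  ultimately have "successively ?R' u" "successively ?R' v"
    by (auto elim!: successively_mono)
  moreover have "?R' x ?N" if "x \<in> ?S" for x
    using that ran last_set_subset[of u] by (auto simp: ins_def)
  moreover have "?R' ?N y" if "?N \<notin> A" "y \<in> ?T" for y
    using that by (auto simp: ins_def)
  ultimately have "successively ?R' ?w"
    unfolding visible_list_def last_set_def hd_set_def
    by (auto simp: successively_append_iff successively_Cons split: if_splits)
  moreover have "last ?w \<in> A \<and> y < last ?w" if y: "(last ?w, y) \<in> ?E'" for y
  proof (cases "?N \<in> A \<or> v = []")
    case True
    then have "last ?w = ?N" by (auto simp: visible_list_def)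
    then have "y \<in> ?T" using y spotD[OF sp] unfolding ins_def by auto
    then show ?thesis
      using True \<open>last ?w = ?N\<close> ran hd_set_subset[of v] by (auto simp: hd_set_def)
  next
    case False
    then have w: "last ?w = last (u @ v)" "last ?w \<in> set v" by (auto simp: visible_list_def)
    then have "(last ?w, y) \<in> E"
      using y dist ran last_set_subset[of u] unfolding ins_def by auto
    then show ?thesis using up_visD(2)[OF visD(4)[OF v]] w(1) by metis
  qed
  ultimately show ?thesis unfolding up_vis_def by blast
qed

lemma vis_ins:
  assumes t: "ptree A B n E" and v: "vis A B n E (u @ v)"
  shows "vis A B (Suc n) (ins (Suc n) (last_set u) (hd_set v) E) (visible_list A B (Suc n) u v)"
proof -
  have "up_vis B (ins (Suc n) (last_set (rev v)) (hd_set (rev u)) (E\<inverse>))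
      (visible_list B A (Suc n) (rev v) (rev u))"
    by (rule up_vis_ins[of B A]) (use t v in \<open>simp_all add: ptree_converse vis_converse flip: rev_append\<close>)
  moreover have "visible_list B A (Suc n) (rev v) (rev u) = rev (visible_list A B (Suc n) u v)"
    by (simp add: visible_list_def)
  moreover have "set u \<inter> set v = {}" "distinct u" "distinct v" "set u \<subseteq> {1..n}" "set v \<subseteq> {1..n}"
    using visD(2,3)[OF v] by auto
  then have "distinct (visible_list A B (Suc n) u v)" "set (visible_list A B (Suc n) u v) \<subseteq> {1..Suc n}"
    by (auto simp: visible_list_def)
  ultimately show ?thesis
    unfolding vis_def using up_vis_ins[OF t v] by (simp add: ins_converse visible_list_def)
qed

section \<open>Deleting the largest node\<close>

definition children :: "nat \<Rightarrow> nat rel \<Rightarrow> nat set" where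
  "children N E = {x. (x, N) \<in> E}"

definition parents :: "nat \<Rightarrow> nat rel \<Rightarrow> nat set" where
  "parents N E = {y. (N, y) \<in> E}"

lemma ins_inverse:
  assumes "spot N S T E"
  shows "del N (ins N S T E) = E" "children N (ins N S T E) = S" "parents N (ins N S T E) = T"
proof -
  note sp = spotD[OF assms]
  show "children N (ins N S T E) = S" "parents N (ins N S T E) = T"
    using sp unfolding children_def parents_def ins_def by blast+
  then have *: "(x, N) \<in> ins N S T E \<longleftrightarrow> x \<in> S" "(N, x) \<in> ins N S T E \<longleftrightarrow> x \<in> T" for x
    unfolding children_def parents_def by blast+
  show "del N (ins N S T E) = E"
    unfolding del_def * using sp unfolding ins_def by auto
qed

text \<open>All neighbours of the largest node are smaller than it, so they cannot occupy a right
  slot; it has at most one child and one parent, whatever its decoration.\<close>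

lemma ptree_del_spot:
  assumes t: "ptree A B (Suc n) E" and n: "1 \<le> n"
  shows "spot (Suc n) (children (Suc n) E) (parents (Suc n) E) (del (Suc n) E)"
    and "ins (Suc n) (children (Suc n) E) (parents (Suc n) E) (del (Suc n) E) = E"
    and "children (Suc n) E \<union> parents (Suc n) E \<subseteq> {1..n}"
proof -
  let ?N = "Suc n" and ?S = "children (Suc n) E" and ?T = "parents (Suc n) E"
  have V: "E \<subseteq> {1..?N} \<times> {1..?N}" by (rule ptreeD(1)[OF t])
  have loop: "(?N, ?N) \<notin> E" using bridgesD[OF ptreeD(3)[OF t], of ?N ?N] by auto
  have N: "?N \<notin> ?S" "?N \<notin> ?T" using loop by (auto simp: children_def parents_def)
  show ST: "?S \<union> ?T \<subseteq> {1..n}"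
  proof
    fix x assume x: "x \<in> ?S \<union> ?T"
    then have "x \<in> {1..?N}" "x \<noteq> ?N" using V N unfolding children_def parents_def by blast+
    then show "x \<in> {1..n}" by auto
  qed
  have "?S \<union> ?T \<noteq> {}"
  proof -
    have "(n, ?N) \<in> lnk E" using ptreeD(2)[OF t] n unfolding connects_def by simp
    then obtain z where "(z, ?N) \<in> E \<or> (?N, z) \<in> E"
      by (rule lnk_last_step) simp
    then show ?thesis by (auto simp: children_def parents_def)
  qed
  moreover have "x = y" if "x \<in> ?T" "y \<in> ?T" for x y
  proof (rule half_uniqD[OF ptreeD(4)[OF t], of ?N])
    show "(?N, x) \<in> E" "(?N, y) \<in> E" using that by (auto simp: parents_def)
    have "x < ?N" "y < ?N" using that ST by auto
    then show "x < ?N \<longleftrightarrow> y < ?N" by simp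
  qed
  moreover have "x = y" if "x \<in> ?S" "y \<in> ?S" for x y
  proof (rule half_uniqD[OF ptreeD(5)[OF t], of ?N])
    show "(?N, x) \<in> E\<inverse>" "(?N, y) \<in> E\<inverse>" using that by (auto simp: children_def)
    have "x < ?N" "y < ?N" using that ST by auto
    then show "x < ?N \<longleftrightarrow> y < ?N" by simp
  qed
  moreover have "?S \<times> ?T \<subseteq> del ?N E" by (auto simp: del_def children_def parents_def)
  moreover have "?N \<notin> Field (del ?N E)"
    using loop by (auto simp: Field_def del_def)
  ultimately show "spot ?N ?S ?T (del ?N E)"
    unfolding spot_def using N by blast
  \<comment> \<open>Child and parent of the deleted node are not adjacent, as that would close a
    triangle. So the edge created by \<open>del\<close> is new, and \<open>ins\<close> removes
    exactly it.\<close>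
  have acyclic: "(x, y) \<notin> E" if x: "x \<in> ?S" and y: "y \<in> ?T" for x y
  proof
    assume xy: "(x, y) \<in> E"
    have "(x, ?N) \<in> E - {(x, y)}" "(?N, y) \<in> E - {(x, y)}"
      using x y N by (auto simp: children_def parents_def)
    then have "(x, y) \<in> lnk (E - {(x, y)})" by (rule lnk_trans[OF lnk_arc lnk_arc])
    then show False using bridgesD[OF ptreeD(3)[OF t] xy] by simp
  qed
  show "ins ?N ?S ?T (del ?N E) = E"
  proof (rule set_eqI)
    fix e :: "nat \<times> nat"
    obtain a b where e: "e = (a, b)" by (cases e)
    show "e \<in> ins ?N ?S ?T (del ?N E) \<longleftrightarrow> e \<in> E"
      unfolding e using acyclic[of a b] loop N
      by (auto simp: ins_def del_def children_def parents_def)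
  qed
qed

text \<open>Only an edge from \<open>x \<in> S\<close> to \<open>y \<in> T\<close> is restored. It
  takes over the slot of the edge from \<open>x\<close> to the largest node, which is not a left
  slot, and what lies behind \<open>y\<close> also lay behind the largest node.\<close>

lemma half_del:
  assumes V: "E \<subseteq> {1..n} \<times> {1..n}" and sp: "spot (Suc n) S T E"
    and h: "half A (ins (Suc n) S T E)" and ST: "S \<union> T \<subseteq> {1..n}"
  shows "half A E"
proof -
  let ?N = "Suc n" and ?E' = "ins (Suc n) S T E"
  have S: "(x, ?N) \<in> ?E'" if "x \<in> S" for x using that by (simp add: ins_def)
  have gap: "\<not> k < x" if x: "x \<in> S" and y: "y \<in> T" and c: "x \<in> A"
    and k: "(y, k) \<in> lnk (E - {(x, y)})" for x y k
  proof -
    have ST1: "S \<times> T = {(x, y)}" using x y spotD(6,7)[OF sp] by blast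
    have "y \<noteq> ?N" using y spotD(3)[OF sp] by blast
    have "k \<in> {1..n}" by (rule lnk_closed[OF k]) (use y ST V in blast)+
    then have "(y, k) \<in> lnk (?E' - {(x, ?N)})"
      using k lnk_ins_delete_child[OF sp \<open>y \<noteq> ?N\<close> _ x, of k] ST1 by simp
    moreover have "(?N, y) \<in> lnk (?E' - {(x, ?N)})"
      using y \<open>y \<noteq> ?N\<close> by (intro lnk_arc) (simp add: ins_def)
    ultimately have "(?N, k) \<in> lnk (?E' - {(x, ?N)})" by (rule lnk_trans[rotated])
    then have "k < x \<longleftrightarrow> ?N < x" by (rule half_sideD[OF h S[OF x] c])
    moreover have "x \<le> n" using x ST by auto
    ultimately show ?thesis by simp
  qed
  have side: "k < c \<longleftrightarrow> p < c"
    if cp: "(c, p) \<in> E" and c: "c \<in> A" and k: "(p, k) \<in> lnk (E - {(c, p)})" for c p k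
  proof (cases "(c, p) \<in> S \<times> T")
    case True
    then show ?thesis using gap[OF _ _ c k] gap[OF _ _ c lnk_refl, of p] by blast
  next
    case False
    have "p \<noteq> ?N" using cp V by auto
    moreover have "k \<in> {1..n}" by (rule lnk_closed[OF k]) (use cp V in blast)+
    ultimately have "(p, k) \<in> lnk (?E' - {(c, p)})"
      using k lnk_ins_delete[OF sp, of p k "{(c, p)}"] False cp by simp
    moreover have "(c, p) \<in> ?E'" using cp False by (simp add: ins_def)
    ultimately show ?thesis using half_sideD[OF h _ c] by blast
  qed
  have new: "(c, p) \<in> S \<times> T \<longrightarrow> p = q"
    if cp: "(c, p) \<in> E" and cq: "(c, q) \<in> E" and cond: "c \<in> A \<Longrightarrow> p < c \<longleftrightarrow> q < c" for c p q
  proof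
    assume cpS: "(c, p) \<in> S \<times> T"
    show "p = q"
    proof (cases "(c, q) \<in> S \<times> T")
      case True
      then show ?thesis using cpS spotD(7)[OF sp] by blast
    next
      case False
      then have "(c, q) \<in> ?E'" using cq by (simp add: ins_def)
      moreover have "?N < c \<longleftrightarrow> q < c" if "c \<in> A"
      proof -
        have "\<not> p < c" using gap[OF _ _ that lnk_refl, of p] cpS by blast
        moreover have "c \<le> n" using cp V by auto
        ultimately show ?thesis using cond[OF that] by simp
      qed
      ultimately have "?N = q" using half_uniqD[OF h S] cpS by blast
      then show ?thesis using cq V by auto
    qed
  qed
  have uniq: "p = q"
    if cp: "(c, p) \<in> E" and cq: "(c, q) \<in> E" and cond: "c \<in> A \<Longrightarrow> p < c \<longleftrightarrow> q < c" for c p q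
  proof (cases "(c, p) \<in> S \<times> T \<or> (c, q) \<in> S \<times> T")
    case True
    then show ?thesis using new[OF cp cq cond] new[OF cq cp] cond by blast
  next
    case False
    then have "(c, p) \<in> ?E'" "(c, q) \<in> ?E'" using cp cq by (auto simp: ins_def)
    then show ?thesis using half_uniqD[OF h] cond by blast
  qed
  show ?thesis unfolding half_def using side uniq by meson
qed

lemma ptree_del:
  assumes t: "ptree A B (Suc n) E" and n: "1 \<le> n"
  shows "ptree A B n (del (Suc n) E)"
proof -
  let ?N = "Suc n" and ?S = "children (Suc n) E" and ?T = "parents (Suc n) E"
  let ?E = "del (Suc n) E"
  note sp = ptree_del_spot(1)[OF t n] and ins = ptree_del_spot(2)[OF t n]
    and ST = ptree_del_spot(3)[OF t n]
  have V: "?E \<subseteq> {1..n} \<times> {1..n}"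
  proof (rule subrelI)
    fix a b assume ab: "(a, b) \<in> ?E"
    then have "a \<noteq> ?N" "b \<noteq> ?N" using spotD(8,9)[OF sp] by auto
    moreover have "a \<in> {1..?N}" "b \<in> {1..?N}"
      using ab ptreeD(1)[OF t] unfolding del_def by blast+
    ultimately show "(a, b) \<in> {1..n} \<times> {1..n}" by auto
  qed
  have "half A ?E"
    by (rule half_del[OF V sp]) (simp_all only: ins ptreeD(4)[OF t] ST)
  moreover have "half B (?E\<inverse>)"
  proof (rule half_del)
    show "?E\<inverse> \<subseteq> {1..n} \<times> {1..n}" using V by blast
    show "spot ?N ?T ?S (?E\<inverse>)" using sp by (simp add: spot_converse)
    show "half B (ins ?N ?T ?S (?E\<inverse>))"
      using ptreeD(5)[OF t] by (simp add: ins flip: ins_converse)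
    show "?T \<union> ?S \<subseteq> {1..n}" using ST by blast
  qed
  moreover have "connects n ?E"
    using connects_ins[OF sp ST] ptreeD(2)[OF t] by (simp add: ins)
  moreover have "bridges ?E"
    using bridges_insD[OF sp] ptreeD(3)[OF t] by (simp add: ins)
  ultimately show ?thesis unfolding ptree_def using V by blast
qed

section \<open>Every insertion happens on the visible path\<close>

lemma last_exit:
  assumes "(a, b) \<in> (R :: 'a rel)\<^sup>*" "a \<in> W" "b \<notin> W"
  obtains z z' where "z \<in> W" "z' \<notin> W" "(z, z') \<in> R" "(z', b) \<in> {(x, y) \<in> R. x \<notin> W \<and> y \<notin> W}\<^sup>*"
proof -
  let ?Q = "{(x, y) \<in> R. x \<notin> W \<and> y \<notin> W}\<^sup>*"
  have "(a, b) \<in> ?Q \<or> (\<exists>z z'. z \<in> W \<and> z' \<notin> W \<and> (z, z') \<in> R \<and> (z', b) \<in> ?Q)"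
    using assms(1)
  proof (induction rule: converse_rtrancl_induct)
    case (step x y)
    show ?case
    proof (cases "\<exists>z z'. z \<in> W \<and> z' \<notin> W \<and> (z, z') \<in> R \<and> (z', b) \<in> ?Q")
      case False
      then have yb: "(y, b) \<in> ?Q" using step.IH by blast
      then have "y \<notin> W" using assms(3) by (cases rule: converse_rtranclE) auto
      then have "x \<notin> W" using False yb step.hyps(1) by blast
      then show ?thesis using yb \<open>y \<notin> W\<close> step.hyps(1) by (auto intro: converse_rtrancl_into_rtrancl)
    qed blast
  qed simp
  moreover have "(a, b) \<notin> ?Q" using assms(2,3) by (auto elim: converse_rtranclE)
  ultimately show thesis using that by blast
qed

text \<open>The new node is larger than \<open>z\<close> and lies behind \<open>z'\<close>, so the
  edge from \<open>z\<close> to \<open>z'\<close> is not in a left slot. In the old tree the only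
  such parent of \<open>z\<close> is the next visible node; hence \<open>z'\<close> is the new node.
  The same uniqueness identifies \<open>T\<close> with that next node, or with nothing at the end of
  the path.\<close>

lemma insertion_point_up:
  assumes t: "ptree A B n E" and v: "vis A B n E w" and sp: "spot (Suc n) S T E"
    and h: "half A (ins (Suc n) S T E)"
    and zz': "z \<in> set w" "z' \<notin> set w" "(z, z') \<in> ins (Suc n) S T E"
    and path: "(z', Suc n) \<in> lnk (ins (Suc n) S T E - {(z, z')})"
  shows "\<exists>u v. w = u @ v \<and> S = last_set u \<and> T = hd_set v"
proof -
  let ?N = "Suc n" and ?E' = "ins (Suc n) S T E"
  obtain l r where w: "w = l @ z # r" using zz'(1) by (meson split_list)
  have zn: "z < ?N" using zz'(1) visD(3)[OF v] by auto
  have next_z: "(z, hd r) \<in> E" "z \<in> A \<Longrightarrow> z < hd r" if "r \<noteq> []"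
  proof -
    have "successively (\<lambda>x y. (x, y) \<in> E \<and> (x \<in> A \<longrightarrow> x < y)) ((l @ [z]) @ r)"
      using up_visD(1)[OF visD(4)[OF v]] by (simp add: w)
    from successively_split[OF this, of z "hd r"] that
    show "(z, hd r) \<in> E" "z \<in> A \<Longrightarrow> z < hd r" by (simp_all add: last_set_def hd_set_def)
  qed
  have z': "\<not> z' < z" if "z \<in> A"
    using half_sideD[OF h zz'(3) that path] zn by simp
  have z'N: "z' = ?N"
  proof (rule ccontr)
    assume "z' \<noteq> ?N"
    then have E: "(z, z') \<in> E" using zz'(3) zn unfolding ins_def by auto
    show False
    proof (cases "r = []")
      case True
      then have "last w = z" by (simp add: w)
      then show False using up_visD(2)[OF visD(4)[OF v], of z'] E z' by auto
    next
      case False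
      have "hd r = z'"
        using half_uniqD[OF ptreeD(4)[OF t] next_z(1)[OF False] E] next_z(2)[OF False] z' by fastforce
      then show False using zz'(2) False by (auto simp: w)
    qed
  qed
  then have zS: "z \<in> S" using zz'(3) spotD(8,9)[OF sp] zn unfolding ins_def by auto
  then have S: "S = {z}" using spotD(6)[OF sp] by blast
  show ?thesis
  proof (cases "r = []")
    case True
    have "T = {}"
    proof (rule ccontr)
      assume "T \<noteq> {}"
      then obtain y where y: "y \<in> T" by blast
      then have zy: "(z, y) \<in> E" using spotD(4)[OF sp] zS by blast
      have last: "last w = z" using True by (simp add: w)
      then have zA: "z \<in> A" and yz: "y < z" using up_visD(2)[OF visD(4)[OF v], of y] zy by auto
      have "(?N, y) \<in> lnk (?E' - {(z, ?N)})"
        using y zn by (intro lnk_arc) (auto simp: ins_def)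
      then have "(z', y) \<in> lnk (?E' - {(z, z')})" by (simp only: z'N)
      from half_sideD[OF h zz'(3) zA this] show False
        using yz z'N zn by simp
    qed
    then show ?thesis
      using True S by (intro exI[of _ w] exI[of _ "[]"]) (simp add: w last_set_def hd_set_def)
  next
    case False
    have "hd r \<in> T"
    proof (rule ccontr)
      assume "hd r \<notin> T"
      then have "(z, hd r) \<in> ?E'" using next_z(1)[OF False] by (simp add: ins_def)
      then have "hd r = z'"
        using half_uniqD[OF h _ zz'(3)] next_z(2)[OF False] z' by fastforce
      then show False using zz'(2) False by (auto simp: w)
    qed
    then have "T = {hd r}" using spotD(7)[OF sp] by blast
    then show ?thesis
      using False S by (intro exI[of _ "l @ [z]"] exI[of _ r]) (simp add: w last_set_def hd_set_def)
  qed
qed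

text \<open>A walk from \<open>n\<close>, which is visible, to the new node leaves the visible path
  for a last time, either to a parent or to a child; the second case is the first one in the
  reversed tree.\<close>

lemma insertion_point:
  assumes t: "ptree A B n E" and v: "vis A B n E w" and sp: "spot (Suc n) S T E"
    and t': "ptree A B (Suc n) (ins (Suc n) S T E)"
  obtains u v where "w = u @ v" "S = last_set u" "T = hd_set v"
proof -
  let ?N = "Suc n" and ?E' = "ins (Suc n) S T E"
  let ?R = "?E' \<union> ?E'\<inverse>"
  have n: "n \<in> set w" "?N \<notin> set w" using visD(1,3)[OF v] by auto
  have "n \<in> {1..?N}" using visD(1,3)[OF v] by auto
  then have "(n, ?N) \<in> ?R\<^sup>*"
    using ptreeD(2)[OF t'] unfolding connects_def lnk_def by simp
  then obtain z z' where z: "z \<in> set w" "z' \<notin> set w" "(z, z') \<in> ?R"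
    and "(z', ?N) \<in> {(x, y) \<in> ?R. x \<notin> set w \<and> y \<notin> set w}\<^sup>*"
    using n by (rule last_exit)
  \<comment> \<open>After its last exit the walk avoids the visible path, hence also the exit edge
    in both directions, as \<open>z\<close> lies on the path.\<close>
  then have "(z', ?N) \<in> ((?E' - {(z, z'), (z', z)}) \<union> (?E' - {(z, z'), (z', z)})\<inverse>)\<^sup>*"
    by (elim rtrancl_mono[THEN subsetD, rotated]) auto
  then have path: "(z', ?N) \<in> lnk (?E' - {(z, z'), (z', z)})" unfolding lnk_def .
  from z(3) have "(z, z') \<in> ?E' \<or> (z, z') \<in> ?E'\<inverse>" by blast
  then have "\<exists>u v. w = u @ v \<and> S = last_set u \<and> T = hd_set v"
  proof
    assume "(z, z') \<in> ?E'"
    moreover have "(z', ?N) \<in> lnk (?E' - {(z, z')})"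
      using path by (rule lnk_mono[rotated]) blast
    ultimately show ?thesis
      using insertion_point_up[OF t v sp ptreeD(4)[OF t'] z(1,2)] by blast
  next
    assume zz': "(z, z') \<in> ?E'\<inverse>"
    have conv: "?E'\<inverse> = ins ?N T S (E\<inverse>)" by (rule ins_converse)
    have "(?E' - {(z, z'), (z', z)}) \<subseteq> (?E'\<inverse> - {(z, z')})\<inverse>" by auto
    then have "(z', ?N) \<in> lnk ((?E'\<inverse> - {(z, z')})\<inverse>)"
      using path by (rule lnk_mono)
    then have path': "(z', ?N) \<in> lnk (ins ?N T S (E\<inverse>) - {(z, z')})"
      by (simp only: conv lnk_converse)
    have "\<exists>u v. rev w = u @ v \<and> T = last_set u \<and> S = hd_set v"
    proof (rule insertion_point_up[of B A])
      show "ptree B A n (E\<inverse>)" using t by (simp add: ptree_converse)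
      show "vis B A n (E\<inverse>) (rev w)" using v by (simp add: vis_converse)
      show "spot ?N T S (E\<inverse>)" using sp by (simp add: spot_converse)
      show "half B (ins ?N T S (E\<inverse>))" using ptreeD(5)[OF t'] by (simp add: conv)
      show "z \<in> set (rev w)" "z' \<notin> set (rev w)" using z by simp_all
      show "(z, z') \<in> ins ?N T S (E\<inverse>)" using zz' by (simp only: conv)
    qed (rule path')
    then obtain u v where uv: "rev w = u @ v" "T = last_set u" "S = hd_set v" by blast
    have "w = rev v @ rev u" using arg_cong[OF uv(1), of rev] by simp
    then show ?thesis
      using uv by (intro exI[of _ "rev v"] exI[of _ "rev u"]) simp
  qed
  then show thesis using that by blast
qed

lemma last_set_take:
  "i \<le> length w \<Longrightarrow> last_set (take i w) = (if i = 0 then {} else {w ! (i - 1)})"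
  by (cases i) (auto simp: last_set_def last_conv_nth min_def)

text \<open>The node below the new one fixes the gap; the empty set stands for the gap at the bottom
  of the path.\<close>

lemma last_set_take_inj:
  assumes "distinct w" "i \<le> length w" "j \<le> length w" "last_set (take i w) = last_set (take j w)"
  shows "i = j"
  using assms by (cases i; cases j) (auto simp: last_set_take nth_eq_iff_index_eq last_set_def[of "[]"])

lemma ptree_1: "ptree A B (Suc 0) E \<longleftrightarrow> E = {}"
proof
  assume t: "ptree A B (Suc 0) E"
  have "(1, 1) \<notin> E" using bridgesD[OF ptreeD(3)[OF t], of 1 1] by auto
  then show "E = {}" using ptreeD(1)[OF t] by auto
qed (auto simp: ptree_def connects_def bridges_def half_def)

text \<open>For trees the map starts from the codes: insertion needs a visible path, and this is
  carried along as an existential statement rather than computed from the tree.\<close>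

lemma bij_betw_codes_ptree:
  fixes \<delta> :: "nat \<Rightarrow> decoration"
  defines "A \<equiv> {i. cut_at \<delta> i False}" and "B \<equiv> {i. cut_at \<delta> i True}"
  assumes one: "\<delta> 1 = I"
  shows "\<exists>f. bij_betw f (codes \<delta> m) {E. ptree A B (Suc m) E} \<and>
    (\<forall>c\<in>codes \<delta> m. \<exists>w. vis A B (Suc m) (f c) w \<and> Suc (length w) = spots \<delta> (Suc m) (hd c))"
proof (induction m)
  case 0
  have "vis A B (Suc 0) {} [1]" by (simp add: vis_def up_vis_def)
  \<comment> \<open>The path \<open>[1]\<close> has two gaps, above and below its node.\<close>
  moreover have "spots \<delta> (Suc 0) (1, 1) = 2" by (simp add: spots_def)
  ultimately show ?case
    by (intro exI[of _ "\<lambda>_. {}"]) (auto simp: bij_betw_def ptree_1 intro!: exI[of _ "[1]"])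
next
  case (Suc m)
  let ?n = "Suc m" and ?N = "Suc (Suc m)"
  from Suc obtain f where f: "bij_betw f (codes \<delta> m) {E. ptree A B ?n E}"
    and ex_w: "\<forall>c\<in>codes \<delta> m. \<exists>w. vis A B ?n (f c) w \<and> Suc (length w) = spots \<delta> ?n (hd c)"
    by (elim exE conjE) (rule that)
  from bchoice[OF ex_w] obtain W where
    "\<forall>c\<in>codes \<delta> m. vis A B ?n (f c) (W c) \<and> Suc (length (W c)) = spots \<delta> ?n (hd c)" ..
  then have W: "\<And>c. c \<in> codes \<delta> m \<Longrightarrow> vis A B ?n (f c) (W c)"
    and len: "\<And>c. c \<in> codes \<delta> m \<Longrightarrow> Suc (length (W c)) = spots \<delta> ?n (hd c)"
    by simp_all
  \<comment> \<open>An entry stores \<open>|u| + 1\<close>, so the split comes after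
    \<open>fst (hd l) - 1\<close> nodes.\<close>
  define u where "u l = take (fst (hd l) - 1) (W (tl l))" for l :: "(nat \<times> nat) list"
  define v where "v l = drop (fst (hd l) - 1) (W (tl l))" for l :: "(nat \<times> nat) list"
  define g where "g l = ins ?N (last_set (u l)) (hd_set (v l)) (f (tl l))" for l :: "(nat \<times> nat) list"
  have tree: "ptree A B ?n (f c)" if "c \<in> codes \<delta> m" for c
    using bij_betw_apply[OF f that] by simp
  have code: "tl l \<in> codes \<delta> m" "W (tl l) = u l @ v l" "length (u l) = fst (hd l) - 1"
      "length (v l) = snd (hd l) - 1" "1 \<le> fst (hd l)" "1 \<le> snd (hd l)" "l \<noteq> []"
    if "l \<in> codes \<delta> (Suc m)" for l
    using that len[of "tl l"] by (auto simp: u_def v_def)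
  have vis: "vis A B ?n (f (tl l)) (u l @ v l)" if "l \<in> codes \<delta> (Suc m)" for l
    using W[OF code(1)[OF that]] code(2)[OF that] by simp
  have g_tree: "ptree A B ?N (g l)" if "l \<in> codes \<delta> (Suc m)" for l
    unfolding g_def by (rule ptree_ins[OF tree vis]) (use code(1) that in auto)
  have g_spot: "spot ?N (last_set (u l)) (hd_set (v l)) (f (tl l))" if "l \<in> codes \<delta> (Suc m)" for l
    by (rule spot_vis[OF tree vis]) (use code(1) that in auto)
  have inj: "inj_on g (codes \<delta> (Suc m))"
  proof (rule inj_onI)
    fix l l' assume l: "l \<in> codes \<delta> (Suc m)" and l': "l' \<in> codes \<delta> (Suc m)" and eq: "g l = g l'"
    have f_eq: "f (tl l) = f (tl l')" and last_eq: "last_set (u l) = last_set (u l')"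
      using ins_inverse[OF g_spot[OF l]] ins_inverse[OF g_spot[OF l']] eq by (simp_all add: g_def)
    have tl: "tl l = tl l'"
      by (rule inj_onD[OF bij_betw_imp_inj_on[OF f] f_eq code(1)[OF l] code(1)[OF l']])
    have len_W: "length (W (tl l)) = fst (hd k) - 1 + (snd (hd k) - 1)"
      if "k \<in> codes \<delta> (Suc m)" "tl k = tl l" for k
      using arg_cong[OF code(2)[OF that(1)], of length] code(3,4)[OF that(1)] that(2) by simp
    have "fst (hd l) - 1 = fst (hd l') - 1"
    proof (rule last_set_take_inj)
      show "distinct (W (tl l))" by (rule visD(2)[OF W[OF code(1)[OF l]]])
      show "fst (hd l) - 1 \<le> length (W (tl l))" "fst (hd l') - 1 \<le> length (W (tl l))"
        using len_W[OF l] len_W[OF l'] tl by simp_all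
      show "last_set (take (fst (hd l) - 1) (W (tl l))) = last_set (take (fst (hd l') - 1) (W (tl l)))"
        using last_eq by (simp add: u_def tl)
    qed
    then have "fst (hd l) = fst (hd l')" using code(5)[OF l] code(5)[OF l'] by simp
    moreover from this have "snd (hd l) = snd (hd l')"
      using len_W[OF l] len_W[OF l'] tl code(6)[OF l] code(6)[OF l'] by simp
    ultimately have "hd l = hd l'" by (simp add: prod_eq_iff)
    then show "l = l'"
      using tl code(7)[OF l] code(7)[OF l'] by (simp add: list.expand)
  qed
  have surj: "\<exists>l\<in>codes \<delta> (Suc m). E = g l" if E: "ptree A B ?N E" for E
  proof -
    have "ptree A B ?n (del ?N E)" using ptree_del[OF E] by simp
    then have "del ?N E \<in> f ` codes \<delta> m" using f by (simp add: bij_betw_def)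
    then obtain c where c: "c \<in> codes \<delta> m" "del ?N E = f c" by blast
    have sp: "spot ?N (children ?N E) (parents ?N E) (f c)"
      and E': "ins ?N (children ?N E) (parents ?N E) (f c) = E"
      using ptree_del_spot(1,2)[OF E] by (simp_all add: c(2))
    have "ptree A B ?N (ins ?N (children ?N E) (parents ?N E) (f c))"
      using E by (simp add: E')
    then obtain u' v' where uv: "W c = u' @ v'" "children ?N E = last_set u'" "parents ?N E = hd_set v'"
      by (rule insertion_point[OF tree[OF c(1)] W[OF c(1)] sp])
    define l where "l = (Suc (length u'), Suc (length v')) # c"
    have "l \<in> codes \<delta> (Suc m)"
      using c(1) len[OF c(1)] uv(1) by (simp add: l_def)
    moreover have "E = g l"
      using E' uv by (simp add: g_def u_def v_def l_def)
    ultimately show ?thesis by blast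
  qed
  have "bij_betw g (codes \<delta> (Suc m)) {E. ptree A B ?N E}"
  proof (rule bij_betw_imageI[OF inj])
    show "g ` codes \<delta> (Suc m) = {E. ptree A B ?N E}"
    proof (intro equalityI subsetI)
      fix E assume "E \<in> {E. ptree A B ?N E}"
      then obtain l where "l \<in> codes \<delta> (Suc m)" "E = g l" using surj[of E] by (auto simp del: codes.simps)
      then show "E \<in> g ` codes \<delta> (Suc m)" by (rule rev_image_eqI)
    qed (use g_tree in \<open>auto simp del: codes.simps\<close>)
  qed
  moreover have "\<exists>w. vis A B ?N (g l) w \<and> Suc (length w) = spots \<delta> ?N (hd l)"
    if l: "l \<in> codes \<delta> (Suc m)" for l
  proof (intro exI conjI)
    show "vis A B ?N (g l) (visible_list A B ?N (u l) (v l))"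
      unfolding g_def by (rule vis_ins[OF tree vis]) (use code(1) l in auto)
    show "Suc (length (visible_list A B ?N (u l) (v l))) = spots \<delta> ?N (hd l)"
      using code(3-6)[OF l] by (auto simp: visible_list_def spots_def A_def B_def)
  qed
  ultimately show ?case by (intro exI[of _ g]) (simp del: codes.simps)
qed

section \<open>Permutrees as relations\<close>

definition ends :: "tree_edge \<Rightarrow> nat \<times> nat" where
  "ends e = (child e, parent e)"

lemma rtrancl_on_eq:
  assumes "E \<subseteq> V \<times> V" "a \<in> V"
  shows "(a, b) \<in> rtrancl_on V (E \<union> E\<inverse>) \<longleftrightarrow> (a, b) \<in> lnk E"
proof
  assume "(a, b) \<in> lnk E"
  then have "(a, b) \<in> (E \<union> E\<inverse>)\<^sup>*" "b \<in> V"
    using lnk_closed[OF _ assms(2,1)] unfolding lnk_def by blast+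
  then show "(a, b) \<in> rtrancl_on V (E \<union> E\<inverse>)"
    by (intro rtrancl_consistent_rtrancl_on) (use assms in auto)
qed (simp add: lnk_def rtrancl_on_rtranclI)

lemma parcs_tree: "parcs (mk_symmetric (tree_digraph n T)) = ends ` T \<union> (ends ` T)\<inverse>"
  by (auto simp: parcs_mk_symmetric tree_digraph_def ends_def image_iff)

lemma connected_tree:
  assumes "ends ` T \<subseteq> {1..n} \<times> {1..n}" "1 \<le> n"
  shows "connected (tree_digraph n T) \<longleftrightarrow> connects n (ends ` T)"
proof -
  have "verts (tree_digraph n T) = {1..n}" by (simp add: tree_digraph_def)
  then show ?thesis
    using assms(2) rtrancl_on_eq[OF assms(1)]
    unfolding connected_def strongly_connected_def connects_def reachable_def by (simp add: parcs_tree)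
qed

lemma wf_tree: "wf_digraph (tree_digraph n T) \<longleftrightarrow> ends ` T \<subseteq> {1..n} \<times> {1..n}"
  by (auto simp: wf_digraph_def tree_digraph_def ends_def)

section \<open>Cycles and bridges\<close>

lemma bidirected_tree_simps:
  "verts (bidirected (tree_digraph n T)) = {1..n}"
  "arcs (bidirected (tree_digraph n T)) = T \<times> UNIV"
  "tail (bidirected (tree_digraph n T)) (e, d) = (if d then child e else parent e)"
  "head (bidirected (tree_digraph n T)) (e, d) = (if d then parent e else child e)"
  by (simp_all add: bidirected_def tree_digraph_def)

context
  fixes n :: nat and T :: "tree_edge set"
  assumes wf: "ends ` T \<subseteq> {1..n} \<times> {1..n}"
begin

interpretation G: wf_digraph "bidirected (tree_digraph n T)"
proof
  fix x assume "x \<in> arcs (bidirected (tree_digraph n T))"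
  then obtain e d where "x = (e, d)" "ends e \<in> {1..n} \<times> {1..n}"
    using wf by (auto simp: bidirected_tree_simps)
  then show "tail (bidirected (tree_digraph n T)) x \<in> verts (bidirected (tree_digraph n T))"
    "head (bidirected (tree_digraph n T)) x \<in> verts (bidirected (tree_digraph n T))"
    by (simp_all add: bidirected_tree_simps ends_def)
qed

lemma walk_lnk:
  "G.awalk u p v \<Longrightarrow> set p \<subseteq> K \<times> UNIV \<Longrightarrow> (u, v) \<in> lnk (ends ` K)"
proof (induction p arbitrary: u)
  case (Cons x p)
  obtain e d where x: "x = (e, d)" by (cases x)
  have "e \<in> K" using Cons.prems(2) x by auto
  then have "(child e, parent e) \<in> lnk (ends ` K)"
    by (intro lnk_arc) (auto simp: ends_def)
  then have "(u, head (bidirected (tree_digraph n T)) x) \<in> lnk (ends ` K)"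
    using Cons.prems(1) lnk_sym[of "child e" "parent e"]
    by (auto simp: G.awalk_Cons_iff x bidirected_tree_simps)
  moreover have "(head (bidirected (tree_digraph n T)) x, v) \<in> lnk (ends ` K)"
    using Cons by (auto simp: G.awalk_Cons_iff)
  ultimately show ?case by (rule lnk_trans)
qed (simp add: G.awalk_Nil_iff)

lemma lnk_walk:
  assumes "(u, v) \<in> lnk (ends ` K)" "K \<subseteq> T" "u \<in> {1..n}"
  shows "\<exists>p. G.awalk u p v \<and> set p \<subseteq> K \<times> UNIV"
  using assms(1)[unfolded lnk_def]
proof (induction rule: rtrancl_induct)
  case base
  then show ?case
    using assms(3) by (intro exI[of _ "[]"]) (simp add: G.awalk_Nil_iff bidirected_tree_simps)
next
  case (step y z)
  then obtain p where p: "G.awalk u p y" "set p \<subseteq> K \<times> UNIV" by blast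
  obtain e d where e: "e \<in> K" "tail (bidirected (tree_digraph n T)) (e, d) = y"
      "head (bidirected (tree_digraph n T)) (e, d) = z"
  proof -
    from step.hyps(2) consider "(y, z) \<in> ends ` K" | "(z, y) \<in> ends ` K" by blast
    then show thesis
    proof cases
      case 1
      then show thesis using that[of _ True] by (auto simp: ends_def bidirected_tree_simps)
    next
      case 2
      then show thesis using that[of _ False] by (auto simp: ends_def bidirected_tree_simps)
    qed
  qed
  have "(e, d) \<in> arcs (bidirected (tree_digraph n T))"
    using e(1) assms(2) by (auto simp: bidirected_tree_simps)
  then have "G.awalk y [(e, d)] z" using G.arc_implies_awalk e(2,3) by metis
  then have "G.awalk u (p @ [(e, d)]) z" by (rule G.awalk_appendI[OF p(1)])
  then show ?case using p(2) e(1) by (intro exI[of _ "p @ [(e, d)]"]) auto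
qed

text \<open>If the edge of the first step is used again later, in whichever direction, the walk
  returns to its starting vertex.\<close>

lemma distinct_verts_distinct_edges:
  "G.awalk u p v \<Longrightarrow> distinct (G.awalk_verts u p) \<Longrightarrow> distinct (map fst p)"
proof (induction p arbitrary: u)
  case (Cons x p)
  obtain e d where x: "x = (e, d)" by (cases x)
  have walk: "G.awalk (head (bidirected (tree_digraph n T)) x) p v"
    and u: "u = tail (bidirected (tree_digraph n T)) x"
    using Cons.prems(1) by (auto simp: G.awalk_Cons_iff)
  have "e \<notin> fst ` set p"
  proof
    assume "e \<in> fst ` set p"
    then obtain d' where d': "(e, d') \<in> set p" by auto
    have "tail (bidirected (tree_digraph n T)) (e, d') \<in>
        set (G.awalk_verts (head (bidirected (tree_digraph n T)) x) p)"
      "head (bidirected (tree_digraph n T)) (e, d') \<in>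
        set (G.awalk_verts (head (bidirected (tree_digraph n T)) x) p)"
      using G.awalk_verts_arc1[OF d'] G.awalk_verts_arc2[OF walk d'] by auto
    then have "u \<in> set (G.awalk_verts (head (bidirected (tree_digraph n T)) x) p)"
      by (auto simp: u x bidirected_tree_simps split: if_splits)
    then show False using Cons.prems(2) by (simp add: u)
  qed
  then show ?case using Cons.IH[OF walk] Cons.prems(2) by (simp add: x)
qed simp

text \<open>The rest of a cycle bypasses its first edge; conversely a bypass, shortened to a path,
  closes up with the edge. Removing \<open>e\<close> from \<open>T\<close> before taking ends keeps
  parallel edges in play: each of them bypasses the other.\<close>

lemma acyclic_tree:
  "\<not> (\<exists>p. G.cycle p \<and> distinct (map fst p)) \<longleftrightarrow>
    (\<forall>e\<in>T. ends e \<notin> lnk (ends ` (T - {e})))"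
proof (intro iffI ballI notI)
  fix e assume acyc: "\<not> (\<exists>p. G.cycle p \<and> distinct (map fst p))" and e: "e \<in> T"
    and lnk: "ends e \<in> lnk (ends ` (T - {e}))"
  have in_n: "child e \<in> {1..n}" "parent e \<in> {1..n}" using wf e by (auto simp: ends_def)
  have "(parent e, child e) \<in> lnk (ends ` (T - {e}))"
    using lnk by (simp add: ends_def lnk_sym)
  then obtain q where "G.awalk (parent e) q (child e)" "set q \<subseteq> (T - {e}) \<times> UNIV"
    using lnk_walk[of "parent e" "child e" "T - {e}"] in_n by blast
  then obtain p where p: "G.apath (parent e) p (child e)" "set p \<subseteq> (T - {e}) \<times> UNIV"
    using G.apath_awalk_to_apath G.awalk_to_apath_subset by (meson order_trans)
  then have path: "G.awalk (parent e) p (child e)" "distinct (G.awalk_verts (parent e) p)"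
    by (auto simp: G.apath_def)
  have "G.awalk (child e) ((e, True) # p) (child e)"
    using path(1) e by (simp add: G.awalk_Cons_iff bidirected_tree_simps)
  then have "G.cycle ((e, True) # p)"
    unfolding G.cycle_def using path(2)
    by (intro exI[of _ "child e"]) (simp add: bidirected_tree_simps)
  moreover have "distinct (map fst ((e, True) # p))"
    using distinct_verts_distinct_edges[OF path] p(2) by auto
  ultimately show False using acyc by blast
next
  assume br: "\<forall>e\<in>T. ends e \<notin> lnk (ends ` (T - {e}))"
    and "\<exists>p. G.cycle p \<and> distinct (map fst p)"
  then obtain p u where p: "G.awalk u p u" "p \<noteq> []" "distinct (map fst p)"
    unfolding G.cycle_def by blast
  then obtain e d q where q: "p = (e, d) # q" by (cases p) auto
  have e: "e \<in> T" and walk: "G.awalk (head (bidirected (tree_digraph n T)) (e, d)) q u"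
    and u: "u = tail (bidirected (tree_digraph n T)) (e, d)"
    using p(1) by (auto simp: q G.awalk_Cons_iff bidirected_tree_simps)
  have "set q \<subseteq> T \<times> UNIV" using walk by (auto simp: G.awalk_def bidirected_tree_simps)
  then have "set q \<subseteq> (T - {e}) \<times> UNIV" using p(3) by (force simp: q)
  then have "(head (bidirected (tree_digraph n T)) (e, d), u) \<in> lnk (ends ` (T - {e}))"
    by (rule walk_lnk[OF walk])
  then have "ends e \<in> lnk (ends ` (T - {e}))"
    using lnk_sym by (cases d) (auto simp: u bidirected_tree_simps ends_def)
  then show False using br e by blast
qed

end

text \<open>Parallel edges form a cycle, hence \<open>inj_on ends T\<close>; with it, removing an
  edge from \<open>T\<close> is removing a pair from the relation. Antiparallel edges are excluded
  by \<open>bridges\<close>.\<close>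

lemma directed_tree_iff:
  assumes "1 \<le> n"
  shows "directed_tree (tree_digraph n T) \<longleftrightarrow>
    ends ` T \<subseteq> {1..n} \<times> {1..n} \<and> connects n (ends ` T) \<and> inj_on ends T \<and> bridges (ends ` T)"
proof (cases "ends ` T \<subseteq> {1..n} \<times> {1..n}")
  case True
  have "(\<forall>e\<in>T. ends e \<notin> lnk (ends ` (T - {e}))) \<longleftrightarrow> inj_on ends T \<and> bridges (ends ` T)"
  proof
    assume br: "\<forall>e\<in>T. ends e \<notin> lnk (ends ` (T - {e}))"
    have inj: "inj_on ends T"
    proof (rule inj_onI, rule ccontr)
      fix e f assume ef: "e \<in> T" "f \<in> T" "ends e = ends f" "e \<noteq> f"
      then have "ends e \<in> ends ` (T - {e})" by auto
      then have "ends e \<in> lnk (ends ` (T - {e}))" by (cases "ends e") (simp add: lnk_arc)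
      then show False using br ef(1) by blast
    qed
    moreover have "ends ` (T - {e}) = ends ` T - {ends e}" if "e \<in> T" for e
      using inj that by (auto simp: inj_on_def)
    ultimately show "inj_on ends T \<and> bridges (ends ` T)"
      using br unfolding bridges_def by (metis imageE)
  next
    assume *: "inj_on ends T \<and> bridges (ends ` T)"
    show "\<forall>e\<in>T. ends e \<notin> lnk (ends ` (T - {e}))"
    proof
      fix e assume e: "e \<in> T"
      have "ends ` (T - {e}) = ends ` T - {ends e}"
        using * e by (auto simp: inj_on_def)
      moreover have "ends e \<notin> lnk (ends ` T - {ends e})"
        using bridgesD[of "ends ` T" "child e" "parent e"] * e by (auto simp: ends_def)
      ultimately show "ends e \<notin> lnk (ends ` (T - {e}))" by simp
    qed
  qed
  then show ?thesis
    unfolding directed_tree_def wf_tree connected_tree[OF True assms] acyclic_tree[OF True]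
    using True by blast
qed (simp add: directed_tree_def wf_tree)

text \<open>The edge \<open>a\<close> is a bridge, so without it \<open>i\<close> is out of reach
  from \<open>j\<close>. Deleting the whole node \<open>i\<close> then takes no more from the
  component of \<open>j\<close> than deleting \<open>a\<close>.\<close>

lemma subtree_at_eq:
  assumes T: "ends ` T \<subseteq> {1..n} \<times> {1..n}" and br: "bridges (ends ` T)"
    and arc: "a \<in> ends ` T" "a = (i, j) \<or> a = (j, i)"
  shows "subtree_at n T i j = {k. (j, k) \<in> lnk (ends ` T - {a})}"
proof -
  let ?E = "ends ` T" and ?V = "{1..n} - {i}"
  let ?F = "{(x, y) \<in> ?E. x \<noteq> i \<and> y \<noteq> i}"
  have "verts (pre_digraph.del_vert (tree_digraph n T) i) = ?V"
    by (simp add: pre_digraph.del_vert_def tree_digraph_def)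
  moreover have "parcs (mk_symmetric (pre_digraph.del_vert (tree_digraph n T) i)) = ?F \<union> ?F\<inverse>"
    by (auto simp: parcs_mk_symmetric pre_digraph.del_vert_def tree_digraph_def ends_def image_iff)
  ultimately have sub: "subtree_at n T i j = {k. (j, k) \<in> rtrancl_on ?V (?F \<union> ?F\<inverse>)}"
    by (simp add: subtree_at_def reachable_def)
  have cut: "(j, i) \<notin> lnk (?E - {a})"
  proof
    assume ji: "(j, i) \<in> lnk (?E - {a})"
    from arc(2) show False
      using bridgesD[OF br, of "fst a" "snd a"] arc(1) ji lnk_sym[OF ji] by (elim disjE) simp_all
  qed
  then have ij: "i \<noteq> j" by auto
  have in_V: "j \<in> ?V" using T arc ij by auto
  have "(j, k) \<in> rtrancl_on ?V (?F \<union> ?F\<inverse>) \<longleftrightarrow> (j, k) \<in> lnk ?F" for k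
    by (rule rtrancl_on_eq) (use T in_V in auto)
  moreover have "(j, k) \<in> lnk ?F \<longleftrightarrow> (j, k) \<in> lnk (?E - {a})" for k
  proof
    assume "(j, k) \<in> lnk ?F"
    moreover have "?F \<subseteq> ?E - {a}" using arc(2) by (elim disjE) blast+
    ultimately show "(j, k) \<in> lnk (?E - {a})" by (rule lnk_mono[rotated])
  next
    assume "(j, k) \<in> lnk (?E - {a})"
    then have "(j, k) \<in> lnk (?E - {a}) \<and> (j, k) \<in> lnk ?F"
      unfolding lnk_def[of "?E - {a}"]
    proof (induction rule: rtrancl_induct)
      case (step y z)
      then have jy: "(j, y) \<in> lnk (?E - {a})" and jyF: "(j, y) \<in> lnk ?F"
        by (simp_all add: lnk_def[of "?E - {a}"])
      from step.hyps(2) have yz: "(y, z) \<in> lnk (?E - {a})" by (auto simp: lnk_def)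
      have jz: "(j, z) \<in> lnk (?E - {a})" using jy yz by (rule lnk_trans)
      have "y \<noteq> i" "z \<noteq> i" using cut jy jz by auto
      then have "(y, z) \<in> lnk ?F" using step.hyps(2) by (auto simp: lnk_def)
      then have "(j, z) \<in> lnk ?F" by (rule lnk_trans[OF jyF])
      then show ?case using jz by (simp add: lnk_def[of "?E - {a}"])
    qed simp
    then show "(j, k) \<in> lnk ?F" by blast
  qed
  ultimately show ?thesis unfolding sub by simp
qed

section \<open>Slots determined by labels\<close>

definition slot_of :: "bool \<Rightarrow> nat \<Rightarrow> nat \<Rightarrow> slot" where
  "slot_of two i j = (if two then if j < i then LeftSlot else RightSlot else Single)"

lemma slot_of_eq_iff: "slot_of b i j = slot_of b i k \<longleftrightarrow> (b \<longrightarrow> (j < i \<longleftrightarrow> k < i))"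
  by (auto simp: slot_of_def)

lemma slot_condition_slot_of:
  assumes "i \<notin> S"
  shows "slot_condition i (slot_of two i j) S \<longleftrightarrow> (two \<longrightarrow> (\<forall>k\<in>S. k < i \<longleftrightarrow> j < i))"
proof -
  have "i < k \<longleftrightarrow> \<not> k < i" if "k \<in> S" for k
    using that assms by (metis linorder_neqE_nat not_less_iff_gr_or_eq)
  then show ?thesis by (auto simp: slot_of_def)
qed

text \<open>The neighbour \<open>j\<close> belongs to its own subtree, so its label alone decides
  between left and right.\<close>

lemma slot_condition_imp_slot_of:
  assumes "slot_condition i s S" "j \<in> S" "s \<in> (if two then {LeftSlot, RightSlot} else {Single})"
  shows "s = slot_of two i j"
  using assms by (cases s) (auto simp: slot_of_def split: if_splits)

definition edge_of :: "nat set \<Rightarrow> nat set \<Rightarrow> nat \<times> nat \<Rightarrow> tree_edge" where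
  "edge_of A B a = TreeEdge (fst a) (slot_of (fst a \<in> A) (fst a) (snd a))
     (snd a) (slot_of (snd a \<in> B) (snd a) (fst a))"

lemma ends_edge_of [simp]: "ends (edge_of A B a) = a"
  by (simp add: ends_def edge_of_def)

lemma edge_of_sel [simp]:
  "child (edge_of A B a) = fst a" "parent (edge_of A B a) = snd a"
  "parent_slot (edge_of A B a) = slot_of (fst a \<in> A) (fst a) (snd a)"
  "child_slot (edge_of A B a) = slot_of (snd a \<in> B) (snd a) (fst a)"
  by (simp_all add: edge_of_def)

lemma edge_of_eq_iff [simp]: "edge_of A B a = edge_of A B b \<longleftrightarrow> a = b"
  by (metis ends_edge_of)

lemma inj_on_parent_slot:
  "inj_on (\<lambda>e. (child e, parent_slot e)) (edge_of A B ` E) \<longleftrightarrow>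
    (\<forall>c p q. (c, p) \<in> E \<longrightarrow> (c, q) \<in> E \<longrightarrow> (c \<in> A \<longrightarrow> (p < c \<longleftrightarrow> q < c)) \<longrightarrow> p = q)"
    (is "?L \<longleftrightarrow> ?R")
proof
  assume inj: ?L
  have "p = q" if "(c, p) \<in> E" "(c, q) \<in> E" "c \<in> A \<longrightarrow> (p < c \<longleftrightarrow> q < c)" for c p q
  proof -
    have "edge_of A B (c, p) = edge_of A B (c, q)"
      by (rule inj_onD[OF inj]) (use that in \<open>simp_all add: slot_of_eq_iff\<close>)
    then show ?thesis by simp
  qed
  then show ?R by blast
next
  assume R: ?R
  show ?L
  proof (rule inj_onI)
    fix e f assume "e \<in> edge_of A B ` E" "f \<in> edge_of A B ` E"
      and eq: "(child e, parent_slot e) = (child f, parent_slot f)"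
    then obtain c p d q where e: "e = edge_of A B (c, p)" "(c, p) \<in> E"
      and f: "f = edge_of A B (d, q)" "(d, q) \<in> E" by auto
    then show "e = f" using eq R by (auto simp: slot_of_eq_iff)
  qed
qed

lemma inj_on_child_slot:
  "inj_on (\<lambda>e. (parent e, child_slot e)) (edge_of A B ` E) \<longleftrightarrow>
    (\<forall>p c d. (c, p) \<in> E \<longrightarrow> (d, p) \<in> E \<longrightarrow> (p \<in> B \<longrightarrow> (c < p \<longleftrightarrow> d < p)) \<longrightarrow> c = d)"
    (is "?L \<longleftrightarrow> ?R")
proof
  assume inj: ?L
  have "c = d" if "(c, p) \<in> E" "(d, p) \<in> E" "p \<in> B \<longrightarrow> (c < p \<longleftrightarrow> d < p)" for p c d
  proof -
    have "edge_of A B (c, p) = edge_of A B (d, p)"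
      by (rule inj_onD[OF inj]) (use that in \<open>simp_all add: slot_of_eq_iff\<close>)
    then show ?thesis by simp
  qed
  then show ?R by blast
next
  assume R: ?R
  show ?L
  proof (rule inj_onI)
    fix e f assume "e \<in> edge_of A B ` E" "f \<in> edge_of A B ` E"
      and eq: "(parent e, child_slot e) = (parent f, child_slot f)"
    then obtain c p d q where e: "e = edge_of A B (c, p)" "(c, p) \<in> E"
      and f: "f = edge_of A B (d, q)" "(d, q) \<in> E" by auto
    then show "e = f" using eq R by (auto simp: slot_of_eq_iff)
  qed
qed

lemma ends_image_edge_of [simp]: "ends ` edge_of A B ` E = E"
  by (simp add: image_image)

text \<open>Slots are forced by \<open>slot_condition_imp_slot_of\<close>, so a permutree is the
  image under \<open>edge_of\<close> of its relation. For such images the slot conditions at the two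
  ends become \<open>half A E\<close> and \<open>half B (E\<inverse>)\<close>.\<close>

lemma permutrees_eq:
  fixes \<delta> :: "nat \<Rightarrow> decoration"
  defines "A \<equiv> {i. cut_at \<delta> i False}" and "B \<equiv> {i. cut_at \<delta> i True}"
  assumes n: "1 \<le> n"
  shows "permutrees n \<delta> = (\<lambda>E. edge_of A B ` E) ` {E. ptree A B n E}"
proof -
  have slots: "parent_slots (\<delta> i) = (if i \<in> A then {LeftSlot, RightSlot} else {Single})"
    "child_slots (\<delta> i) = (if i \<in> B then {LeftSlot, RightSlot} else {Single})" for i
    by (simp_all add: parent_slots_def child_slots_def A_def B_def cut_at_def)
  define good where "good T \<longleftrightarrow>
    (\<forall>e\<in>T. slot_condition (child e) (parent_slot e) (subtree_at n T (child e) (parent e)) \<and>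
       slot_condition (parent e) (child_slot e) (subtree_at n T (parent e) (child e)))" for T
  have subtrees: "subtree_at n T (child e) (parent e) = {k. (parent e, k) \<in> lnk (ends ` T - {ends e})}"
      "subtree_at n T (parent e) (child e) = {k. (child e, k) \<in> lnk (ends ` T - {ends e})}"
    if "ends ` T \<subseteq> {1..n} \<times> {1..n}" "bridges (ends ` T)" "e \<in> T" for T e
  proof -
    have e: "ends e = (child e, parent e)" by (simp add: ends_def)
    show "subtree_at n T (child e) (parent e) = {k. (parent e, k) \<in> lnk (ends ` T - {ends e})}"
      "subtree_at n T (parent e) (child e) = {k. (child e, k) \<in> lnk (ends ` T - {ends e})}"
      by (rule subtree_at_eq[OF that(1,2) imageI[OF that(3)]]; simp add: e)+
  qed
  have shape: "T = edge_of A B ` ends ` T"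
    if T: "ends ` T \<subseteq> {1..n} \<times> {1..n}" "bridges (ends ` T)" "good T"
      and sl: "\<forall>e\<in>T. parent_slot e \<in> parent_slots (\<delta> (child e)) \<and>
                child_slot e \<in> child_slots (\<delta> (parent e))" for T
  proof -
    have "e = edge_of A B (ends e)" if e: "e \<in> T" for e
    proof -
      have "parent_slot e = slot_of (child e \<in> A) (child e) (parent e)"
        by (rule slot_condition_imp_slot_of)
          (use T(3) sl e subtrees[OF T(1,2) e] in \<open>auto simp: good_def slots\<close>)
      moreover have "child_slot e = slot_of (parent e \<in> B) (parent e) (child e)"
        by (rule slot_condition_imp_slot_of)
          (use T(3) sl e subtrees[OF T(1,2) e] in \<open>auto simp: good_def slots\<close>)
      ultimately show ?thesis by (simp add: edge_of_def ends_def tree_edge.expand)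
    qed
    then show ?thesis by (force simp: image_image)
  qed
  have main: "edge_of A B ` E \<in> permutrees n \<delta> \<longleftrightarrow> ptree A B n E" for E
  proof (cases "E \<subseteq> {1..n} \<times> {1..n} \<and> connects n E \<and> bridges E")
    case True
    let ?T = "edge_of A B ` E"
    have "inj_on ends ?T" by (auto intro: inj_onI)
    then have tree: "directed_tree (tree_digraph n ?T)"
      unfolding directed_tree_iff[OF n] using True by simp
    have notin: "c \<notin> {k. (p, k) \<in> lnk (E - {(c, p)})}" "p \<notin> {k. (c, k) \<in> lnk (E - {(c, p)})}"
      if "(c, p) \<in> E" for c p
      using True bridgesD[OF _ that] lnk_sym[of p c] by auto
    have "good ?T \<longleftrightarrow> (\<forall>c p k. (c, p) \<in> E \<longrightarrow> c \<in> A \<longrightarrow> (p, k) \<in> lnk (E - {(c, p)}) \<longrightarrow> (k < c \<longleftrightarrow> p < c)) \<and>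
        (\<forall>p c k. (c, p) \<in> E \<longrightarrow> p \<in> B \<longrightarrow> (c, k) \<in> lnk (E - {(c, p)}) \<longrightarrow> (k < p \<longleftrightarrow> c < p))"
    proof -
      have "good ?T \<longleftrightarrow> (\<forall>(c, p)\<in>E.
          slot_condition c (slot_of (c \<in> A) c p) {k. (p, k) \<in> lnk (E - {(c, p)})} \<and>
          slot_condition p (slot_of (p \<in> B) p c) {k. (c, k) \<in> lnk (E - {(c, p)})})"
      proof -
        have "subtree_at n ?T c p = {k. (p, k) \<in> lnk (E - {(c, p)})}"
          "subtree_at n ?T p c = {k. (c, k) \<in> lnk (E - {(c, p)})}" if "(c, p) \<in> E" for c p
          using subtrees[of ?T "edge_of A B (c, p)"] True that by simp_all
        then show ?thesis unfolding good_def by auto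
      qed
      also have "\<dots> \<longleftrightarrow> (\<forall>(c, p)\<in>E.
          (c \<in> A \<longrightarrow> (\<forall>k\<in>{k. (p, k) \<in> lnk (E - {(c, p)})}. k < c \<longleftrightarrow> p < c)) \<and>
          (p \<in> B \<longrightarrow> (\<forall>k\<in>{k. (c, k) \<in> lnk (E - {(c, p)})}. k < p \<longleftrightarrow> c < p)))"
      proof (rule ball_cong[OF refl])
        fix x assume "x \<in> E"
        moreover obtain c p where x: "x = (c, p)" by (cases x)
        ultimately have "(c, p) \<in> E" by simp
        then show "(case x of (c, p) \<Rightarrow>
            slot_condition c (slot_of (c \<in> A) c p) {k. (p, k) \<in> lnk (E - {(c, p)})} \<and>
            slot_condition p (slot_of (p \<in> B) p c) {k. (c, k) \<in> lnk (E - {(c, p)})}) \<longleftrightarrow>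
          (case x of (c, p) \<Rightarrow>
            (c \<in> A \<longrightarrow> (\<forall>k\<in>{k. (p, k) \<in> lnk (E - {(c, p)})}. k < c \<longleftrightarrow> p < c)) \<and>
            (p \<in> B \<longrightarrow> (\<forall>k\<in>{k. (c, k) \<in> lnk (E - {(c, p)})}. k < p \<longleftrightarrow> c < p)))"
          unfolding x prod.case by (simp only: slot_condition_slot_of[OF notin(1)] slot_condition_slot_of[OF notin(2)])
      qed
      finally show ?thesis by blast
    qed
    moreover have "\<forall>e\<in>?T. parent_slot e \<in> parent_slots (\<delta> (child e)) \<and>
        child_slot e \<in> child_slots (\<delta> (parent e))"
      by (auto simp: slots slot_of_def)
    then have "?T \<in> permutrees n \<delta> \<longleftrightarrow> inj_on (\<lambda>e. (child e, parent_slot e)) ?T \<and>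
        inj_on (\<lambda>e. (parent e, child_slot e)) ?T \<and> good ?T"
      unfolding permutrees_def good_def[symmetric] by (simp only: mem_Collect_eq tree simp_thms) blast
    moreover have "lnk (E\<inverse> - {(p, c)}) = lnk (E - {(c, p)})" for c p
      by (metis converse_del lnk_converse)
    then have "half B (E\<inverse>) \<longleftrightarrow>
        (\<forall>p c k. (c, p) \<in> E \<longrightarrow> p \<in> B \<longrightarrow> (c, k) \<in> lnk (E - {(c, p)}) \<longrightarrow> (k < p \<longleftrightarrow> c < p)) \<and>
        (\<forall>p c d. (c, p) \<in> E \<longrightarrow> (d, p) \<in> E \<longrightarrow> (p \<in> B \<longrightarrow> (c < p \<longleftrightarrow> d < p)) \<longrightarrow> c = d)"
      unfolding half_def by (simp only: converse_iff)
    ultimately show ?thesis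
      unfolding ptree_def half_def[of A] using True
      by (simp only: inj_on_parent_slot inj_on_child_slot) blast
  next
    case False
    then have "\<not> directed_tree (tree_digraph n (edge_of A B ` E))"
      unfolding directed_tree_iff[OF n] by simp
    then show ?thesis unfolding permutrees_def ptree_def using False by blast
  qed
  have "T \<in> (\<lambda>E. edge_of A B ` E) ` {E. ptree A B n E}" if T: "T \<in> permutrees n \<delta>" for T
  proof -
    have "directed_tree (tree_digraph n T)" using T by (simp add: permutrees_def)
    then have "T = edge_of A B ` ends ` T"
      by (intro shape) (use T in \<open>simp_all add: directed_tree_iff[OF n] permutrees_def good_def\<close>)
    then show ?thesis using main[of "ends ` T"] T by auto
  qed
  then show ?thesis using main by blast
qed

lemma inj_image_edge_of: "inj_on (\<lambda>E. edge_of A B ` E) K"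
  by (rule inj_on_inverseI[of _ "\<lambda>T. ends ` T"]) simp

theorem theorem7p18:
  fixes n :: nat and \<delta> :: "nat \<Rightarrow> decoration"
  assumes "n \<ge> 2" and "\<delta> 1 = I" and "\<delta> n = I"
  shows "\<exists>f. bij_betw f (permutrees n \<delta>) (maximal_cliques (bicho n \<delta>))"
proof -
  obtain m where n: "n = Suc m" and m: "1 \<le> m" using assms(1) by (cases n) auto
  interpret bicho_graph \<delta> m
    by unfold_locales (use assms m n in auto)
  define A where "A = {i. cut_at \<delta> i False}"
  define B where "B = {i. cut_at \<delta> i True}"
  have "\<exists>f. bij_betw f (codes \<delta> m) {E. ptree A B n E}"
    using bij_betw_codes_ptree[of \<delta> m, OF assms(2)] unfolding A_def B_def n
    by (elim exE conjE) (rule exI)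
  then obtain f where f: "bij_betw f (codes \<delta> m) {E. ptree A B n E}" ..
  have "\<exists>g. bij_betw g (word_cliques \<delta> m) (codes \<delta> m)"
    using bij_betw_word_cliques_codes[of \<delta> m, OF assms(2)]
    by (elim exE conjE) (rule exI)
  then obtain g where g: "bij_betw g (word_cliques \<delta> m) (codes \<delta> m)" ..
  have "permutrees n \<delta> = (\<lambda>E. edge_of A B ` E) ` {E. ptree A B n E}"
    unfolding A_def B_def by (rule permutrees_eq) (simp add: n)
  then have trees: "bij_betw (\<lambda>E. edge_of A B ` E) {E. ptree A B n E} (permutrees n \<delta>)"
    by (intro bij_betw_imageI inj_image_edge_of) simp
  have "inj_on (\<lambda>C. route_of \<delta> ` C) (word_cliques \<delta> m)"
    by (rule inj_on_subset[OF inj_on_image_Pow[OF route_of_inj_on]])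
      (auto dest: word_cliquesD(1)[THEN subsetD])
  then have cliques: "bij_betw (\<lambda>C. route_of \<delta> ` C) (word_cliques \<delta> m) (maximal_cliques (bicho n \<delta>))"
    using maximal_cliques_eq by (simp add: bij_betw_def n)
  \<comment> \<open>The composite from word cliques through codes and relations to permutrees is
    inverted and then continued to cliques of routes.\<close>
  show ?thesis
    using bij_betw_trans[OF bij_betw_inv_into[OF bij_betw_trans[OF g bij_betw_trans[OF f trees]]] cliques]
    by blast
qed

end
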